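(* Let $T$ be a stable theory, let $M\models T$ be such that the universe of $M$ is a group $G=M$ (definable in $M$), and let $M\preceq N$. Let $q(x)\in S(N)$. Then: (1) $q$ is a weak heir over $M$ iff $q|_{\Delta_M}$ does not fork over $M$; (2) $q$ is a weak coheir over $M$ iff $q|_{\Delta_M^*}$ does not fork over $M$.
   Context: Since $T$ is stable, every externally definable subset of $M$ is definable, so the relevant algebra is ${\rm Def}(M)$ (definable subsets of $M$ with parameters) and the type space is $S(M)$ of complete 1-types; for $A\in{\rm Def}(M)$, $A^{\#}\subseteq N$ is the set defined in $N$ by the same formula. For a type $s$ over $N$ and $B\in{\rm Def}(N)$, $d_s(B)=\{h\in N:h^{-1}B\in s\}$, and similarly over $M$. Let $p=q|_M$. $q$ is a weak heir over $M$ if $d_q(A^{\#})=(d_p(A))^{\#}$ for all $A\in{\rm Def}(M)$; $q$ is a weak coheir over $M$ if for all $A\in{\rm Def}(M)$ and $s\in S(N)$, $d_s(A^{\#})\in q\iff d_s(A^{\#})\cap M\in p$. For $A\in{\rm Def}(M)$, $\varphi_A(x;y)$ is an $L(M)$-formula expressing $x\in y\cdot A$ and $\psi_A(x;y)$ one expressing $x\in A\cdot y$; $\Delta_M=\{\varphi_A:A\in{\rm Def}(M)\}$, $\Delta_M^*=\{\psi_A:A\in{\rm Def}(M)\}$. $q|_{\Delta}$ denotes the restriction of $q$ to instances (with parameters from $N$) of formulas in $\Delta$ and their negations; forking is the usual (local) forking in the stable theory $T$. *)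

theory Defs
  imports "HOL-Algebra.Coset" "HOL-Library.Equipollence"
begin

section \<open>First-order logic with parameters\<close>

text \<open>
  A language assigns an arity to each of its symbols; a symbol mapped to \<open>None\<close> does not belong
  to the language. Terms contain constants \<open>Par a\<close> for elements of structures, so that the
  \<open>L(A)\<close>-formulas are the formulas whose constants lie in \<open>A\<close>, and the \<open>L\<close>-formulas are those
  without constants.
\<close>

record ('f, 'r) lang =
  farity :: "'f \<Rightarrow> nat option"
  rarity :: "'r \<Rightarrow> nat option"

datatype ('f, 'a) tm = Var nat | Par 'a | App 'f "('f, 'a) tm list"

datatype ('f, 'r, 'a) fm =
    Equ "('f, 'a) tm" "('f, 'a) tm"
  | Rel 'r "('f, 'a) tm list"
  | Neg "('f, 'r, 'a) fm"
  | Con "('f, 'r, 'a) fm" "('f, 'r, 'a) fm"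
  | Exi nat "('f, 'r, 'a) fm"

primrec wf_tm :: "('f, 'r) lang \<Rightarrow> 'a set \<Rightarrow> ('f, 'a) tm \<Rightarrow> bool" where
  "wf_tm L A (Var n) \<longleftrightarrow> True"
| "wf_tm L A (Par a) \<longleftrightarrow> a \<in> A"
| "wf_tm L A (App f ts) \<longleftrightarrow> farity L f = Some (length ts) \<and> list_all (wf_tm L A) ts"

primrec wf_fm :: "('f, 'r) lang \<Rightarrow> 'a set \<Rightarrow> ('f, 'r, 'a) fm \<Rightarrow> bool" where
  "wf_fm L A (Equ s t) \<longleftrightarrow> wf_tm L A s \<and> wf_tm L A t"
| "wf_fm L A (Rel r ts) \<longleftrightarrow> rarity L r = Some (length ts) \<and> list_all (wf_tm L A) ts"
| "wf_fm L A (Neg \<phi>) \<longleftrightarrow> wf_fm L A \<phi>"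
| "wf_fm L A (Con \<phi> \<psi>) \<longleftrightarrow> wf_fm L A \<phi> \<and> wf_fm L A \<psi>"
| "wf_fm L A (Exi n \<phi>) \<longleftrightarrow> wf_fm L A \<phi>"

primrec fv_tm :: "('f, 'a) tm \<Rightarrow> nat set" where
  "fv_tm (Var n) = {n}"
| "fv_tm (Par a) = {}"
| "fv_tm (App f ts) = \<Union> (set (map fv_tm ts))"

primrec fv :: "('f, 'r, 'a) fm \<Rightarrow> nat set" where
  "fv (Equ s t) = fv_tm s \<union> fv_tm t"
| "fv (Rel r ts) = (\<Union>t\<in>set ts. fv_tm t)"
| "fv (Neg \<phi>) = fv \<phi>"
| "fv (Con \<phi> \<psi>) = fv \<phi> \<union> fv \<psi>"
| "fv (Exi n \<phi>) = fv \<phi> - {n}"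

definition fms :: "('f, 'r) lang \<Rightarrow> 'a set \<Rightarrow> nat \<Rightarrow> ('f, 'r, 'a) fm set" where
  "fms L A n = {\<phi>. wf_fm L A \<phi> \<and> fv \<phi> \<subseteq> {..<n}}"

text \<open>Substituting constants for free variables cannot capture variables.\<close>

primrec inst_tm :: "(nat \<rightharpoonup> 'a) \<Rightarrow> ('f, 'a) tm \<Rightarrow> ('f, 'a) tm" where
  "inst_tm \<sigma> (Var n) = (case \<sigma> n of None \<Rightarrow> Var n | Some a \<Rightarrow> Par a)"
| "inst_tm \<sigma> (Par a) = Par a"
| "inst_tm \<sigma> (App f ts) = App f (map (inst_tm \<sigma>) ts)"

primrec inst :: "(nat \<rightharpoonup> 'a) \<Rightarrow> ('f, 'r, 'a) fm \<Rightarrow> ('f, 'r, 'a) fm" where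
  "inst \<sigma> (Equ s t) = Equ (inst_tm \<sigma> s) (inst_tm \<sigma> t)"
| "inst \<sigma> (Rel r ts) = Rel r (map (inst_tm \<sigma>) ts)"
| "inst \<sigma> (Neg \<phi>) = Neg (inst \<sigma> \<phi>)"
| "inst \<sigma> (Con \<phi> \<psi>) = Con (inst \<sigma> \<phi>) (inst \<sigma> \<psi>)"
| "inst \<sigma> (Exi n \<phi>) = Exi n (inst (\<sigma>(n := None)) \<phi>)"

record ('f, 'r, 'a) str =
  univ :: "'a set"
  fun_int :: "'f \<Rightarrow> 'a list \<Rightarrow> 'a"
  rel_int :: "'r \<Rightarrow> 'a list set"

definition is_str :: "('f, 'r) lang \<Rightarrow> ('f, 'r, 'a) str \<Rightarrow> bool" where
  "is_str L M \<longleftrightarrow> univ M \<noteq> {} \<and>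
     (\<forall>f xs. farity L f = Some (length xs) \<and> set xs \<subseteq> univ M \<longrightarrow> fun_int M f xs \<in> univ M)"

primrec eval :: "('f, 'r, 'a) str \<Rightarrow> (nat \<Rightarrow> 'a) \<Rightarrow> ('f, 'a) tm \<Rightarrow> 'a" where
  "eval M e (Var n) = e n"
| "eval M e (Par a) = a"
| "eval M e (App f ts) = fun_int M f (map (eval M e) ts)"

primrec sat :: "('f, 'r, 'a) str \<Rightarrow> (nat \<Rightarrow> 'a) \<Rightarrow> ('f, 'r, 'a) fm \<Rightarrow> bool" where
  "sat M e (Equ s t) \<longleftrightarrow> eval M e s = eval M e t"
| "sat M e (Rel r ts) \<longleftrightarrow> map (eval M e) ts \<in> rel_int M r"
| "sat M e (Neg \<phi>) \<longleftrightarrow> \<not> sat M e \<phi>"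
| "sat M e (Con \<phi> \<psi>) \<longleftrightarrow> sat M e \<phi> \<and> sat M e \<psi>"
| "sat M e (Exi n \<phi>) \<longleftrightarrow> (\<exists>a\<in>univ M. sat M (e(n := a)) \<phi>)"

text \<open>\<open>holds M \<phi> [a\<^sub>0, \<dots>, a\<^sub>n\<^sub>-\<^sub>1]\<close> is used only for formulas whose free variables are below \<open>n\<close>.\<close>

definition holds :: "('f, 'r, 'a) str \<Rightarrow> ('f, 'r, 'a) fm \<Rightarrow> 'a list \<Rightarrow> bool" where
  "holds M \<phi> as = sat M ((!) as) \<phi>"

section \<open>Models, elementary extensions, stability, saturation\<close>

definition is_theory :: "('f, 'r) lang \<Rightarrow> ('f, 'r, 'a) fm set \<Rightarrow> bool" where
  "is_theory L T \<longleftrightarrow> T \<subseteq> fms L {} 0"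

definition models :: "('f, 'r) lang \<Rightarrow> ('f, 'r, 'a) str \<Rightarrow> ('f, 'r, 'a) fm set \<Rightarrow> bool" where
  "models L M T \<longleftrightarrow> is_str L M \<and> (\<forall>\<phi>\<in>T. holds M \<phi> [])"

definition elem_ext :: "('f, 'r) lang \<Rightarrow> ('f, 'r, 'a) str \<Rightarrow> ('f, 'r, 'a) str \<Rightarrow> bool" where
  "elem_ext L M N \<longleftrightarrow> is_str L M \<and> is_str L N \<and> univ M \<subseteq> univ N \<and>
     (\<forall>n. \<forall>\<phi>\<in>fms L {} n. \<forall>as. length as = n \<and> set as \<subseteq> univ M \<longrightarrow>
        (holds M \<phi> as \<longleftrightarrow> holds N \<phi> as))"

definition order_property ::
    "('f, 'r) lang \<Rightarrow> ('f, 'r, 'a) str \<Rightarrow> ('f, 'r, 'a) fm \<Rightarrow> nat \<Rightarrow> nat \<Rightarrow> bool" where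
  "order_property L M \<phi> m n \<longleftrightarrow>
     (\<exists>a b. (\<forall>i::nat. length (a i) = m \<and> set (a i) \<subseteq> univ M \<and>
                      length (b i) = n \<and> set (b i) \<subseteq> univ M) \<and>
            (\<forall>i j. holds M \<phi> (a i @ b j) \<longleftrightarrow> i < j))"

text \<open>
  No formula \<open>\<phi>(x\<^sub>1 \<dots> x\<^sub>m; y\<^sub>1 \<dots> y\<^sub>n)\<close> has the order property in a model of \<open>T\<close>. The models range
  over those whose elements come from the type \<open>'a\<close>, so the notion is the usual one only when \<open>'a\<close>
  is large enough; it is enough that \<open>'a\<close> carries an \<open>\<aleph>\<^sub>1\<close>-saturated model of each completion of \<open>T\<close>
  under consideration.
\<close>

definition stable :: "('f, 'r) lang \<Rightarrow> ('f, 'r, 'a) fm set \<Rightarrow> bool" where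
  "stable L T \<longleftrightarrow>
     (\<forall>M m n. \<forall>\<phi>\<in>fms L {} (m + n). models L M T \<longrightarrow> \<not> order_property L M \<phi> m n)"

definition realizes :: "('f, 'r, 'a) str \<Rightarrow> 'a \<Rightarrow> ('f, 'r, 'a) fm set \<Rightarrow> bool" where
  "realizes M a \<pi> \<longleftrightarrow> a \<in> univ M \<and> (\<forall>\<phi>\<in>\<pi>. holds M \<phi> [a])"

definition fin_satisfiable :: "('f, 'r, 'a) str \<Rightarrow> ('f, 'r, 'a) fm set \<Rightarrow> bool" where
  "fin_satisfiable M \<pi> \<longleftrightarrow> (\<forall>F\<subseteq>\<pi>. finite F \<longrightarrow> (\<exists>a. realizes M a F))"

text \<open>\<open>\<bar>X\<bar>\<^sup>+\<close>-saturation.\<close>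

definition saturated_above :: "('f, 'r) lang \<Rightarrow> ('f, 'r, 'a) str \<Rightarrow> 'a set \<Rightarrow> bool" where
  "saturated_above L C X \<longleftrightarrow>
     (\<forall>A \<pi>. A \<subseteq> univ C \<and> A \<lesssim> X \<and> \<pi> \<subseteq> fms L A 1 \<and> fin_satisfiable C \<pi> \<longrightarrow>
        (\<exists>a. realizes C a \<pi>))"

section \<open>Definable sets and types\<close>

definition defset :: "('f, 'r, 'a) str \<Rightarrow> ('f, 'r, 'a) fm \<Rightarrow> 'a set" where
  "defset M \<phi> = {a \<in> univ M. holds M \<phi> [a]}"

definition Def :: "('f, 'r) lang \<Rightarrow> ('f, 'r, 'a) str \<Rightarrow> 'a set set" where
  "Def L M = defset M ` fms L (univ M) 1"

text \<open>\<open>A\<^sup>#\<close>; for \<open>M \<preceq> N\<close> it does not depend on the formula chosen to define \<open>A\<close>.\<close>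

definition sharp ::
    "('f, 'r) lang \<Rightarrow> ('f, 'r, 'a) str \<Rightarrow> ('f, 'r, 'a) str \<Rightarrow> 'a set \<Rightarrow> 'a set" where
  "sharp L M N A = defset N (SOME \<phi>. \<phi> \<in> fms L (univ M) 1 \<and> defset M \<phi> = A)"

text \<open>Complete 1-types over (the universe of) \<open>N\<close>; being finitely satisfiable in \<open>N\<close> is the same
  as being consistent with the elementary diagram of \<open>N\<close>.\<close>

definition types1 :: "('f, 'r) lang \<Rightarrow> ('f, 'r, 'a) str \<Rightarrow> ('f, 'r, 'a) fm set set" where
  "types1 L N = {q. q \<subseteq> fms L (univ N) 1 \<and> fin_satisfiable N q \<and>
                    (\<forall>\<phi>\<in>fms L (univ N) 1. \<phi> \<in> q \<or> Neg \<phi> \<in> q)}"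

definition restr_type ::
    "('f, 'r) lang \<Rightarrow> ('f, 'r, 'a) fm set \<Rightarrow> ('f, 'r, 'a) str \<Rightarrow> ('f, 'r, 'a) fm set" where
  "restr_type L q M = q \<inter> fms L (univ M) 1"

text \<open>A type over \<open>N\<close> viewed as an ultrafilter: \<open>B \<in> q\<close> for \<open>B \<in> Def(N)\<close>.\<close>

definition set_in_type :: "('f, 'r, 'a) str \<Rightarrow> 'a set \<Rightarrow> ('f, 'r, 'a) fm set \<Rightarrow> bool" where
  "set_in_type N B q \<longleftrightarrow> (\<exists>\<phi>\<in>q. defset N \<phi> = B)"

section \<open>Definable groups, weak heirs and weak coheirs\<close>

text \<open>
  The group on the whole universe of \<open>M\<close> whose multiplication has as its graph the set defined by
  \<open>\<mu>(x, y, z)\<close>. For \<open>M \<preceq> N\<close>, \<open>group_of N \<mu>\<close> is the group defined in \<open>N\<close> by the same formula.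
\<close>

definition group_of :: "('f, 'r, 'a) str \<Rightarrow> ('f, 'r, 'a) fm \<Rightarrow> 'a monoid" where
  "group_of M \<mu> =
     (let m = (\<lambda>x y. THE z. z \<in> univ M \<and> holds M \<mu> [x, y, z])
      in \<lparr>carrier = univ M, mult = m,
          one = (THE e. e \<in> univ M \<and> (\<forall>x\<in>univ M. m e x = x \<and> m x e = x))\<rparr>)"

definition defines_group ::
    "('f, 'r) lang \<Rightarrow> ('f, 'r, 'a) str \<Rightarrow> ('f, 'r, 'a) fm \<Rightarrow> bool" where
  "defines_group L M \<mu> \<longleftrightarrow> \<mu> \<in> fms L (univ M) 3 \<and>
     (\<forall>x\<in>univ M. \<forall>y\<in>univ M. \<exists>!z. z \<in> univ M \<and> holds M \<mu> [x, y, z]) \<and>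
     group (group_of M \<mu>)"

definition dset ::
    "('f, 'r, 'a) str \<Rightarrow> ('f, 'r, 'a) fm \<Rightarrow> ('f, 'r, 'a) fm set \<Rightarrow> 'a set \<Rightarrow> 'a set" where
  "dset N \<mu> s B =
     {h \<in> univ N. set_in_type N (inv\<^bsub>group_of N \<mu>\<^esub> h <#\<^bsub>group_of N \<mu>\<^esub> B) s}"

definition weak_heir ::
    "('f, 'r) lang \<Rightarrow> ('f, 'r, 'a) str \<Rightarrow> ('f, 'r, 'a) str \<Rightarrow> ('f, 'r, 'a) fm \<Rightarrow>
     ('f, 'r, 'a) fm set \<Rightarrow> bool" where
  "weak_heir L M N \<mu> q \<longleftrightarrow>
     (\<forall>A\<in>Def L M. dset N \<mu> q (sharp L M N A) = sharp L M N (dset M \<mu> (restr_type L q M) A))"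

definition weak_coheir ::
    "('f, 'r) lang \<Rightarrow> ('f, 'r, 'a) str \<Rightarrow> ('f, 'r, 'a) str \<Rightarrow> ('f, 'r, 'a) fm \<Rightarrow>
     ('f, 'r, 'a) fm set \<Rightarrow> bool" where
  "weak_coheir L M N \<mu> q \<longleftrightarrow>
     (\<forall>A\<in>Def L M. \<forall>s\<in>types1 L N.
        set_in_type N (dset N \<mu> s (sharp L M N A)) q \<longleftrightarrow>
        set_in_type M (dset N \<mu> s (sharp L M N A) \<inter> univ M) (restr_type L q M))"

text \<open>In \<open>\<phi>(x; y)\<close> the variable \<open>x\<close> has index 0 and \<open>y\<close> has index 1.\<close>

definition expresses_left ::
    "('f, 'r) lang \<Rightarrow> ('f, 'r, 'a) str \<Rightarrow> ('f, 'r, 'a) fm \<Rightarrow> 'a set \<Rightarrow> ('f, 'r, 'a) fm \<Rightarrow> bool" where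
  "expresses_left L M \<mu> A \<phi> \<longleftrightarrow> \<phi> \<in> fms L (univ M) 2 \<and>
     (\<forall>x\<in>univ M. \<forall>y\<in>univ M. holds M \<phi> [x, y] \<longleftrightarrow> x \<in> y <#\<^bsub>group_of M \<mu>\<^esub> A)"

definition expresses_right ::
    "('f, 'r) lang \<Rightarrow> ('f, 'r, 'a) str \<Rightarrow> ('f, 'r, 'a) fm \<Rightarrow> 'a set \<Rightarrow> ('f, 'r, 'a) fm \<Rightarrow> bool" where
  "expresses_right L M \<mu> A \<phi> \<longleftrightarrow> \<phi> \<in> fms L (univ M) 2 \<and>
     (\<forall>x\<in>univ M. \<forall>y\<in>univ M. holds M \<phi> [x, y] \<longleftrightarrow> x \<in> A #>\<^bsub>group_of M \<mu>\<^esub> y)"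

definition restr_to ::
    "('f, 'r, 'a) str \<Rightarrow> ('f, 'r, 'a) fm set \<Rightarrow> ('f, 'r, 'a) fm set \<Rightarrow> ('f, 'r, 'a) fm set" where
  "restr_to N q \<Delta> = {\<theta> \<in> q. \<exists>\<phi>\<in>\<Delta>. \<exists>b\<in>univ N.
                       \<theta> = inst [1 \<mapsto> b] \<phi> \<or> \<theta> = Neg (inst [1 \<mapsto> b] \<phi>)}"

section \<open>Dividing and forking\<close>

definition same_type :: "('f, 'r) lang \<Rightarrow> ('f, 'r, 'a) str \<Rightarrow> 'a set \<Rightarrow> 'a list \<Rightarrow> 'a list \<Rightarrow> bool" where
  "same_type L C A b c \<longleftrightarrow> length b = length c \<and>
     (\<forall>\<theta>\<in>fms L A (length b). holds C \<theta> b \<longleftrightarrow> holds C \<theta> c)"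

text \<open>
  Shelah's definitions, evaluated in a sufficiently saturated model \<open>C\<close>. The formula \<open>\<phi>(x, b)\<close>
  divides over \<open>A\<close> if for some \<open>k\<close> there are \<open>b\<^sub>0, b\<^sub>1, \<dots>\<close> with the type of \<open>b\<close> over \<open>A\<close> such that
  \<open>{\<phi>(x, b\<^sub>i) : i < \<omega>}\<close> is \<open>k\<close>-inconsistent.
\<close>

definition divides ::
    "('f, 'r) lang \<Rightarrow> ('f, 'r, 'a) str \<Rightarrow> 'a set \<Rightarrow> ('f, 'r, 'a) fm \<Rightarrow> 'a list \<Rightarrow> bool" where
  "divides L C A \<phi> b \<longleftrightarrow> \<phi> \<in> fms L {} (Suc (length b)) \<and> set b \<subseteq> univ C \<and>
     (\<exists>k bs. (\<forall>i::nat. set (bs i) \<subseteq> univ C \<and> same_type L C A b (bs i)) \<and>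
             (\<forall>I. finite I \<and> card I = k \<longrightarrow>
                \<not> (\<exists>a\<in>univ C. \<forall>i\<in>I. holds C \<phi> (a # bs i))))"

text \<open>
  A partial type \<open>\<pi>(x)\<close> forks over \<open>A\<close> if it implies a finite disjunction of formulas that divide
  over \<open>A\<close>. If \<open>C\<close> is saturated over the parameters of \<open>\<pi>\<close>, the implication can be tested on the
  realizations of \<open>\<pi>\<close> in \<open>C\<close>.
\<close>

definition forks ::
    "('f, 'r) lang \<Rightarrow> ('f, 'r, 'a) str \<Rightarrow> 'a set \<Rightarrow> ('f, 'r, 'a) fm set \<Rightarrow> bool" where
  "forks L C A \<pi> \<longleftrightarrow>
     (\<exists>D. finite D \<and> (\<forall>(\<phi>, b)\<in>D. divides L C A \<phi> b) \<and>
          (\<forall>a. realizes C a \<pi> \<longrightarrow> (\<exists>(\<phi>, b)\<in>D. holds C \<phi> (a # b))))"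

end

theory Submission
  imports Defs "HOL-Library.Ramsey"
begin

text \<open>
  Extend \<open>p = q|\<^sub>M\<close> to an ultrafilter \<open>U\<close> on \<open>M\<close>. Its limit type, consisting of the \<open>\<theta>(x, c)\<close> with
  \<open>C \<Turnstile> \<theta>(m, c)\<close> for \<open>U\<close>-almost all \<open>m\<close>, is an \<open>M\<close>-invariant coheir of \<open>p\<close>, hence contains no formula
  dividing over \<open>M\<close>. Conversely, let \<open>\<phi>(x, b) \<in> q\<close> lie outside the limit type, and let \<open>V\<close> be an
  ultrafilter on \<open>M\<close> that generates the type of \<open>b\<close> over \<open>M\<close>. Stability makes iterated limits along
  \<open>U\<close> and \<open>V\<close> commute, so \<open>U\<close>-almost all \<open>m\<close> satisfy \<open>\<phi>(m, c)\<close> only for \<open>V\<close>-few \<open>c\<close>, and finitely many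
  instances of \<open>\<phi>\<close> over \<open>M\<close> imply this property of \<open>x\<close>. Together with \<open>\<phi>(x, b)\<close> they divide over \<open>M\<close>
  along a Morley sequence of the limit type of \<open>V\<close>. Therefore \<open>q|\<^sub>\<Delta>\<close> does not fork over \<open>M\<close> iff it agrees
  with the limit type of \<open>U\<close>, and the two parts of the theorem spell out this agreement using that
  limits along an ultrafilter are Boolean combinations of instances over \<open>M\<close>, which for the
  formulas \<open>x \<in> y \<cdot> A\<close> and \<open>x \<in> A \<cdot> y\<close> are translates of \<open>A\<close>.
\<close>

section \<open>Substitution\<close>

text \<open>Two restrictions shape the construction. \<open>C\<close> is saturated only over sets no
  larger than \<open>univ N\<close>, so a Morley sequence is built one element at a time, over
  \<open>univ N\<close> and finitely many earlier elements. And \<open>divides\<close>,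
  \<open>elem_ext\<close> and \<open>order_property\<close> accept only formulas without constants,
  so parameters must travel in the tuples. Most arguments therefore concern relations for which some
  formula exists; formulas are written down only at the ends. An ultrafilter extends
  \<open>p\<close> to all of \<open>C\<close> without any prior theory of forking: what holds almost
  everywhere has a witness in \<open>M\<close>, and tuples of the same type over \<open>M\<close>
  satisfy the same formulas with such a witness. Definability of types and symmetry become two facts
  about relations without infinite orders, finite separation and commuting limits. A formula outside
  the limit type need not divide by itself: it may follow from another formula over \<open>M\<close>
  that does not divide. The added instances over \<open>M\<close> exclude this by forcing the limit
  of \<open>x\<close> along \<open>V\<close> to be false. How long a Morley sequence must then be to
  become inconsistent is not computed; a bound exists because otherwise an order appears.\<close>

lemma eval_cong:
  assumes "\<And>i. i \<in> fv_tm t \<Longrightarrow> e i = e' i"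
  shows "eval M e t = eval M e' t"
  using assms
proof (induction t)
  case (App f ts)
  have "map (eval M e) ts = map (eval M e') ts"
    using App by fastforce
  then show ?case by (metis eval.simps(3))
qed auto

lemma sat_cong:
  assumes "\<And>i. i \<in> fv \<phi> \<Longrightarrow> e i = e' i"
  shows "sat M e \<phi> \<longleftrightarrow> sat M e' \<phi>"
  using assms
proof (induction \<phi> arbitrary: e e')
  case (Equ s t)
  have "eval M e s = eval M e' s" "eval M e t = eval M e' t"
    using Equ by (auto intro!: eval_cong)
  then show ?case by simp
next
  case (Rel r ts)
  have "map (eval M e) ts = map (eval M e') ts"
    using Rel by (auto intro!: eval_cong)
  then show ?case by (metis sat.simps(2))
next
  case (Neg \<phi>)
  then show ?case by (metis fv.simps(3) sat.simps(3))
next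
  case (Con \<phi> \<psi>)
  then show ?case by (metis Un_iff fv.simps(4) sat.simps(4))
next
  case (Exi n \<phi>)
  have "sat M (e(n := a)) \<phi> \<longleftrightarrow> sat M (e'(n := a)) \<phi>" for a
    by (rule Exi.IH) (use Exi.prems in auto)
  then show ?case by simp
qed

lemma holds_eq_sat:
  assumes "\<phi> \<in> fms L A n" "\<And>i. i < n \<Longrightarrow> e i = as ! i"
  shows "holds M \<phi> as \<longleftrightarrow> sat M e \<phi>"
  unfolding holds_def using assms by (intro sat_cong) (auto simp: fms_def)

lemma wf_tm_mono: "\<lbrakk>wf_tm L A t; A \<subseteq> B\<rbrakk> \<Longrightarrow> wf_tm L B t"
  by (induction t) (auto simp: list_all_iff)

lemma wf_fm_mono: "\<lbrakk>wf_fm L A \<phi>; A \<subseteq> B\<rbrakk> \<Longrightarrow> wf_fm L B \<phi>"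
  by (induction \<phi>) (auto simp: list_all_iff intro: wf_tm_mono)

lemma fms_mono: "\<lbrakk>\<phi> \<in> fms L A n; A \<subseteq> B; n \<le> m\<rbrakk> \<Longrightarrow> \<phi> \<in> fms L B m"
  by (auto simp: fms_def intro: wf_fm_mono)

section \<open>Instances of formulas at constants\<close>

lemma eval_inst_tm:
  "eval M e (inst_tm \<sigma> t) = eval M (\<lambda>i. case \<sigma> i of None \<Rightarrow> e i | Some a \<Rightarrow> a) t"
  by (induction t) (auto split: option.splits intro!: arg_cong2[where f = "fun_int M"])

lemma sat_inst:
  "sat M e (inst \<sigma> \<phi>) \<longleftrightarrow> sat M (\<lambda>i. case \<sigma> i of None \<Rightarrow> e i | Some a \<Rightarrow> a) \<phi>"
proof (induction \<phi> arbitrary: e \<sigma>)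
  case (Exi n \<phi>)
  have "(\<lambda>i. case (\<sigma>(n := None)) i of None \<Rightarrow> (e(n := a)) i | Some a \<Rightarrow> a) =
        (\<lambda>i. case \<sigma> i of None \<Rightarrow> e i | Some a \<Rightarrow> a)(n := a)" for a
    by (auto split: option.splits)
  then show ?case by (simp add: Exi.IH)
qed (auto simp: eval_inst_tm comp_def)

lemma fv_inst_tm: "fv_tm (inst_tm \<sigma> t) = fv_tm t - dom \<sigma>"
  by (induction t) (auto split: option.splits)

lemma fv_inst: "fv (inst \<sigma> \<phi>) = fv \<phi> - dom \<sigma>"
  by (induction \<phi> arbitrary: \<sigma>) (auto simp: fv_inst_tm)

lemma wf_inst_tm: "\<lbrakk>wf_tm L A t; ran \<sigma> \<subseteq> A\<rbrakk> \<Longrightarrow> wf_tm L A (inst_tm \<sigma> t)"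
  by (induction t) (auto simp: list_all_iff ran_def split: option.splits)

lemma wf_inst: "\<lbrakk>wf_fm L A \<phi>; ran \<sigma> \<subseteq> A\<rbrakk> \<Longrightarrow> wf_fm L A (inst \<sigma> \<phi>)"
proof (induction \<phi> arbitrary: \<sigma>)
  case (Exi n \<phi>)
  have "ran (\<sigma>(n := None)) \<subseteq> A"
    using Exi.prems(2) by (auto simp: ran_def)
  then show ?case using Exi by simp
qed (auto simp: list_all_iff wf_inst_tm)

lemma inst_1_fms:
  assumes "\<phi> \<in> fms L A 2" "b \<in> A"
  shows "inst [1 \<mapsto> b] \<phi> \<in> fms L A 1"
proof -
  have "i < 1" if "i \<in> fv \<phi> - {1}" for i
    using that assms(1) by (force simp: fms_def)
  moreover have "wf_fm L A (inst [1 \<mapsto> b] \<phi>)"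
    using assms by (intro wf_inst) (auto simp: fms_def)
  ultimately show ?thesis by (auto simp: fms_def fv_inst)
qed

lemma holds_inst_1:
  assumes "\<phi> \<in> fms L A 2"
  shows "holds M (inst [1 \<mapsto> b] \<phi>) [a] \<longleftrightarrow> holds M \<phi> [a, b]"
proof -
  show ?thesis
    unfolding holds_def sat_inst
    by (intro sat_cong) (use assms in \<open>fastforce simp: fms_def nth_Cons split: nat.splits\<close>)
qed

text \<open>Substitution is specified by its effect and not by a recursive function, since only
  well-formedness, free variables and values of the result are used later. \<open>g\<close> treats
  variables, \<open>h\<close> parameters, and \<open>F\<close> bounds the new variables.\<close>

lemma subst_tm_exists:
  fixes t :: "('f, 'a) tm"
  assumes "\<And>i. i \<in> fv_tm t \<Longrightarrow> wf_tm L B (g i) \<and> fv_tm (g i) \<subseteq> F"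
    and "\<And>a. a \<in> A \<Longrightarrow> wf_tm L B (h a) \<and> fv_tm (h a) \<subseteq> F"
    and "wf_tm L A t"
  shows "\<exists>s. wf_tm L B s \<and> fv_tm s \<subseteq> F \<and>
     (\<forall>(M :: ('f, 'r, 'a) str) e e'. (\<forall>i\<in>fv_tm t. eval M e' (g i) = e i) \<and> (\<forall>a\<in>A. eval M e' (h a) = a) \<longrightarrow>
        eval M e' s = eval M e t)"
  using assms
proof (induction t)
  case (Var n)
  then show ?case by (intro exI[of _ "g n"]) auto
next
  case (Par a)
  then show ?case by (intro exI[of _ "h a"]) auto
next
  case (App f ts)
  have "\<forall>t\<in>set ts. \<exists>s. wf_tm L B s \<and> fv_tm s \<subseteq> F \<and>
     (\<forall>(M :: ('f, 'r, 'a) str) e e'. (\<forall>i\<in>fv_tm t. eval M e' (g i) = e i) \<and> (\<forall>a\<in>A. eval M e' (h a) = a) \<longrightarrow>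
        eval M e' s = eval M e t)"
  proof
    fix t assume "t \<in> set ts"
    then show "\<exists>s. wf_tm L B s \<and> fv_tm s \<subseteq> F \<and>
     (\<forall>(M :: ('f, 'r, 'a) str) e e'. (\<forall>i\<in>fv_tm t. eval M e' (g i) = e i) \<and> (\<forall>a\<in>A. eval M e' (h a) = a) \<longrightarrow>
        eval M e' s = eval M e t)"
      using App.prems by (intro App.IH) (auto simp: list_all_iff)
  qed
  from bchoice[OF this] obtain S where S: "\<And>t. t \<in> set ts \<Longrightarrow> wf_tm L B (S t) \<and> fv_tm (S t) \<subseteq> F \<and>
     (\<forall>(M :: ('f, 'r, 'a) str) e e'. (\<forall>i\<in>fv_tm t. eval M e' (g i) = e i) \<and> (\<forall>a\<in>A. eval M e' (h a) = a) \<longrightarrow>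
        eval M e' (S t) = eval M e t)" by blast
  show ?case
    using S App.prems(3)
    by (intro exI[of _ "App f (map S ts)"])
      (auto simp: list_all_iff comp_def subset_iff intro!: arg_cong2[where f = "fun_int _"])
qed

lemma finite_fv_tm: "finite (fv_tm t)"
  by (induction t) auto

lemma finite_fv: "finite (fv \<phi>)"
  by (induction \<phi>) (auto simp: finite_fv_tm)

lemma subst_tms_exist:
  fixes ts :: "('f, 'a) tm list"
  assumes "\<And>i t. t \<in> set ts \<Longrightarrow> i \<in> fv_tm t \<Longrightarrow> wf_tm L B (g i) \<and> fv_tm (g i) \<subseteq> F"
    and "\<And>a. a \<in> A \<Longrightarrow> wf_tm L B (h a) \<and> fv_tm (h a) \<subseteq> F"
    and "\<And>t. t \<in> set ts \<Longrightarrow> wf_tm L A t"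
  shows "\<exists>S. \<forall>t\<in>set ts. wf_tm L B (S t) \<and> fv_tm (S t) \<subseteq> F \<and>
     (\<forall>(M :: ('f, 'r, 'a) str) e e'. (\<forall>i\<in>fv_tm t. eval M e' (g i) = e i) \<and> (\<forall>a\<in>A. eval M e' (h a) = a) \<longrightarrow>
        eval M e' (S t) = eval M e t)"
  by (rule bchoice, rule ballI, rule subst_tm_exists) (use assms in auto)

text \<open>Both variables and parameters are replaced by terms, with bound variables renamed as
  needed: with \<open>h = Par\<close> this is ordinary substitution, with \<open>h a\<close> a variable it abstracts from
  the parameters.\<close>

lemma subst_fm_exists:
  fixes \<phi> :: "('f, 'r, 'a) fm"
  assumes "finite A"
    and "\<And>i. i \<in> fv \<phi> \<Longrightarrow> wf_tm L B (g i) \<and> fv_tm (g i) \<subseteq> F"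
    and "\<And>a. a \<in> A \<Longrightarrow> wf_tm L B (h a) \<and> fv_tm (h a) \<subseteq> F"
    and "wf_fm L A \<phi>"
  shows "\<exists>\<psi>. wf_fm L B \<psi> \<and> fv \<psi> \<subseteq> F \<and>
     (\<forall>(M :: ('f, 'r, 'a) str) e e'. (\<forall>i\<in>fv \<phi>. eval M e' (g i) = e i) \<and> (\<forall>a\<in>A. eval M e' (h a) = a) \<longrightarrow>
        (sat M e' \<psi> \<longleftrightarrow> sat M e \<phi>))"
  using assms
proof (induction \<phi> arbitrary: g F)
  case (Equ s t)
  have "\<exists>S. \<forall>u\<in>set [s, t]. wf_tm L B (S u) \<and> fv_tm (S u) \<subseteq> F \<and>
     (\<forall>(M :: ('f, 'r, 'a) str) e e'. (\<forall>i\<in>fv_tm u. eval M e' (g i) = e i) \<and>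
        (\<forall>a\<in>A. eval M e' (h a) = a) \<longrightarrow> eval M e' (S u) = eval M e u)"
    by (rule subst_tms_exist) (use Equ.prems in auto)
  then obtain S where S: "\<And>u. u \<in> set [s, t] \<Longrightarrow> wf_tm L B (S u) \<and> fv_tm (S u) \<subseteq> F \<and>
     (\<forall>(M :: ('f, 'r, 'a) str) e e'. (\<forall>i\<in>fv_tm u. eval M e' (g i) = e i) \<and>
        (\<forall>a\<in>A. eval M e' (h a) = a) \<longrightarrow> eval M e' (S u) = eval M e u)"
    by blast
  show ?case
  proof (intro exI[of _ "Equ (S s) (S t)"] conjI allI impI)
    fix M :: "('f, 'r, 'a) str" and e e'
    assume "(\<forall>i\<in>fv (Equ s t :: ('f, 'r, 'a) fm). eval M e' (g i) = e i) \<and> (\<forall>a\<in>A. eval M e' (h a) = a)"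
    then have "eval M e' (S s) = eval M e s" "eval M e' (S t) = eval M e t"
      using S by auto
    then show "sat M e' (Equ (S s) (S t)) \<longleftrightarrow> sat M e (Equ s t)" by simp
  qed (use S in auto)
next
  case (Rel r ts)
  have "\<exists>S. \<forall>u\<in>set ts. wf_tm L B (S u) \<and> fv_tm (S u) \<subseteq> F \<and>
     (\<forall>(M :: ('f, 'r, 'a) str) e e'. (\<forall>i\<in>fv_tm u. eval M e' (g i) = e i) \<and>
        (\<forall>a\<in>A. eval M e' (h a) = a) \<longrightarrow> eval M e' (S u) = eval M e u)"
    by (rule subst_tms_exist) (use Rel.prems in \<open>auto simp: list_all_iff\<close>)
  then obtain S where S: "\<And>u. u \<in> set ts \<Longrightarrow> wf_tm L B (S u) \<and> fv_tm (S u) \<subseteq> F \<and>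
     (\<forall>(M :: ('f, 'r, 'a) str) e e'. (\<forall>i\<in>fv_tm u. eval M e' (g i) = e i) \<and>
        (\<forall>a\<in>A. eval M e' (h a) = a) \<longrightarrow> eval M e' (S u) = eval M e u)"
    by blast
  show ?case
  proof (intro exI[of _ "Rel r (map S ts)"] conjI allI impI)
    fix M :: "('f, 'r, 'a) str" and e e'
    assume "(\<forall>i\<in>fv (Rel r ts :: ('f, 'r, 'a) fm). eval M e' (g i) = e i) \<and> (\<forall>a\<in>A. eval M e' (h a) = a)"
    then have "map (eval M e') (map S ts) = map (eval M e) ts"
      using S by auto
    then show "sat M e' (Rel r (map S ts)) \<longleftrightarrow> sat M e (Rel r ts)" by (metis sat.simps(2))
  qed (use S Rel.prems(4) in \<open>auto simp: list_all_iff\<close>)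
next
  case (Neg \<phi>)
  then obtain \<psi> where "wf_fm L B \<psi> \<and> fv \<psi> \<subseteq> F \<and>
     (\<forall>(M :: ('f, 'r, 'a) str) e e'. (\<forall>i\<in>fv \<phi>. eval M e' (g i) = e i) \<and> (\<forall>a\<in>A. eval M e' (h a) = a) \<longrightarrow>
        (sat M e' \<psi> \<longleftrightarrow> sat M e \<phi>))"
    by (metis fv.simps(3) wf_fm.simps(3))
  then show ?case by (intro exI[of _ "Neg \<psi>"]) auto
next
  case (Con \<phi>1 \<phi>2)
  have "\<exists>\<psi>. wf_fm L B \<psi> \<and> fv \<psi> \<subseteq> F \<and>
     (\<forall>(M :: ('f, 'r, 'a) str) e e'. (\<forall>i\<in>fv \<phi>1. eval M e' (g i) = e i) \<and> (\<forall>a\<in>A. eval M e' (h a) = a) \<longrightarrow>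
        (sat M e' \<psi> \<longleftrightarrow> sat M e \<phi>1))"
    by (rule Con.IH(1)) (use Con.prems in auto)
  moreover have "\<exists>\<psi>. wf_fm L B \<psi> \<and> fv \<psi> \<subseteq> F \<and>
     (\<forall>(M :: ('f, 'r, 'a) str) e e'. (\<forall>i\<in>fv \<phi>2. eval M e' (g i) = e i) \<and> (\<forall>a\<in>A. eval M e' (h a) = a) \<longrightarrow>
        (sat M e' \<psi> \<longleftrightarrow> sat M e \<phi>2))"
    by (rule Con.IH(2)) (use Con.prems in auto)
  ultimately obtain \<psi>1 \<psi>2 where
    "wf_fm L B \<psi>1 \<and> fv \<psi>1 \<subseteq> F \<and>
     (\<forall>(M :: ('f, 'r, 'a) str) e e'. (\<forall>i\<in>fv \<phi>1. eval M e' (g i) = e i) \<and> (\<forall>a\<in>A. eval M e' (h a) = a) \<longrightarrow>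
        (sat M e' \<psi>1 \<longleftrightarrow> sat M e \<phi>1))"
    "wf_fm L B \<psi>2 \<and> fv \<psi>2 \<subseteq> F \<and>
     (\<forall>(M :: ('f, 'r, 'a) str) e e'. (\<forall>i\<in>fv \<phi>2. eval M e' (g i) = e i) \<and> (\<forall>a\<in>A. eval M e' (h a) = a) \<longrightarrow>
        (sat M e' \<psi>2 \<longleftrightarrow> sat M e \<phi>2))"
    by blast
  note \<psi> = this
  show ?case
  proof (intro exI[of _ "Con \<psi>1 \<psi>2"] conjI allI impI)
    fix M :: "('f, 'r, 'a) str" and e e'
    assume "(\<forall>i\<in>fv (Con \<phi>1 \<phi>2). eval M e' (g i) = e i) \<and> (\<forall>a\<in>A. eval M e' (h a) = a)"
    then have "sat M e' \<psi>1 \<longleftrightarrow> sat M e \<phi>1" "sat M e' \<psi>2 \<longleftrightarrow> sat M e \<phi>2"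
      using \<psi> by (simp_all add: ball_Un)
    then show "sat M e' (Con \<psi>1 \<psi>2) \<longleftrightarrow> sat M e (Con \<phi>1 \<phi>2)" by simp
  qed (use \<psi> in auto)
next
  case (Exi n \<phi>)
  \<comment> \<open>The bound variable is renamed to an \<open>m\<close> that no substituted term
    mentions, so nothing is captured. The induction hypothesis is used with \<open>g\<close> sending
    \<open>n\<close> to \<open>Var m\<close> and with \<open>m\<close> added to
    \<open>F\<close>.\<close>
  define V where "V = (\<Union>i\<in>fv \<phi>. fv_tm (g i)) \<union> (\<Union>a\<in>A. fv_tm (h a))"
  have "finite V" using Exi.prems(1) by (simp add: V_def finite_fv finite_fv_tm)
  then obtain m where m: "m \<notin> V" using ex_new_if_finite infinite_UNIV_nat by metis
  have "\<exists>\<psi>. wf_fm L B \<psi> \<and> fv \<psi> \<subseteq> insert m F \<and>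
     (\<forall>(M :: ('f, 'r, 'a) str) e e'. (\<forall>i\<in>fv \<phi>. eval M e' ((g(n := Var m)) i) = e i) \<and> (\<forall>a\<in>A. eval M e' (h a) = a) \<longrightarrow>
        (sat M e' \<psi> \<longleftrightarrow> sat M e \<phi>))"
    by (rule Exi.IH) (use Exi.prems in auto)
  then obtain \<psi> where \<psi>: "wf_fm L B \<psi>" "fv \<psi> \<subseteq> insert m F" and
    sat: "\<And>M e e'. \<forall>i\<in>fv \<phi>. eval M e' ((g(n := Var m)) i) = e i \<Longrightarrow>
       \<forall>a\<in>A. eval M e' (h a) = a \<Longrightarrow> sat M e' \<psi> \<longleftrightarrow> sat M e \<phi>"
    by blast
  have step: "sat M (e'(m := a)) \<psi> \<longleftrightarrow> sat M (e(n := a)) \<phi>"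
    if "\<forall>i\<in>fv \<phi> - {n}. eval M e' (g i) = e i" "\<forall>a\<in>A. eval M e' (h a) = a" for M e e' a
  proof (rule sat)
    have eq: "eval M (e'(m := a)) t = eval M e' t" if "fv_tm t \<subseteq> V" for t
      by (rule eval_cong) (use that m in auto)
    have "eval M (e'(m := a)) (g i) = eval M e' (g i)" if "i \<in> fv \<phi>" for i
      by (rule eq) (use that in \<open>auto simp: V_def\<close>)
    then show "\<forall>i\<in>fv \<phi>. eval M (e'(m := a)) ((g(n := Var m)) i) = (e(n := a)) i"
      using that(1) by auto
    have "eval M (e'(m := a)) (h b) = eval M e' (h b)" if "b \<in> A" for b
      by (rule eq) (use that in \<open>auto simp: V_def\<close>)
    then show "\<forall>b\<in>A. eval M (e'(m := a)) (h b) = b"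
      using that(2) by auto
  qed
  show ?case
  proof (intro exI[of _ "Exi m \<psi>"] conjI allI impI)
    fix M :: "('f, 'r, 'a) str" and e e'
    assume "(\<forall>i\<in>fv (Exi n \<phi>). eval M e' (g i) = e i) \<and> (\<forall>a\<in>A. eval M e' (h a) = a)"
    then have "sat M (e'(m := a)) \<psi> \<longleftrightarrow> sat M (e(n := a)) \<phi>" for a
      by (intro step) auto
    then show "sat M e' (Exi m \<psi>) \<longleftrightarrow> sat M e (Exi n \<phi>)" by simp
  qed (use \<psi> in auto)
qed

lemma wf_tms_finite_params:
  assumes "\<And>t. t \<in> set ts \<Longrightarrow> \<exists>P. finite P \<and> P \<subseteq> A \<and> wf_tm L P t"
  shows "\<exists>P. finite P \<and> P \<subseteq> A \<and> list_all (wf_tm L P) ts"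
proof -
  obtain P where P: "\<And>t. t \<in> set ts \<Longrightarrow> finite (P t) \<and> P t \<subseteq> A \<and> wf_tm L (P t) t"
    using assms by metis
  then have "list_all (wf_tm L (\<Union>(P ` set ts))) ts"
    unfolding list_all_iff by (meson UN_upper wf_tm_mono)
  then show ?thesis using P by (intro exI[of _ "\<Union>(P ` set ts)"]) auto
qed

lemma wf_tm_finite_params: "wf_tm L A t \<Longrightarrow> \<exists>P. finite P \<and> P \<subseteq> A \<and> wf_tm L P t"
proof (induction t)
  case (Par a)
  then show ?case by (intro exI[of _ "{a}"]) auto
next
  case (App f ts)
  then show ?case using wf_tms_finite_params[of ts A L] by (auto simp: list_all_iff)
qed auto

text \<open>A formula is a finite object. Finiteness of the parameter set leaves a fresh variable
  for \<open>subst_fm_exists\<close> and lets the parameters be listed in a tuple.\<close>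

lemma wf_fm_finite_params: "wf_fm L A \<phi> \<Longrightarrow> \<exists>P. finite P \<and> P \<subseteq> A \<and> wf_fm L P \<phi>"
proof (induction \<phi>)
  case (Equ s t)
  then show ?case
    using wf_tms_finite_params[of "[s, t]" A L] wf_tm_finite_params[of L A] by auto
next
  case (Rel r ts)
  then show ?case
    using wf_tms_finite_params[of ts A L] wf_tm_finite_params[of L A] by (auto simp: list_all_iff)
next
  case (Con \<phi> \<psi>)
  then obtain P Q where "finite P" "P \<subseteq> A" "wf_fm L P \<phi>" "finite Q" "Q \<subseteq> A" "wf_fm L Q \<psi>"
    by auto
  then show ?case
    by (intro exI[of _ "P \<union> Q"]) (auto intro: wf_fm_mono)
qed auto

section \<open>Relations expressed by formulas\<close>

text \<open>One formula has to serve all structures \<open>K\<close> that contain the parameters;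
  this uniformity makes a relation transfer along elementary extensions. \<open>R\<close> takes
  \<open>K\<close> as an argument because its quantifiers range over \<open>univ K\<close>.\<close>

definition expressible ::
    "('f, 'r) lang \<Rightarrow> 'a set \<Rightarrow> nat \<Rightarrow> (('f, 'r, 'a) str \<Rightarrow> 'a list \<Rightarrow> bool) \<Rightarrow> bool" where
  "expressible L A n R \<longleftrightarrow> (\<exists>\<phi>\<in>fms L A n. \<forall>K as. length as = n \<longrightarrow> A \<union> set as \<subseteq> univ K \<longrightarrow>
     (holds K \<phi> as \<longleftrightarrow> R K as))"

lemma expressibleE:
  assumes "expressible L A n R"
  obtains \<phi> where "\<phi> \<in> fms L A n"
    "\<forall>K as. length as = n \<longrightarrow> A \<union> set as \<subseteq> univ K \<longrightarrow> (holds K \<phi> as \<longleftrightarrow> R K as)"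
  using assms by (auto simp: expressible_def)

lemma expressible_holds: "\<phi> \<in> fms L A n \<Longrightarrow> expressible L A n (\<lambda>K as. holds K \<phi> as)"
  by (auto simp: expressible_def)

lemma expressible_cong:
  assumes "expressible L A n R"
    "\<And>K as. \<lbrakk>length as = n; A \<subseteq> univ K; set as \<subseteq> univ K\<rbrakk> \<Longrightarrow> R K as \<longleftrightarrow> S K as"
  shows "expressible L A n S"
  using assms by (auto simp: expressible_def)

lemma expressible_mono:
  assumes "expressible L A n R" "A \<subseteq> B"
  shows "expressible L B n R"
proof -
  obtain \<phi> where "\<phi> \<in> fms L A n"
    "\<forall>K as. length as = n \<longrightarrow> A \<union> set as \<subseteq> univ K \<longrightarrow> (holds K \<phi> as \<longleftrightarrow> R K as)"
    by (rule expressibleE[OF assms(1)])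
  then show ?thesis
    using assms(2) unfolding expressible_def by (intro bexI[of _ \<phi>]) (auto intro: fms_mono)
qed

lemma expressible_not: "expressible L A n R \<Longrightarrow> expressible L A n (\<lambda>K as. \<not> R K as)"
  unfolding expressible_def by (elim bexE, rule_tac x = "Neg \<phi>" in bexI) (auto simp: holds_def fms_def)

lemma expressible_and:
  assumes "expressible L A n R" "expressible L A n S"
  shows "expressible L A n (\<lambda>K as. R K as \<and> S K as)"
proof -
  obtain \<phi> where \<phi>: "\<phi> \<in> fms L A n"
    "\<forall>K as. length as = n \<longrightarrow> A \<union> set as \<subseteq> univ K \<longrightarrow> (holds K \<phi> as \<longleftrightarrow> R K as)"
    by (rule expressibleE[OF assms(1)])
  obtain \<psi> where "\<psi> \<in> fms L A n"
    "\<forall>K as. length as = n \<longrightarrow> A \<union> set as \<subseteq> univ K \<longrightarrow> (holds K \<psi> as \<longleftrightarrow> S K as)"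
    by (rule expressibleE[OF assms(2)])
  note \<phi> this
  then show ?thesis
    unfolding expressible_def by (intro bexI[of _ "Con \<phi> \<psi>"]) (auto simp: holds_def fms_def)
qed

lemma expressible_or:
  assumes "expressible L A n R" "expressible L A n S"
  shows "expressible L A n (\<lambda>K as. R K as \<or> S K as)"
  using expressible_not[OF expressible_and[OF assms[THEN expressible_not]]] by simp

lemma expressible_imp:
  assumes "expressible L A n R" "expressible L A n S"
  shows "expressible L A n (\<lambda>K as. R K as \<longrightarrow> S K as)"
  using expressible_or[OF expressible_not[OF assms(1)] assms(2)] by simp

lemma expressible_iff:
  assumes "expressible L A n R" "expressible L A n S"
  shows "expressible L A n (\<lambda>K as. R K as \<longleftrightarrow> S K as)"
  using expressible_and[OF expressible_imp[OF assms] expressible_imp[OF assms(2,1)]]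
  by (rule expressible_cong) auto

text \<open>The quantified argument stands last, so its position \<open>n\<close> is used directly
  as the bound variable, without renumbering.\<close>

lemma expressible_ex:
  assumes "expressible L A (Suc n) R"
  shows "expressible L A n (\<lambda>K as. \<exists>a\<in>univ K. R K (as @ [a]))"
proof -
  obtain \<phi> where \<phi>: "\<phi> \<in> fms L A (Suc n)"
    and R: "\<forall>K as. length as = Suc n \<longrightarrow> A \<union> set as \<subseteq> univ K \<longrightarrow> (holds K \<phi> as \<longleftrightarrow> R K as)"
    by (rule expressibleE[OF assms])
  have eq: "holds K \<phi> (as @ [a]) \<longleftrightarrow> sat K (((!) as)(n := a)) \<phi>" if "length as = n" for K and as :: "'c list" and a
    using that by (intro holds_eq_sat[OF \<phi>]) (auto simp: nth_append)
  have "sat K (((!) as)(n := a)) \<phi> \<longleftrightarrow> R K (as @ [a])"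
    if "length as = n" "A \<subseteq> univ K" "set as \<subseteq> univ K" "a \<in> univ K" for K as a
    using that R[rule_format, of "as @ [a]" K] eq[of as] by simp
  then have "holds K (Exi n \<phi>) as \<longleftrightarrow> (\<exists>a\<in>univ K. R K (as @ [a]))"
    if "length as = n" "A \<subseteq> univ K" "set as \<subseteq> univ K" for K as
    using that by (simp add: holds_def)
  then show ?thesis
    using \<phi> unfolding expressible_def by (intro bexI[of _ "Exi n \<phi>"]) (auto simp: fms_def)
qed

lemma expressible_exs:
  assumes "expressible L A (n + k) R"
  shows "expressible L A n (\<lambda>K as. \<exists>bs. length bs = k \<and> set bs \<subseteq> univ K \<and> R K (as @ bs))"
  using assms
proof (induction k arbitrary: n)
  case (Suc k)
  from Suc.prems have "expressible L A (Suc n + k) R" by simp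
  from expressible_ex[OF Suc.IH[OF this]] show ?case
  proof (rule expressible_cong)
    fix K :: "('a, 'b, 'c) str" and as
    show "(\<exists>a\<in>univ K. \<exists>bs. length bs = k \<and> set bs \<subseteq> univ K \<and> R K ((as @ [a]) @ bs)) \<longleftrightarrow>
      (\<exists>bs. length bs = Suc k \<and> set bs \<subseteq> univ K \<and> R K (as @ bs))" (is "?l \<longleftrightarrow> ?r")
    proof
      assume ?l
      then obtain a bs where "a \<in> univ K" "length bs = k" "set bs \<subseteq> univ K" "R K ((as @ [a]) @ bs)"
        by blast
      then show ?r by (intro exI[of _ "a # bs"]) simp
    next
      assume ?r
      then obtain cs where "length cs = Suc k" "set cs \<subseteq> univ K" "R K (as @ cs)" by blast
      then show ?l by (cases cs) auto
    qed
  qed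
qed simp

lemma expressible_eq:
  assumes "i < n" "j < n"
  shows "expressible L A n (\<lambda>K as. as ! i = as ! j)"
  unfolding expressible_def
  using assms by (intro bexI[of _ "Equ (Var i) (Var j)"]) (auto simp: holds_def fms_def)

lemma expressible_True: "expressible L A n (\<lambda>K as. True)"
proof -
  \<comment> \<open>There is no truth constant. A closed formula without symbols or constants gives
    a tautology for every language, every \<open>A\<close> and also for
    \<open>n = 0\<close>.\<close>
  define \<theta> :: "('a, 'b, 'c) fm" where "\<theta> = Exi 0 (Equ (Var 0) (Var 0))"
  have "Neg (Con \<theta> (Neg \<theta>)) \<in> fms L A n" "holds K (Neg (Con \<theta> (Neg \<theta>))) as" for K as
    by (simp_all add: \<theta>_def fms_def holds_def)
  then show ?thesis unfolding expressible_def by blast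
qed

lemma expressible_ball:
  assumes "finite I" "\<And>i. i \<in> I \<Longrightarrow> expressible L A n (R i)"
  shows "expressible L A n (\<lambda>K as. \<forall>i\<in>I. R i K as)"
  using assms
proof (induction I)
  case empty
  then show ?case by (simp add: expressible_True)
next
  case (insert i I)
  have "expressible L A n (\<lambda>K as. R i K as \<and> (\<forall>i\<in>I. R i K as))"
    by (rule expressible_and) (use insert in auto)
  then show ?case by simp
qed

lemma expressible_bex:
  assumes "finite I" "\<And>i. i \<in> I \<Longrightarrow> expressible L A n (R i)"
  shows "expressible L A n (\<lambda>K as. \<exists>i\<in>I. R i K as)"
proof -
  have "expressible L A n (\<lambda>K as. \<not> (\<forall>i\<in>I. \<not> R i K as))"
    by (rule expressible_not, rule expressible_ball[OF assms(1)], rule expressible_not, rule assms(2))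
  then show ?thesis by simp
qed

text \<open>The \<open>i\<close>-th argument of \<open>R\<close> becomes the \<open>j\<close>-th argument (\<open>Inl j\<close>) or a parameter (\<open>Inr a\<close>).\<close>

lemma expressible_subst:
  assumes "expressible L A n R" "length ts = n"
    "\<And>j. Inl j \<in> set ts \<Longrightarrow> j < m" "\<And>a. Inr a \<in> set ts \<Longrightarrow> a \<in> A"
  shows "expressible L A m (\<lambda>K as. R K (map (case_sum ((!) as) (\<lambda>a. a)) ts))"
proof -
  obtain \<phi> where \<phi>: "\<phi> \<in> fms L A n"
    and R: "\<forall>K as. length as = n \<longrightarrow> A \<union> set as \<subseteq> univ K \<longrightarrow> (holds K \<phi> as \<longleftrightarrow> R K as)"
    by (rule expressibleE[OF assms(1)])
  obtain P where P: "finite P" "P \<subseteq> A" "wf_fm L P \<phi>"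
    using wf_fm_finite_params[of L A \<phi>] \<phi> by (auto simp: fms_def)
  define g :: "nat \<Rightarrow> ('a, 'c) tm" where "g i = case_sum Var Par (ts ! i)" for i
  have g: "wf_tm L A (g i) \<and> fv_tm (g i) \<subseteq> {..<m}" if "i \<in> fv \<phi>" for i
  proof -
    have mem: "ts ! i \<in> set ts" using that \<phi> assms(2) by (auto simp: fms_def)
    show ?thesis
    proof (cases "ts ! i")
      case (Inl j)
      then have "j < m" using mem assms(3)[of j] by simp
      then show ?thesis using Inl by (simp add: g_def)
    next
      case (Inr a)
      then have "a \<in> A" using mem assms(4)[of a] by simp
      then show ?thesis using Inr by (simp add: g_def)
    qed
  qed
  have "\<exists>\<psi>. wf_fm L A \<psi> \<and> fv \<psi> \<subseteq> {..<m} \<and>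
     (\<forall>M e e'. (\<forall>i\<in>fv \<phi>. eval M e' (g i) = e i) \<and> (\<forall>a\<in>P. eval M e' (Par a) = a) \<longrightarrow>
        (sat M e' \<psi> \<longleftrightarrow> sat M e \<phi>))"
    by (rule subst_fm_exists[OF P(1) g _ P(3)]) (use P(2) in auto)
  then obtain \<psi> where \<psi>: "wf_fm L A \<psi>" "fv \<psi> \<subseteq> {..<m}" and
    sat: "\<And>M e e'. \<forall>i\<in>fv \<phi>. eval M e' (g i) = e i \<Longrightarrow> \<forall>a\<in>P. eval M e' (Par a) = a \<Longrightarrow>
       sat M e' \<psi> \<longleftrightarrow> sat M e \<phi>"
    by blast
  have "holds K \<psi> as \<longleftrightarrow> R K (map (case_sum ((!) as) (\<lambda>a. a)) ts)"
    if as: "length as = m" "A \<subseteq> univ K" "set as \<subseteq> univ K" for K as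
  proof -
    let ?bs = "map (case_sum ((!) as) (\<lambda>a. a)) ts"
    have "holds K \<psi> as \<longleftrightarrow> holds K \<phi> ?bs"
      unfolding holds_def
    proof (rule sat)
      show "\<forall>i\<in>fv \<phi>. eval K ((!) as) (g i) = ?bs ! i"
        using \<phi> assms(2) by (auto simp: g_def fms_def subset_iff split: sum.split)
    qed simp
    also have "set ?bs \<subseteq> univ K"
      using as assms(3,4) by (force split: sum.split dest: nth_mem)
    then have "holds K \<phi> ?bs \<longleftrightarrow> R K ?bs"
      using as assms(2) by (intro R[rule_format]) auto
    finally show ?thesis .
  qed
  then show ?thesis
    using \<psi> by (auto simp: expressible_def fms_def)
qed

text \<open>\<open>elem_ext\<close>, \<open>order_property\<close> and \<open>divides\<close> speak
  of formulas without constants. Turning the finitely many parameters into a trailing tuple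
  \<open>ps\<close> makes them applicable to formulas over \<open>A\<close>.\<close>

lemma params_abstract:
  assumes \<phi>: "\<phi> \<in> fms L A n"
  obtains \<psi> ps where "set ps \<subseteq> A" "\<psi> \<in> fms L {} (n + length ps)"
    "\<forall>K as. length as = n \<longrightarrow> (holds K \<psi> (as @ ps) \<longleftrightarrow> holds K \<phi> as)"
proof -
  obtain P where P: "finite P" "P \<subseteq> A" "wf_fm L P \<phi>"
    using wf_fm_finite_params[of L A \<phi>] \<phi> by (auto simp: fms_def)
  obtain ps where ps: "set ps = P" using P(1) finite_list by blast
  then have "\<forall>a\<in>P. \<exists>i. i < length ps \<and> ps ! i = a" by (simp add: in_set_conv_nth flip: ps)
  from bchoice[OF this] obtain k where k: "\<forall>a\<in>P. k a < length ps \<and> ps ! k a = a" by blast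
  have "\<exists>\<psi>. wf_fm L {} \<psi> \<and> fv \<psi> \<subseteq> {..<n + length ps} \<and>
     (\<forall>M e e'. (\<forall>i\<in>fv \<phi>. eval M e' (Var i) = e i) \<and> (\<forall>a\<in>P. eval M e' (Var (n + k a)) = a) \<longrightarrow>
        (sat M e' \<psi> \<longleftrightarrow> sat M e \<phi>))"
    by (rule subst_fm_exists[OF P(1) _ _ P(3)]) (use \<phi> k in \<open>auto simp: fms_def\<close>)
  then obtain \<psi> where \<psi>: "wf_fm L {} \<psi>" "fv \<psi> \<subseteq> {..<n + length ps}" and
    sat: "\<And>M e e'. \<forall>i\<in>fv \<phi>. eval M e' (Var i) = e i \<Longrightarrow>
       \<forall>a\<in>P. eval M e' (Var (n + k a)) = a \<Longrightarrow> sat M e' \<psi> \<longleftrightarrow> sat M e \<phi>"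
    by blast
  show thesis
  proof (rule that)
    have "holds K \<psi> (as @ ps) \<longleftrightarrow> holds K \<phi> as" if "length as = n" for K as
      unfolding holds_def
    proof (rule sat)
      show "\<forall>i\<in>fv \<phi>. eval K ((!) (as @ ps)) (Var i) = as ! i"
        using that \<phi> by (auto simp: nth_append fms_def)
      show "\<forall>a\<in>P. eval K ((!) (as @ ps)) (Var (n + k a)) = a"
        using that k by (simp add: nth_append)
    qed
    then show "\<forall>K as. length as = n \<longrightarrow> (holds K \<psi> (as @ ps) \<longleftrightarrow> holds K \<phi> as)" by blast
  qed (use \<psi> P ps in \<open>auto simp: fms_def\<close>)
qed

lemma elem_ext_holds:
  assumes "elem_ext L M N" "\<phi> \<in> fms L (univ M) n" "length as = n" "set as \<subseteq> univ M"
  shows "holds M \<phi> as \<longleftrightarrow> holds N \<phi> as"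
proof -
  obtain \<psi> ps where \<psi>: "set ps \<subseteq> univ M" "\<psi> \<in> fms L {} (n + length ps)"
    "\<forall>K as. length as = n \<longrightarrow> (holds K \<psi> (as @ ps) \<longleftrightarrow> holds K \<phi> as)"
    by (rule params_abstract[OF assms(2)])
  have "length (as @ ps) = n + length ps \<and> set (as @ ps) \<subseteq> univ M"
    using assms(3,4) \<psi>(1) by simp
  then have "holds M \<psi> (as @ ps) \<longleftrightarrow> holds N \<psi> (as @ ps)"
    using assms(1) \<psi>(2) unfolding elem_ext_def by blast
  then show ?thesis using \<psi>(3) assms(3) by simp
qed

lemma elem_ext_expressible:
  assumes "elem_ext L M N" "expressible L (univ M) n R" "length as = n" "set as \<subseteq> univ M"
  shows "R M as \<longleftrightarrow> R N as"
proof -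
  obtain \<phi> where \<phi>: "\<phi> \<in> fms L (univ M) n"
    and R: "\<forall>K as. length as = n \<longrightarrow> univ M \<union> set as \<subseteq> univ K \<longrightarrow> (holds K \<phi> as \<longleftrightarrow> R K as)"
    by (rule expressibleE[OF assms(2)])
  have "univ M \<subseteq> univ N" using assms(1) by (simp add: elem_ext_def)
  then have "holds M \<phi> as \<longleftrightarrow> R M as" "holds N \<phi> as \<longleftrightarrow> R N as"
    using assms(3,4) by (auto intro!: R[rule_format])
  then show ?thesis
    using elem_ext_holds[OF assms(1) \<phi> assms(3,4)] by simp
qed

text \<open>A counterexample in \<open>N\<close> makes an existential sentence over \<open>M\<close>
  true there; by elementarity it would have a witness in \<open>M\<close>.\<close>

lemma elem_ext_transfer:
  assumes "elem_ext L M N" "expressible L (univ M) n R"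
    "\<And>as. \<lbrakk>length as = n; set as \<subseteq> univ M\<rbrakk> \<Longrightarrow> R M as" "length as = n" "set as \<subseteq> univ N"
  shows "R N as"
proof (rule ccontr)
  assume "\<not> R N as"
  have "expressible L (univ M) 0
      (\<lambda>K as. \<exists>bs. length bs = n \<and> set bs \<subseteq> univ K \<and> \<not> R K (as @ bs))"
    by (rule expressible_exs) (simp add: assms(2) expressible_not)
  from elem_ext_expressible[OF assms(1) this, of "[]"] show False
    using assms(3-5) \<open>\<not> R N as\<close> by auto
qed

lemma elem_ext_trans:
  fixes M N C :: "('f, 'r, 'a) str"
  assumes "elem_ext L M N" "elem_ext L N C"
  shows "elem_ext L M C"
  unfolding elem_ext_def
proof (intro conjI allI ballI impI)
  fix n and \<phi> :: "('f, 'r, 'a) fm" and as assume \<phi>: "\<phi> \<in> fms L {} n" and as: "length as = n \<and> set as \<subseteq> univ M"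
  then have "holds M \<phi> as \<longleftrightarrow> holds N \<phi> as" "holds N \<phi> as \<longleftrightarrow> holds C \<phi> as"
    using assms unfolding elem_ext_def by auto
  then show "holds M \<phi> as \<longleftrightarrow> holds C \<phi> as" by simp
qed (use assms in \<open>auto simp: elem_ext_def\<close>)

section \<open>Ultrafilters and orderless relations\<close>

definition ultra :: "'a filter \<Rightarrow> bool" where
  "ultra F \<longleftrightarrow> F \<noteq> bot \<and> (\<forall>P. eventually P F \<or> (\<forall>\<^sub>F x in F. \<not> P x))"

lemma ultra_ex: "\<lbrakk>ultra F; eventually P F\<rbrakk> \<Longrightarrow> \<exists>x. P x"
  unfolding ultra_def by (blast intro: eventually_happens')

lemma ultra_not:
  assumes "ultra F"
  shows "(\<forall>\<^sub>F x in F. \<not> P x) \<longleftrightarrow> \<not> eventually P F"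
proof
  assume "\<forall>\<^sub>F x in F. \<not> P x"
  then show "\<not> eventually P F"
    using ultra_ex[OF assms eventually_conj] by blast
qed (use assms in \<open>auto simp: ultra_def\<close>)

text \<open>Zorn's lemma for the reversed order, so that maximal elements are the finest filters.
  The infimum of a chain is proper because a chain is directed: what holds eventually for the
  infimum does so for a member.\<close>

lemma ultra_exists:
  assumes "F \<noteq> bot"
  obtains U where "U \<le> F" "ultra U"
proof -
  define A where "A = {G. G \<le> F \<and> G \<noteq> bot}"
  let ?r = "relation_of (\<ge>) A"
  have "\<exists>m\<in>A. \<forall>G\<in>A. m \<ge> G \<longrightarrow> G = m"
  proof (rule predicate_Zorn)
    show "partial_order_on A ?r"
      by (auto simp: partial_order_on_def preorder_on_def refl_on_def trans_def antisym_def
          relation_of_def)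
    fix C assume "C \<in> Chains ?r"
    then have C: "C \<subseteq> A" "\<And>G H. \<lbrakk>G \<in> C; H \<in> C\<rbrakk> \<Longrightarrow> G \<le> H \<or> H \<le> G"
      by (auto simp: Chains_def relation_of_def)
    show "\<exists>u\<in>A. \<forall>G\<in>C. G \<ge> u"
    proof (cases "C = {}")
      case True
      then show ?thesis using assms by (auto simp: A_def)
    next
      case False
      have "eventually P (Inf C) \<longleftrightarrow> (\<exists>G\<in>C. eventually P G)" for P
      proof (rule eventually_Inf_base[OF False])
        fix G H assume "G \<in> C" "H \<in> C"
        then show "\<exists>u\<in>C. u \<le> inf G H" using C(2)[of G H] by auto
      qed
      then have "Inf C \<noteq> bot"
        using C(1) by (force simp: A_def trivial_limit_def)
      moreover obtain G where "G \<in> C" using False by blast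
      then have "Inf C \<le> F" using C(1) by (auto simp: A_def intro: order_trans[OF Inf_lower])
      ultimately show ?thesis by (auto simp: A_def intro!: bexI[of _ "Inf C"] Inf_lower)
    qed
  qed
  then obtain U where U: "U \<in> A" "\<And>G. \<lbrakk>G \<in> A; G \<le> U\<rbrakk> \<Longrightarrow> G = U" by blast
  \<comment> \<open>Adjoining \<open>P\<close> to \<open>U\<close> gives a proper filter below
    \<open>U\<close>, which by maximality is \<open>U\<close> itself.\<close>
  have "eventually P U" if "\<not> (\<forall>\<^sub>F x in U. \<not> P x)" for P
  proof -
    let ?G = "inf U (principal {x. P x})"
    have "?G \<noteq> bot"
      using that by (auto simp: trivial_limit_def eventually_inf_principal)
    moreover have "?G \<le> F" using U(1) by (auto simp: A_def intro: le_infI1)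
    ultimately have "?G = U" by (intro U(2)) (auto simp: A_def)
    moreover have "eventually P ?G" by (simp add: eventually_inf_principal)
    ultimately show ?thesis by simp
  qed
  then have "ultra U" using U(1) by (auto simp: ultra_def A_def)
  then show thesis using U(1) that by (auto simp: A_def)
qed

section \<open>Relations without infinite orders, and iterated limits\<close>

definition has_order :: "'a set \<Rightarrow> 'b set \<Rightarrow> ('a \<Rightarrow> 'b \<Rightarrow> bool) \<Rightarrow> bool" where
  "has_order X Y \<rho> \<longleftrightarrow>
     (\<exists>a b. (\<forall>i::nat. a i \<in> X \<and> b i \<in> Y) \<and> (\<forall>i j. \<rho> (a i) (b j) \<longleftrightarrow> i < j))"

text \<open>Forbidding an order for the negation too also rules out reversed orders, which would otherwise
  require compactness.\<close>

definition orderless :: "'a set \<Rightarrow> 'b set \<Rightarrow> ('a \<Rightarrow> 'b \<Rightarrow> bool) \<Rightarrow> bool" where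
  "orderless X Y \<rho> \<longleftrightarrow> \<not> has_order X Y \<rho> \<and> \<not> has_order X Y (\<lambda>a b. \<not> \<rho> a b)"

lemma orderless_not: "orderless X Y \<rho> \<Longrightarrow> orderless X Y (\<lambda>a b. \<not> \<rho> a b)"
  by (simp add: orderless_def)

lemma orderless_lessD:
  assumes "orderless X Y \<rho>" "\<And>i::nat. a i \<in> X" "\<And>i. b i \<in> Y" "\<And>i j. \<rho> (a i) (b j) \<longleftrightarrow> i < j"
  shows False
proof -
  have "has_order X Y \<rho>"
    unfolding has_order_def using assms(2-4) by (intro exI[of _ a] exI[of _ b]) simp
  then show False using assms(1) by (simp add: orderless_def)
qed

lemma orderless_leD:
  assumes "orderless X Y \<rho>" "\<And>i::nat. a i \<in> X" "\<And>i. b i \<in> Y" "\<And>i j. \<rho> (a i) (b j) \<longleftrightarrow> i \<le> j"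
  shows False
  \<comment> \<open>Dropping \<open>a 0\<close> turns the weak order into a strict one.\<close>
  using orderless_lessD[OF assms(1), of "\<lambda>i. a (Suc i)" b] assms(2-4) by (simp add: Suc_le_eq)

lemma orderless_gtD:
  assumes "orderless X Y \<rho>" "\<And>i::nat. a i \<in> X" "\<And>i. b i \<in> Y" "\<And>i j. \<rho> (a i) (b j) \<longleftrightarrow> j < i"
  shows False
  using orderless_leD[OF orderless_not[OF assms(1)], of a b] assms(2-4) by (simp add: not_less)

lemma has_order_mono:
  assumes "has_order X' Y' \<rho>" "X' \<subseteq> X" "Y' \<subseteq> Y"
  shows "has_order X Y \<rho>"
proof -
  obtain a b where *: "\<forall>i::nat. a i \<in> X' \<and> b i \<in> Y'" "\<forall>i j. \<rho> (a i) (b j) \<longleftrightarrow> i < j"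
    using assms(1) unfolding has_order_def by blast
  show ?thesis
    unfolding has_order_def by (intro exI[of _ a] exI[of _ b]) (use * assms(2,3) in auto)
qed

lemma orderless_mono: "\<lbrakk>orderless X Y \<rho>; X' \<subseteq> X; Y' \<subseteq> Y\<rbrakk> \<Longrightarrow> orderless X' Y' \<rho>"
  unfolding orderless_def by (blast dest: has_order_mono)

text \<open>Ramsey's theorem for increasing pairs: \<open>Min\<close> and \<open>Max\<close> recover
  the order of an unordered pair.\<close>

lemma pair_colouring:
  fixes R :: "nat \<Rightarrow> nat \<Rightarrow> bool"
  shows "\<exists>(k :: nat \<Rightarrow> nat) t. strict_mono k \<and> (\<forall>i j. i < j \<longrightarrow> (R (k i) (k j) \<longleftrightarrow> t))"
proof -
  define f :: "nat set \<Rightarrow> nat" where "f A = (if R (Min A) (Max A) then 1 else 0)" for A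
  have "\<exists>Y t. Y \<subseteq> (UNIV :: nat set) \<and> infinite Y \<and> t < 2 \<and> (\<forall>x\<in>Y. \<forall>y\<in>Y. x \<noteq> y \<longrightarrow> f {x, y} = t)"
    by (rule Ramsey2) (auto simp: f_def)
  then obtain Y t where Y: "infinite Y" "\<forall>x\<in>Y. \<forall>y\<in>Y. x \<noteq> y \<longrightarrow> f {x, y} = t" by blast
  define k where "k = enumerate Y"
  have k: "k i \<in> Y" "strict_mono k" for i
    using Y(1) by (simp_all add: k_def enumerate_in_set strict_mono_enumerate)
  have "R (k i) (k j) \<longleftrightarrow> t = 1" if "i < j" for i j
  proof -
    have "k i < k j" using k(2) that by (simp add: strict_mono_less)
    then show ?thesis using Y(2)[rule_format, OF k(1)[of i] k(1)[of j]] by (auto simp: f_def split: if_splits)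
  qed
  then show ?thesis using k(2) by (intro exI[of _ k] exI[of _ "t = 1"]) simp
qed

text \<open>The set of those \<open>b\<close> for which \<open>\<rho> x b\<close> holds at the limit along \<open>F\<close> is a positive Boolean
  combination of the sets \<open>{b. \<rho> s b}\<close>: otherwise one chooses witnesses step by step, and
  Ramsey's theorem extracts an order.\<close>

lemma ultra_finite_separation:
  assumes st: "orderless X Y \<rho>" and F: "ultra F" "\<forall>\<^sub>F x in F. x \<in> X"
  obtains S where "finite S" "S \<subseteq> X"
    "\<forall>b\<in>Y. \<forall>b'\<in>Y. (\<forall>\<^sub>F x in F. \<rho> x b) \<longrightarrow> \<not> (\<forall>\<^sub>F x in F. \<rho> x b') \<longrightarrow>
       (\<exists>s\<in>S. \<rho> s b \<and> \<not> \<rho> s b')"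
proof (rule ccontr)
  note found = that
  assume "\<not> thesis"
  then have no: "\<exists>b\<in>Y. \<exists>b'\<in>Y. (\<forall>\<^sub>F x in F. \<rho> x b) \<and> \<not> (\<forall>\<^sub>F x in F. \<rho> x b') \<and>
      (\<forall>s\<in>S. \<rho> s b \<longrightarrow> \<rho> s b')" if "finite S" "S \<subseteq> X" for S
    using found[OF that] by blast
  \<comment> \<open>Stage \<open>n\<close> yields \<open>a\<close>, \<open>b\<close>,
    \<open>b'\<close>: \<open>a\<close> satisfies \<open>\<rho>\<close> with every earlier
    \<open>b\<close> and no earlier \<open>b'\<close>, as \<open>F\<close>-almost every point does,
    and the new pair \<open>b\<close>, \<open>b'\<close> is one that the earlier \<open>a\<close>
    fail to separate.\<close>
  define P where "P f n r \<longleftrightarrow> (case r of (a, b, b') \<Rightarrow>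
      a \<in> X \<and> b \<in> Y \<and> b' \<in> Y \<and> (\<forall>\<^sub>F x in F. \<rho> x b) \<and> \<not> (\<forall>\<^sub>F x in F. \<rho> x b') \<and>
      (\<forall>i<n. \<rho> a (fst (snd (f i))) \<and> \<not> \<rho> a (snd (snd (f i))) \<and> (\<rho> (fst (f i)) b \<longrightarrow> \<rho> (fst (f i)) b')))"
    for f :: "nat \<Rightarrow> 'a \<times> 'b \<times> 'b" and n r
  have "\<exists>f. \<forall>n. P f n (f n)"
  proof (rule dependent_wf_choice[OF wf])
    show "P f x r = P g x r" if "\<And>z. (z, x) \<in> {(m, n). m < n} \<Longrightarrow> f z = g z" for f g x r
      using that unfolding P_def by (auto split: prod.split)
    fix n f assume *: "\<And>y. (y, n) \<in> {(m, n). m < n} \<Longrightarrow> P f y (f y)"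
    then have prev: "fst (f i) \<in> X" "\<forall>\<^sub>F x in F. \<rho> x (fst (snd (f i)))"
      "\<forall>\<^sub>F x in F. \<not> \<rho> x (snd (snd (f i)))" if "i < n" for i
      using *[of i, unfolded P_def] that by (auto simp: ultra_not[OF F(1)] split: prod.splits)
    have "\<forall>\<^sub>F x in F. x \<in> X \<and> (\<forall>i\<in>{..<n}. \<rho> x (fst (snd (f i))) \<and> \<not> \<rho> x (snd (snd (f i))))"
      using F(2) prev by (intro eventually_conj eventually_ball_finite ballI) auto
    from ultra_ex[OF F(1) this] obtain a where "a \<in> X"
      "\<And>i. i < n \<Longrightarrow> \<rho> a (fst (snd (f i))) \<and> \<not> \<rho> a (snd (snd (f i)))" by auto
    moreover obtain b b' where "b \<in> Y" "b' \<in> Y" "\<forall>\<^sub>F x in F. \<rho> x b" "\<not> (\<forall>\<^sub>F x in F. \<rho> x b')"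
      "\<forall>s\<in>(\<lambda>i. fst (f i)) ` {..<n}. \<rho> s b \<longrightarrow> \<rho> s b'"
      using no[of "(\<lambda>i. fst (f i)) ` {..<n}"] prev(1) by auto
    ultimately have "P f n (a, b, b')" unfolding P_def by auto
    then show "\<exists>r. P f n r" by blast
  qed
  then obtain f where f: "\<And>n. P f n (f n)" by blast
  define a b c where "a n = fst (f n)" and "b n = fst (snd (f n))" and "c n = snd (snd (f n))" for n
  have X: "a n \<in> X" "b n \<in> Y" "c n \<in> Y" for n
    using f[of n] by (auto simp: P_def a_def b_def c_def split: prod.splits)
  have step: "\<rho> (a n) (b i)" "\<not> \<rho> (a n) (c i)" "\<rho> (a i) (b n) \<longrightarrow> \<rho> (a i) (c n)" if "i < n" for i n
    using f[of n] that by (auto simp: P_def a_def b_def c_def split: prod.splits)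
  \<comment> \<open>\<open>step\<close> decides \<open>\<rho> (a n) (b i)\<close> only for
    \<open>i < n\<close>; Ramsey makes the other side constant. If it is true there,
    \<open>a\<close> is ordered against \<open>c\<close>, otherwise against
    \<open>b\<close>.\<close>
  obtain k :: "nat \<Rightarrow> nat" and t where k: "strict_mono k" "\<forall>i j. i < j \<longrightarrow> (\<rho> (a (k i)) (b (k j)) \<longleftrightarrow> t)"
    using pair_colouring[of "\<lambda>i j. \<rho> (a i) (b j)"] by (elim exE conjE) (rule that)
  have lt: "k i < k j" if "i < j" for i j using k(1) that by (simp add: strict_mono_less)
  \<comment> \<open>Diagonal entries are not controlled, so \<open>a\<close> takes even indices and
    \<open>b\<close>, \<open>c\<close> odd ones, which never meet.\<close>
  have cmp: "2 * i < Suc (2 * j) \<longleftrightarrow> i \<le> j" "Suc (2 * j) < 2 * i \<longleftrightarrow> j < i" for i j :: nat by auto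
  show False
  proof (cases t)
    case True
    have "\<rho> (a (k (2 * i))) (c (k (Suc (2 * j)))) \<longleftrightarrow> i \<le> j" for i j
    proof (cases "i \<le> j")
      case True
      then have "2 * i < Suc (2 * j)" by simp
      with k(2) lt step(3) \<open>t\<close> True show ?thesis by blast
    next
      case False
      then have "Suc (2 * j) < 2 * i" by simp
      with lt step(2) False show ?thesis by blast
    qed
    from orderless_leD[OF st _ _ this] show False using X by simp
  next
    case False
    have "\<rho> (a (k (2 * i))) (b (k (Suc (2 * j)))) \<longleftrightarrow> j < i" for i j
    proof (cases "i \<le> j")
      case True
      then have "2 * i < Suc (2 * j)" by simp
      with k(2) \<open>\<not> t\<close> True show ?thesis by (metis not_le)
    next
      case False
      then have "Suc (2 * j) < 2 * i" by simp
      with lt step(1) False show ?thesis by (metis not_le)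
    qed
    from orderless_gtD[OF st _ _ this] show False using X by simp
  qed
qed

text \<open>If the iterated limits differ, points can be chosen alternately, each generic for the
  earlier ones: \<open>a\<close> falsifies \<open>\<rho>\<close> with every earlier
  \<open>b\<close>, then \<open>b\<close> satisfies it with every \<open>a\<close> so far, including
  the current one. This is a weak order.\<close>

lemma ultra_commute_imp:
  assumes st: "orderless X Y \<rho>" and F: "ultra F" "\<forall>\<^sub>F x in F. x \<in> X"
    and G: "ultra G" "\<forall>\<^sub>F y in G. y \<in> Y"
    and FG: "\<forall>\<^sub>F x in F. \<forall>\<^sub>F y in G. \<rho> x y"
  shows "\<forall>\<^sub>F y in G. \<forall>\<^sub>F x in F. \<rho> x y"
proof (rule ccontr)
  assume "\<not> ?thesis"
  then have GF: "\<forall>\<^sub>F y in G. \<forall>\<^sub>F x in F. \<not> \<rho> x y"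
    by (simp add: ultra_not[OF F(1)] ultra_not[OF G(1)])
  define P where "P f n r \<longleftrightarrow> (case r of (a, b) \<Rightarrow>
      a \<in> X \<and> b \<in> Y \<and> (\<forall>\<^sub>F y in G. \<rho> a y) \<and> (\<forall>\<^sub>F x in F. \<not> \<rho> x b) \<and> \<rho> a b \<and>
      (\<forall>i<n. \<not> \<rho> a (snd (f i)) \<and> \<rho> (fst (f i)) b))"
    for f :: "nat \<Rightarrow> 'a \<times> 'b" and n r
  have "\<exists>f. \<forall>n. P f n (f n)"
  proof (rule dependent_wf_choice[OF wf])
    show "P f x r = P g x r" if "\<And>z. (z, x) \<in> {(m, n). m < n} \<Longrightarrow> f z = g z" for f g x r
      using that unfolding P_def by (auto split: prod.split)
    fix n f assume *: "\<And>y. (y, n) \<in> {(m, n). m < n} \<Longrightarrow> P f y (f y)"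
    then have prev: "\<forall>\<^sub>F y in G. \<rho> (fst (f i)) y" "\<forall>\<^sub>F x in F. \<not> \<rho> x (snd (f i))" if "i < n" for i
      using *[of i, unfolded P_def] that by (auto split: prod.splits)
    have "\<forall>\<^sub>F x in F. x \<in> X \<and> (\<forall>\<^sub>F y in G. \<rho> x y) \<and> (\<forall>i\<in>{..<n}. \<not> \<rho> x (snd (f i)))"
      using F(2) FG prev by (intro eventually_conj eventually_ball_finite ballI) auto
    from ultra_ex[OF F(1) this] obtain a where a: "a \<in> X" "\<forall>\<^sub>F y in G. \<rho> a y"
      "\<And>i. i < n \<Longrightarrow> \<not> \<rho> a (snd (f i))" by auto
    have "\<forall>\<^sub>F y in G. y \<in> Y \<and> (\<forall>\<^sub>F x in F. \<not> \<rho> x y) \<and> \<rho> a y \<and> (\<forall>i\<in>{..<n}. \<rho> (fst (f i)) y)"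
      using G(2) GF a(2) prev by (intro eventually_conj eventually_ball_finite ballI) auto
    from ultra_ex[OF G(1) this] obtain b where "b \<in> Y" "\<forall>\<^sub>F x in F. \<not> \<rho> x b" "\<rho> a b"
      "\<And>i. i < n \<Longrightarrow> \<rho> (fst (f i)) b" by auto
    with a have "P f n (a, b)" unfolding P_def by auto
    then show "\<exists>r. P f n r" by blast
  qed
  then obtain f where f: "\<And>n. P f n (f n)" by blast
  define a b where "a n = fst (f n)" and "b n = snd (f n)" for n
  have X: "a n \<in> X" "b n \<in> Y" "\<rho> (a n) (b n)" for n
    using f[of n] by (auto simp: P_def a_def b_def split: prod.splits)
  have "\<not> \<rho> (a n) (b i)" "\<rho> (a i) (b n)" if "i < n" for i n
    using f[of n] that by (auto simp: P_def a_def b_def split: prod.splits)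
  then have "\<rho> (a i) (b j) \<longleftrightarrow> i \<le> j" for i j
    using X(3) by (metis le_less not_le)
  from orderless_leD[OF st _ _ this] show False using X by simp
qed

text \<open>The converse is the same implication for the complement of \<open>\<rho>\<close>, since
  ultrafilters commute with negation.\<close>

lemma ultra_commute:
  assumes st: "orderless X Y \<rho>" and F: "ultra F" "\<forall>\<^sub>F x in F. x \<in> X"
    and G: "ultra G" "\<forall>\<^sub>F y in G. y \<in> Y"
  shows "(\<forall>\<^sub>F x in F. \<forall>\<^sub>F y in G. \<rho> x y) \<longleftrightarrow> (\<forall>\<^sub>F y in G. \<forall>\<^sub>F x in F. \<rho> x y)"
proof
  assume "\<forall>\<^sub>F y in G. \<forall>\<^sub>F x in F. \<rho> x y"
  moreover have "\<not> (\<forall>\<^sub>F y in G. \<forall>\<^sub>F x in F. \<rho> x y)" if "\<not> (\<forall>\<^sub>F x in F. \<forall>\<^sub>F y in G. \<rho> x y)"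
    using ultra_commute_imp[OF orderless_not[OF st] F G] that
    by (simp add: ultra_not[OF F(1)] ultra_not[OF G(1)])
  ultimately show "\<forall>\<^sub>F x in F. \<forall>\<^sub>F y in G. \<rho> x y" by blast
qed (rule ultra_commute_imp[OF assms])

section \<open>Types and saturation\<close>

lemma models_elem_ext:
  assumes "is_theory L T" "models L M T" "elem_ext L M N"
  shows "models L N T"
  unfolding models_def
proof (intro conjI ballI)
  show "is_str L N" using assms(3) by (simp add: elem_ext_def)
  fix \<phi> assume "\<phi> \<in> T"
  then have "\<phi> \<in> fms L (univ M) 0" "holds M \<phi> []"
    using assms(1,2) by (auto simp: is_theory_def models_def intro: fms_mono)
  then show "holds N \<phi> []" using elem_ext_holds[OF assms(3), of \<phi> 0 "[]"] by simp
qed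

text \<open>The parameters of \<open>R\<close> join the second tuple as \<open>b j # ps\<close>,
  giving the order property for a formula without constants. The negation of \<open>R\<close> is
  handled alike.\<close>

lemma stable_orderless:
  assumes "stable L T" "models L C T" "expressible L (univ C) 2 R"
  shows "orderless (univ C) (univ C) (\<lambda>a b. R C [a, b])"
proof -
  have "\<not> has_order (univ C) (univ C) (\<lambda>a b. S C [a, b])" if S: "expressible L (univ C) 2 S" for S
  proof
    assume "has_order (univ C) (univ C) (\<lambda>a b. S C [a, b])"
    then obtain a b where ab: "\<forall>i::nat. a i \<in> univ C \<and> b i \<in> univ C"
      "\<forall>i j. S C [a i, b j] \<longleftrightarrow> i < j"
      unfolding has_order_def by blast
    obtain \<phi> where \<phi>: "\<phi> \<in> fms L (univ C) 2"
      "\<forall>K as. length as = 2 \<longrightarrow> univ C \<union> set as \<subseteq> univ K \<longrightarrow> (holds K \<phi> as \<longleftrightarrow> S K as)"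
      by (rule expressibleE[OF S])
    obtain \<psi> ps where \<psi>: "set ps \<subseteq> univ C" "\<psi> \<in> fms L {} (2 + length ps)"
      "\<forall>K as. length as = 2 \<longrightarrow> (holds K \<psi> (as @ ps) \<longleftrightarrow> holds K \<phi> as)"
      by (rule params_abstract[OF \<phi>(1)])
    have "holds C \<psi> ([a i] @ b j # ps) \<longleftrightarrow> i < j" for i j
      using \<psi>(3)[rule_format, of "[a i, b j]" C] \<phi>(2)[rule_format, of "[a i, b j]" C] ab by simp
    then have "order_property L C \<psi> 1 (Suc (length ps))"
      unfolding order_property_def using ab(1) \<psi>(1)
      by (intro exI[of _ "\<lambda>i. [a i]"] exI[of _ "\<lambda>j. b j # ps"]) auto
    moreover have "\<psi> \<in> fms L {} (1 + Suc (length ps))" using \<psi>(2) by simp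
    ultimately show False using assms(1,2) unfolding stable_def by blast
  qed
  from this[OF assms(3)] this[OF expressible_not[OF assms(3)]] show ?thesis
    by (simp add: orderless_def)
qed

section \<open>Complete types and the ultrafilters on \<open>M\<close> that induce them\<close>

lemma types1_Neg:
  assumes "q \<in> types1 L N" "\<theta> \<in> fms L (univ N) 1"
  shows "Neg \<theta> \<in> q \<longleftrightarrow> \<theta> \<notin> q"
proof -
  have "\<not> (\<theta> \<in> q \<and> Neg \<theta> \<in> q)"
  proof
    assume "\<theta> \<in> q \<and> Neg \<theta> \<in> q"
    then have "{\<theta>, Neg \<theta>} \<subseteq> q" "finite {\<theta>, Neg \<theta>}" by auto
    then obtain a where "realizes N a {\<theta>, Neg \<theta>}"
      using assms(1) unfolding types1_def fin_satisfiable_def by blast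
    then show False by (simp add: realizes_def holds_def)
  qed
  then show ?thesis using assms by (auto simp: types1_def)
qed

lemma realized_type: "b \<in> univ N \<Longrightarrow> {\<theta> \<in> fms L (univ N) 1. holds N \<theta> [b]} \<in> types1 L N"
  by (auto simp: types1_def fin_satisfiable_def realizes_def fms_def holds_def)

text \<open>By elementarity, finitely many formulas over \<open>M\<close> in \<open>q\<close> have a
  common realization in \<open>M\<close>, not only in \<open>N\<close>. The sets they define in
  \<open>M\<close> thus generate a proper filter, and any ultrafilter above it computes
  \<open>q\<close> on formulas over \<open>M\<close>.\<close>

lemma type_ultra:
  assumes MN: "elem_ext L M N" and MC: "elem_ext L M C" and q: "q \<in> types1 L N"
  obtains U where "ultra U" "\<forall>\<^sub>F m in U. m \<in> univ M"
    "\<forall>\<theta>\<in>fms L (univ M) 1. \<theta> \<in> q \<longleftrightarrow> (\<forall>\<^sub>F m in U. holds C \<theta> [m])"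
proof -
  define F where "F = (INF \<theta>\<in>q \<inter> fms L (univ M) 1. principal {m \<in> univ M. holds M \<theta> [m]})"
  have univ_subset: "univ M \<subseteq> univ N" using MN by (simp add: elem_ext_def)
  have ex: "\<exists>m\<in>univ M. \<forall>\<theta>\<in>X. holds M \<theta> [m]" if X: "X \<subseteq> q" "X \<subseteq> fms L (univ M) 1" "finite X" for X
  proof (rule ccontr)
    assume no: "\<not> ?thesis"
    have "expressible L (univ M) 1 (\<lambda>K as. \<not> (\<forall>\<theta>\<in>X. holds K \<theta> as))"
      by (rule expressible_not, rule expressible_ball[OF X(3)], rule expressible_holds)
        (use X(2) in blast)
    moreover have "\<not> (\<forall>\<theta>\<in>X. holds M \<theta> as)" if "length as = 1" "set as \<subseteq> univ M" for as
      using that no by (cases as) auto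
    ultimately have "\<not> (\<forall>\<theta>\<in>X. holds N \<theta> [a])" if "a \<in> univ N" for a
      using elem_ext_transfer[OF MN, of 1 "\<lambda>K as. \<not> (\<forall>\<theta>\<in>X. holds K \<theta> as)" "[a]"] that by simp
    moreover obtain a where "realizes N a X"
      using q X(1,3) unfolding types1_def fin_satisfiable_def by blast
    ultimately show False unfolding realizes_def by blast
  qed
  have "F \<noteq> bot"
    unfolding F_def
  proof (rule INF_filter_not_bot)
    fix X assume X: "X \<subseteq> q \<inter> fms L (univ M) 1" "finite X"
    then show "(INF \<theta>\<in>X. principal {m \<in> univ M. holds M \<theta> [m]}) \<noteq> bot"
      using ex[of X] by (auto simp: INF_principal_finite principal_eq_bot_iff)
  qed
  then obtain U where U: "U \<le> F" "ultra U" by (rule ultra_exists)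
  have mem: "\<forall>\<^sub>F m in U. m \<in> univ M \<and> holds M \<theta> [m]" if "\<theta> \<in> q" "\<theta> \<in> fms L (univ M) 1" for \<theta>
  proof -
    have "eventually (\<lambda>m. m \<in> univ M \<and> holds M \<theta> [m]) F"
      unfolding F_def
      by (rule eventually_INF1[of \<theta>]) (use that in \<open>auto simp: eventually_principal\<close>)
    then show ?thesis using U(1) by (rule filter_leD[rotated])
  qed
  have Neg: "Neg \<theta> \<in> fms L (univ M) 1" "\<theta> \<in> fms L (univ N) 1" if "\<theta> \<in> fms L (univ M) 1" for \<theta>
    using that univ_subset by (auto simp: fms_def intro: wf_fm_mono)
  have on_M: "\<forall>\<^sub>F m in U. m \<in> univ M"
  proof -
    \<comment> \<open>Any formula over \<open>M\<close> decided by \<open>q\<close> shows that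
      \<open>U\<close> lives on \<open>univ M\<close>; this one exists in every language.\<close>
    define \<theta> :: "('a, 'b, 'c) fm" where "\<theta> = Exi 0 (Equ (Var 0) (Var 0))"
    have "\<theta> \<in> fms L (univ M) 1" by (simp add: fms_def \<theta>_def)
    moreover from this have "\<theta> \<in> q \<or> Neg \<theta> \<in> q" using types1_Neg[OF q] Neg by blast
    ultimately show ?thesis
      using mem[of \<theta>] mem[of "Neg \<theta>"] Neg(1) by (auto elim: eventually_mono)
  qed
  have "\<theta> \<in> q \<longleftrightarrow> (\<forall>\<^sub>F m in U. holds C \<theta> [m])" if \<theta>: "\<theta> \<in> fms L (univ M) 1" for \<theta>
  proof -
    have "\<theta> \<in> q \<longleftrightarrow> (\<forall>\<^sub>F m in U. holds M \<theta> [m])"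
    proof
      assume "\<theta> \<in> q"
      then show "\<forall>\<^sub>F m in U. holds M \<theta> [m]" using mem[OF _ \<theta>] by (auto elim: eventually_mono)
    next
      assume ev: "\<forall>\<^sub>F m in U. holds M \<theta> [m]"
      have "Neg \<theta> \<notin> q"
      proof
        assume "Neg \<theta> \<in> q"
        then have "\<forall>\<^sub>F m in U. \<not> holds M \<theta> [m]"
          using mem[OF _ Neg(1)[OF \<theta>]] by (auto simp: holds_def elim: eventually_mono)
        then show False using ev by (simp add: ultra_not[OF U(2)])
      qed
      then show "\<theta> \<in> q" using types1_Neg[OF q Neg(2)[OF \<theta>]] by simp
    qed
    also have "\<dots> \<longleftrightarrow> (\<forall>\<^sub>F m in U. holds C \<theta> [m])"
      by (rule eventually_cong[OF on_M]) (use elem_ext_holds[OF MC \<theta>] in simp)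
    finally show ?thesis .
  qed
  then show thesis using that U(2) on_M by blast
qed

text \<open>\<open>type_ultra\<close> for the type realized by \<open>b\<close>, with
  \<open>C\<close> in place of \<open>N\<close>. It lets an element outside \<open>M\<close> be
  replaced by a limit over elements of \<open>M\<close>.\<close>

lemma realized_ultra:
  assumes MC: "elem_ext L M C" and b: "b \<in> univ C"
  obtains V where "ultra V" "\<forall>\<^sub>F m in V. m \<in> univ M"
    "\<forall>R. expressible L (univ M) 1 R \<longrightarrow> (R C [b] \<longleftrightarrow> (\<forall>\<^sub>F m in V. R C [m]))"
proof -
  have univ_subset: "univ M \<subseteq> univ C" using MC by (simp add: elem_ext_def)
  obtain V where V: "ultra V" "\<forall>\<^sub>F m in V. m \<in> univ M"
    "\<forall>\<theta>\<in>fms L (univ M) 1.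
       \<theta> \<in> {\<theta> \<in> fms L (univ C) 1. holds C \<theta> [b]} \<longleftrightarrow> (\<forall>\<^sub>F m in V. holds C \<theta> [m])"
    by (rule type_ultra[OF MC MC realized_type[OF b]])
  have "R C [b] \<longleftrightarrow> (\<forall>\<^sub>F m in V. R C [m])" if R: "expressible L (univ M) 1 R" for R
  proof -
    obtain \<theta> where \<theta>: "\<theta> \<in> fms L (univ M) 1"
      "\<forall>K as. length as = 1 \<longrightarrow> univ M \<union> set as \<subseteq> univ K \<longrightarrow> (holds K \<theta> as \<longleftrightarrow> R K as)"
      by (rule expressibleE[OF R])
    have eq: "holds C \<theta> [a] \<longleftrightarrow> R C [a]" if "a \<in> univ C" for a
      using \<theta>(2)[rule_format, of "[a]" C] that univ_subset by simp
    have "holds C \<theta> [b] \<longleftrightarrow> (\<forall>\<^sub>F m in V. holds C \<theta> [m])"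
      using V(3)[rule_format, OF \<theta>(1)] fms_mono[OF \<theta>(1) univ_subset order_refl] by simp
    also have "\<dots> \<longleftrightarrow> (\<forall>\<^sub>F m in V. R C [m])"
      by (rule eventually_cong[OF V(2)]) (use eq univ_subset in auto)
    finally show ?thesis using eq[OF b] by simp
  qed
  then show thesis using that V(1,2) by blast
qed

text \<open>A set that respects finitely many conditions is a union of atoms of the Boolean algebra
  they generate. \<open>J\<close> lists the atoms that meet it; for a fixed atom, membership of
  \<open>i\<close> is a mere truth value, hence a constant relation.\<close>

lemma expressible_atoms:
  assumes "finite I" "\<And>i. i \<in> I \<Longrightarrow> expressible L A 1 (E i)" "A \<subseteq> univ K"
    and X: "\<And>x y. \<lbrakk>x \<in> univ K; y \<in> univ K; \<And>i. i \<in> I \<Longrightarrow> E i K [x] \<longleftrightarrow> E i K [y]; X x\<rbrakk> \<Longrightarrow> X y"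
  obtains \<theta> where "\<theta> \<in> fms L A 1" "\<forall>x\<in>univ K. holds K \<theta> [x] \<longleftrightarrow> X x"
proof -
  define J where "J = {J \<in> Pow I. \<exists>x\<in>univ K. X x \<and> (\<forall>i\<in>I. E i K [x] \<longleftrightarrow> i \<in> J)}"
  have "finite J" using assms(1) by (simp add: J_def)
  have const: "expressible L A 1 (\<lambda>_ _. P)" for P
    using expressible_True[of L A 1] expressible_not[OF expressible_True[of L A 1]] by (cases P) simp_all
  have "expressible L A 1 (\<lambda>K as. \<exists>S\<in>J. \<forall>i\<in>I. E i K as \<longleftrightarrow> i \<in> S)"
    by (rule expressible_bex[OF \<open>finite J\<close>], rule expressible_ball[OF assms(1)],
        rule expressible_iff[OF assms(2) const])
  then obtain \<theta> where \<theta>: "\<theta> \<in> fms L A 1"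
    "\<forall>K as. length as = 1 \<longrightarrow> A \<union> set as \<subseteq> univ K \<longrightarrow>
      (holds K \<theta> as \<longleftrightarrow> (\<exists>S\<in>J. \<forall>i\<in>I. E i K as \<longleftrightarrow> i \<in> S))"
    by (rule expressibleE)
  have "holds K \<theta> [x] \<longleftrightarrow> X x" if x: "x \<in> univ K" for x
  proof -
    have "holds K \<theta> [x] \<longleftrightarrow> (\<exists>S\<in>J. \<forall>i\<in>I. E i K [x] \<longleftrightarrow> i \<in> S)"
      using \<theta>(2)[rule_format, of "[x]" K] x assms(3) by simp
    also have "\<dots> \<longleftrightarrow> X x"
    proof
      assume "\<exists>S\<in>J. \<forall>i\<in>I. E i K [x] \<longleftrightarrow> i \<in> S"
      then obtain S y where "y \<in> univ K" "X y" "\<forall>i\<in>I. E i K [y] \<longleftrightarrow> i \<in> S" "\<forall>i\<in>I. E i K [x] \<longleftrightarrow> i \<in> S"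
        by (auto simp: J_def)
      then show "X x" using X[of y x] x by blast
    next
      assume "X x"
      then have "{i \<in> I. E i K [x]} \<in> J" using x by (auto simp: J_def)
      then show "\<exists>S\<in>J. \<forall>i\<in>I. E i K [x] \<longleftrightarrow> i \<in> S"
        by (intro bexI[of _ "{i \<in> I. E i K [x]}"]) auto
    qed
    finally show ?thesis .
  qed
  then show thesis using that \<theta>(1) by blast
qed

lemma expressible_swap:
  assumes "expressible L A 2 R"
  shows "expressible L A 2 (\<lambda>K as. R K [as ! 1, as ! 0])"
proof -
  have "expressible L A 2 (\<lambda>K as. R K (map (case_sum ((!) as) (\<lambda>a. a)) [Inl 1, Inl 0]))"
    by (rule expressible_subst[OF assms]) auto
  then show ?thesis by simp
qed

lemma expressible_fix_fst:
  assumes "expressible L A (Suc n) R" "a \<in> A"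
  shows "expressible L A n (\<lambda>K as. R K (a # as))"
proof -
  have "expressible L A n (\<lambda>K as. R K (map (case_sum ((!) as) (\<lambda>a. a)) (Inr a # map Inl [0..<n])))"
    by (rule expressible_subst[OF assms(1)]) (use assms(2) in auto)
  then show ?thesis
    by (rule expressible_cong) (auto simp: comp_def map_nth)
qed

lemma expressible_fix_rest:
  assumes "expressible L A (Suc (length bs)) R" "set bs \<subseteq> A"
  shows "expressible L A 1 (\<lambda>K as. R K (as ! 0 # bs))"
proof -
  have "expressible L A 1 (\<lambda>K as. R K (map (case_sum ((!) as) (\<lambda>a. a)) (Inl 0 # map Inr bs)))"
    by (rule expressible_subst[OF assms(1)]) (use assms(2) in auto)
  then show ?thesis by (simp add: comp_def)
qed

section \<open>Saturation after adding finitely many parameters\<close>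

lemma finite_elem_ext:
  assumes "elem_ext L N C" "finite (univ N)"
  shows "univ C = univ N"
proof -
  have "expressible L (univ N) 1 (\<lambda>K as. \<exists>a\<in>univ N. as ! 0 = a)"
  proof (rule expressible_bex[OF assms(2)])
    fix a assume "a \<in> univ N"
    then show "expressible L (univ N) 1 (\<lambda>K as. as ! 0 = a)"
      using expressible_subst[OF expressible_eq[of 0 2 1], of "[Inl 0, Inr a]" 1 "univ N"] by simp
  qed
  then have "\<exists>b\<in>univ N. [a] ! 0 = b" if "a \<in> univ C" for a
    by (rule elem_ext_transfer[OF assms(1)]) (use that in \<open>auto simp: length_Suc_conv\<close>)
  then show ?thesis using assms(1) by (auto simp: elem_ext_def)
qed

lemma infinite_Un_finite_lepoll:
  assumes "infinite X" "finite B"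
  shows "X \<union> B \<lesssim> X"
  using assms(2)
proof induction
  case (insert b B)
  have "infinite (X \<union> B)" using assms(1) by simp
  then have "insert b (X \<union> B) \<lesssim> X \<union> B" by (rule infinite_insert_lepoll)
  also have "\<dots> \<lesssim> X" by (rule insert.IH)
  finally show ?case by simp
qed simp

text \<open>Adding the finite set \<open>B\<close> does not exceed the size of
  \<open>univ N\<close>: an infinite set absorbs it, and a finite structure has no proper elementary
  extension, so that \<open>B\<close> already lies in it.\<close>

lemma saturated_realize:
  assumes "saturated_above L C (univ N)" "elem_ext L N C" "finite B" "B \<subseteq> univ C"
    and "\<pi> \<subseteq> fms L (univ N \<union> B) 1" "fin_satisfiable C \<pi>"
  obtains a where "realizes C a \<pi>"
proof -
  have "univ N \<subseteq> univ C" using assms(2) by (simp add: elem_ext_def)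
  moreover have "univ N \<union> B \<lesssim> univ N"
  proof (cases "finite (univ N)")
    case True
    then have "univ N \<union> B = univ N" using finite_elem_ext[OF assms(2)] assms(4) by auto
    then show ?thesis by simp
  qed (rule infinite_Un_finite_lepoll[OF _ assms(3)])
  ultimately show thesis
    using assms(1,4-6) that unfolding saturated_above_def by (metis le_sup_iff)
qed

section \<open>Limit types and forking\<close>

text \<open>Isolates what the limit arguments use of stability: no orders in \<open>C\<close>, for
  relations with parameters anywhere in \<open>C\<close>.\<close>

locale stable_extension =
  fixes L :: "('f, 'r) lang" and M C :: "('f, 'r, 'a) str"
  assumes MC: "elem_ext L M C"
    and stab: "expressible L (univ C) 2 R \<Longrightarrow> orderless (univ C) (univ C) (\<lambda>a b. R C [a, b])"
begin

lemma univ_subset: "univ M \<subseteq> univ C"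
  using MC by (simp add: elem_ext_def)

lemma orderless_MC:
  "expressible L (univ M) 2 R \<Longrightarrow> orderless (univ M) (univ C) (\<lambda>a b. R C [a, b])"
  by (rule orderless_mono[OF stab]) (use univ_subset in \<open>auto intro: expressible_mono\<close>)

text \<open>Definability of the limit type: by finite separation the limit at \<open>b\<close>
  depends only on the truth of \<open>R C [s, b]\<close> for finitely many \<open>s\<close> in
  \<open>M\<close>. The definition is valid for all \<open>b\<close> in \<open>C\<close>, not only
  in \<open>M\<close>.\<close>

lemma limit_definable:
  assumes U: "ultra U" "\<forall>\<^sub>F m in U. m \<in> univ M" and R: "expressible L (univ M) 2 R"
  obtains \<theta> where "\<theta> \<in> fms L (univ M) 1"
    "\<forall>b\<in>univ C. holds C \<theta> [b] \<longleftrightarrow> (\<forall>\<^sub>F m in U. R C [m, b])"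
proof -
  obtain S where S: "finite S" "S \<subseteq> univ M"
    "\<forall>b\<in>univ C. \<forall>b'\<in>univ C. (\<forall>\<^sub>F x in U. R C [x, b]) \<longrightarrow> \<not> (\<forall>\<^sub>F x in U. R C [x, b']) \<longrightarrow>
       (\<exists>s\<in>S. R C [s, b] \<and> \<not> R C [s, b'])"
    by (rule ultra_finite_separation[OF orderless_MC[OF R] U])
  have R': "expressible L (univ M) (Suc 1) R" using R by (simp add: numeral_2_eq_2)
  obtain \<theta> where "\<theta> \<in> fms L (univ M) 1"
    "\<forall>b\<in>univ C. holds C \<theta> [b] \<longleftrightarrow> (\<forall>\<^sub>F x in U. R C [x, b])"
  proof (rule expressible_atoms[of S L "univ M" "\<lambda>s K as. R K (s # as)" C "\<lambda>b. \<forall>\<^sub>F x in U. R C [x, b]"])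
    show "expressible L (univ M) 1 (\<lambda>K as. R K (s # as))" if "s \<in> S" for s
      by (rule expressible_fix_fst[OF R']) (use that S(2) in auto)
    show "\<forall>\<^sub>F x in U. R C [x, c]"
      if "b \<in> univ C" "c \<in> univ C" "\<And>s. s \<in> S \<Longrightarrow> R C [s, b] \<longleftrightarrow> R C [s, c]" "\<forall>\<^sub>F x in U. R C [x, b]" for b c
      using S(3)[rule_format, OF that(1,2,4)] that(3) by blast
  qed (use S(1) univ_subset in auto)
  then show thesis by (rule that)
qed

text \<open>On \<open>M\<close>, the value at \<open>b\<close> is the limit along an ultrafilter
  \<open>V\<close> inducing the type of \<open>b\<close>; \<open>limit_definable\<close> with the
  variables exchanged defines this limit over \<open>M\<close>.\<close>

lemma externally_definable:
  assumes R: "expressible L (univ M) 2 R" and b: "b \<in> univ C"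
  obtains \<theta> where "\<theta> \<in> fms L (univ M) 1" "\<forall>m\<in>univ M. holds C \<theta> [m] \<longleftrightarrow> R C [m, b]"
proof -
  obtain V where V: "ultra V" "\<forall>\<^sub>F m in V. m \<in> univ M"
    "\<forall>R. expressible L (univ M) 1 R \<longrightarrow> (R C [b] \<longleftrightarrow> (\<forall>\<^sub>F m in V. R C [m]))"
    by (rule realized_ultra[OF MC b])
  obtain \<theta> where \<theta>: "\<theta> \<in> fms L (univ M) 1"
    "\<forall>m\<in>univ C. holds C \<theta> [m] \<longleftrightarrow> (\<forall>\<^sub>F c in V. R C [[c, m] ! 1, [c, m] ! 0])"
    by (rule limit_definable[OF V(1,2) expressible_swap[OF R]])
  have "holds C \<theta> [m] \<longleftrightarrow> R C [m, b]" if m: "m \<in> univ M" for m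
  proof -
    have "expressible L (univ M) 1 (\<lambda>K as. R K (m # as))"
      by (rule expressible_fix_fst) (use R m in \<open>simp_all add: numeral_2_eq_2\<close>)
    then have "R C [m, b] \<longleftrightarrow> (\<forall>\<^sub>F c in V. R C [m, c])" using V(3) by blast
    then show ?thesis using \<theta>(2) m univ_subset by auto
  qed
  then show thesis using that \<theta>(1) by blast
qed

text \<open>The limit type along an ultrafilter on \<open>M\<close> is \<open>M\<close>-invariant, so that it contains no
  dividing formula.\<close>

lemma limit_not_divides:
  assumes U: "ultra U" "\<forall>\<^sub>F m in U. m \<in> univ M" and div: "divides L C (univ M) \<phi> b"
  shows "\<not> (\<forall>\<^sub>F m in U. holds C \<phi> (m # b))"
proof
  assume ev: "\<forall>\<^sub>F m in U. holds C \<phi> (m # b)"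
  obtain k bs where \<phi>: "\<phi> \<in> fms L {} (Suc (length b))" and b: "set b \<subseteq> univ C"
    and bs: "\<forall>i::nat. set (bs i) \<subseteq> univ C \<and> same_type L C (univ M) b (bs i)"
    and incons: "\<forall>I. finite I \<and> card I = k \<longrightarrow> \<not> (\<exists>a\<in>univ C. \<forall>i\<in>I. holds C \<phi> (a # bs i))"
    using div unfolding divides_def by (elim conjE exE)
  \<comment> \<open>With \<open>m\<close> in \<open>M\<close> as first argument,
    \<open>\<phi>\<close> becomes a formula over \<open>M\<close>, which cannot distinguish
    \<open>b\<close> from \<open>bs i\<close>. Hence almost every \<open>m\<close> satisfies any
    \<open>k\<close> of the instances together.\<close>
  have "holds C \<phi> (m # bs i)" if m: "m \<in> univ M" "holds C \<phi> (m # b)" for m i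
  proof -
    have "\<phi> \<in> fms L (univ M) (Suc (length b))" by (rule fms_mono[OF \<phi>]) auto
    from expressible_fix_fst[OF expressible_holds[OF this] m(1)]
    obtain \<theta> where \<theta>: "\<theta> \<in> fms L (univ M) (length b)"
      "\<forall>K as. length as = length b \<longrightarrow> univ M \<union> set as \<subseteq> univ K \<longrightarrow>
         (holds K \<theta> as \<longleftrightarrow> holds K \<phi> (m # as))"
      by (rule expressibleE)
    have "length (bs i) = length b" "holds C \<theta> b \<longleftrightarrow> holds C \<theta> (bs i)"
      using bs \<theta>(1) by (auto simp: same_type_def)
    then show ?thesis
      using \<theta>(2)[rule_format, of b C] \<theta>(2)[rule_format, of "bs i" C] m(2) b bs univ_subset by simp
  qed
  then have "\<forall>\<^sub>F m in U. m \<in> univ C \<and> (\<forall>i\<in>{..<k}. holds C \<phi> (m # bs i))"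
    using eventually_conj[OF ev U(2)] univ_subset by (auto elim!: eventually_mono)
  from ultra_ex[OF U(1) this] show False using incons[rule_format, of "{..<k}"] by auto
qed

section \<open>Realizations of the limit type over larger sets, and their Morley sequences\<close>

definition realizes_limit :: "'a filter \<Rightarrow> 'a set \<Rightarrow> 'a \<Rightarrow> bool" where
  "realizes_limit V A b \<longleftrightarrow> b \<in> univ C \<and>
     (\<forall>R. expressible L A 1 R \<longrightarrow> (R C [b] \<longleftrightarrow> (\<forall>\<^sub>F c in V. R C [c])))"

lemma realizes_limit_mono: "\<lbrakk>realizes_limit V A b; B \<subseteq> A\<rbrakk> \<Longrightarrow> realizes_limit V B b"
  unfolding realizes_limit_def using expressible_mono[of L B 1 _ A] by simp

text \<open>Finite parts of the limit type are realized already in \<open>M\<close>, so saturation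
  realizes the whole type over \<open>univ N\<close> and finitely many further elements.\<close>

lemma realizes_limit_exists:
  assumes V: "ultra V" "\<forall>\<^sub>F m in V. m \<in> univ M"
    and sat: "saturated_above L C (univ N)" "elem_ext L N C" and B: "finite B" "B \<subseteq> univ C"
  obtains b where "realizes_limit V (univ N \<union> B) b"
proof -
  define \<pi> where "\<pi> = {\<theta> \<in> fms L (univ N \<union> B) 1. \<forall>\<^sub>F c in V. holds C \<theta> [c]}"
  have "fin_satisfiable C \<pi>"
    unfolding fin_satisfiable_def
  proof (intro allI impI)
    fix F assume F: "F \<subseteq> \<pi>" "finite F"
    have "\<forall>\<^sub>F c in V. c \<in> univ M \<and> (\<forall>\<theta>\<in>F. holds C \<theta> [c])"
      using V(2) F by (intro eventually_conj eventually_ball_finite) (auto simp: \<pi>_def)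
    from ultra_ex[OF V(1) this] show "\<exists>a. realizes C a F"
      using univ_subset by (auto simp: realizes_def)
  qed
  then obtain b where b: "realizes C b \<pi>"
    by (rule saturated_realize[OF sat B, rotated]) (auto simp: \<pi>_def)
  have "R C [b] \<longleftrightarrow> (\<forall>\<^sub>F c in V. R C [c])" if R: "expressible L (univ N \<union> B) 1 R" for R
  proof -
    \<comment> \<open>One direction is enough: the limit type is complete, so the converse is this
      implication for the negation.\<close>
    have imp: "S C [b]" if S: "expressible L (univ N \<union> B) 1 S" and ev: "\<forall>\<^sub>F c in V. S C [c]" for S
    proof -
      obtain \<theta> where \<theta>: "\<theta> \<in> fms L (univ N \<union> B) 1"
        "\<forall>K as. length as = 1 \<longrightarrow> univ N \<union> B \<union> set as \<subseteq> univ K \<longrightarrow> (holds K \<theta> as \<longleftrightarrow> S K as)"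
        by (rule expressibleE[OF S])
      have eq: "holds C \<theta> [a] \<longleftrightarrow> S C [a]" if "a \<in> univ C" for a
        using \<theta>(2)[rule_format, of "[a]" C] that B(2) sat(2) by (simp add: elem_ext_def)
      have "\<forall>\<^sub>F c in V. holds C \<theta> [c]"
        using eventually_conj[OF ev V(2)] eq univ_subset by (auto elim!: eventually_mono)
      then have "\<theta> \<in> \<pi>" using \<theta>(1) by (simp add: \<pi>_def)
      then show ?thesis using b eq by (auto simp: realizes_def)
    qed
    show ?thesis
      using imp[OF R] imp[OF expressible_not[OF R]] by (auto simp: ultra_not[OF V(1)])
  qed
  then have "realizes_limit V (univ N \<union> B) b"
    using b by (simp add: realizes_limit_def realizes_def)
  then show thesis by (rule that)
qed

text \<open>Finite Morley sequences of the limit type, listed from the last element to the first.\<close>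

primrec morley :: "'a filter \<Rightarrow> 'a list \<Rightarrow> bool" where
  "morley V [] \<longleftrightarrow> True"
| "morley V (b # bs) \<longleftrightarrow> realizes_limit V (univ M \<union> set bs) b \<and> morley V bs"

text \<open>The head may be replaced by almost every \<open>m\<close> in \<open>M\<close>, and
  fixing such an \<open>m\<close> leaves a relation over \<open>M\<close> on the shorter sequences.
  This uniqueness does the work of indiscernibility.\<close>

lemma morley_type_unique:
  assumes V: "\<forall>\<^sub>F m in V. m \<in> univ M" and "length bs = length cs" "morley V bs" "morley V cs"
    "expressible L (univ M) (length bs) R"
  shows "R C bs \<longleftrightarrow> R C cs"
  using assms(2-)
proof (induction bs cs arbitrary: R rule: list_induct2)
  case (Cons b bs c cs)
  have R: "expressible L (univ M) (Suc (length bs)) R" using Cons.prems(3) by simp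
  have lim: "R C (d # ds) \<longleftrightarrow> (\<forall>\<^sub>F m in V. R C (m # ds))"
    if "morley V (d # ds)" "length ds = length bs" for d ds
  proof -
    have "expressible L (univ M \<union> set ds) (Suc (length ds)) R"
      by (rule expressible_mono[of L "univ M"]) (use R that in auto)
    from expressible_fix_rest[OF this]
    have "expressible L (univ M \<union> set ds) 1 (\<lambda>K as. R K (as ! 0 # ds))" by simp
    then have "R C ([d] ! 0 # ds) \<longleftrightarrow> (\<forall>\<^sub>F m in V. R C ([m] ! 0 # ds))"
      using that(1) unfolding morley.simps realizes_limit_def by blast
    then show ?thesis by simp
  qed
  have "R C (m # bs) \<longleftrightarrow> R C (m # cs)" if "m \<in> univ M" for m
    by (rule Cons.IH[where R = "\<lambda>K as. R K (m # as)"])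
      (use Cons.prems R that in \<open>auto intro: expressible_fix_fst\<close>)
  then have "(\<forall>\<^sub>F m in V. R C (m # bs)) \<longleftrightarrow> (\<forall>\<^sub>F m in V. R C (m # cs))"
    by (intro eventually_cong[OF V]) auto
  then show ?case using lim[of b bs] lim[of c cs] Cons.prems Cons.hyps by simp
qed simp

text \<open>If all finite Morley sequences were consistent, adding realizations of the formulas one at
  a time would produce an order.\<close>

lemma morley_inconsistent:
  assumes V: "ultra V" "\<forall>\<^sub>F m in V. m \<in> univ M"
    and sat: "saturated_above L C (univ N)" "elem_ext L N C" "elem_ext L M N"
    and R: "expressible L (univ M) 2 R" and Z: "expressible L (univ M) 1 Z"
    and ZR: "\<And>a. \<lbrakk>a \<in> univ C; Z C [a]\<rbrakk> \<Longrightarrow> \<not> (\<forall>\<^sub>F c in V. R C [a, c])"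
  obtains n where "\<forall>bs. morley V bs \<and> length bs = n \<longrightarrow>
     \<not> (\<exists>a\<in>univ C. Z C [a] \<and> (\<forall>b\<in>set bs. R C [a, b]))"
proof (rule ccontr)
  note found = that
  assume "\<not> thesis"
  then have ex: "\<exists>bs. morley V bs \<and> length bs = n \<and> (\<exists>a\<in>univ C. Z C [a] \<and> (\<forall>b\<in>set bs. R C [a, b]))" for n
    using found by blast
  \<comment> \<open>Consistency is a property over \<open>M\<close> of the sequence, so one
    consistent Morley sequence of a given length makes all of that length consistent.\<close>
  have cons: "\<exists>a\<in>univ C. Z C [a] \<and> (\<forall>b\<in>set bs. R C [a, b])" if bs: "morley V bs" for bs
  proof -
    let ?n = "length bs"
    let ?E = "\<lambda>K as. \<exists>a\<in>univ K. Z K [(as @ [a]) ! ?n] \<and> (\<forall>i\<in>{..<?n}. R K [(as @ [a]) ! ?n, (as @ [a]) ! i])"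
    have "expressible L (univ M) (Suc ?n) (\<lambda>K as. Z K [as ! ?n] \<and> (\<forall>i\<in>{..<?n}. R K [as ! ?n, as ! i]))"
    proof (rule expressible_and)
      have "expressible L (univ M) (Suc ?n) (\<lambda>K as. Z K (map (case_sum ((!) as) (\<lambda>a. a)) [Inl ?n]))"
        by (rule expressible_subst[OF Z]) auto
      then show "expressible L (univ M) (Suc ?n) (\<lambda>K as. Z K [as ! ?n])" by simp
      show "expressible L (univ M) (Suc ?n) (\<lambda>K as. \<forall>i\<in>{..<?n}. R K [as ! ?n, as ! i])"
      proof (rule expressible_ball)
        fix i assume "i \<in> {..<?n}"
        then have "expressible L (univ M) (Suc ?n)
            (\<lambda>K as. R K (map (case_sum ((!) as) (\<lambda>a. a)) [Inl ?n, Inl i]))"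
          by (intro expressible_subst[OF R]) auto
        then show "expressible L (univ M) (Suc ?n) (\<lambda>K as. R K [as ! ?n, as ! i])" by simp
      qed simp
    qed
    from expressible_ex[OF this] have E: "expressible L (univ M) ?n ?E" .
    have E_iff: "?E C as \<longleftrightarrow> (\<exists>a\<in>univ C. Z C [a] \<and> (\<forall>b\<in>set as. R C [a, b]))"
      if "length as = ?n" for as
      using that by (auto simp: nth_append in_set_conv_nth all_set_conv_all_nth)
    obtain cs where "morley V cs" "length cs = ?n" "\<exists>a\<in>univ C. Z C [a] \<and> (\<forall>b\<in>set cs. R C [a, b])"
      using ex by blast
    moreover from this have "?E C bs \<longleftrightarrow> ?E C cs"
      by (intro morley_type_unique[OF V(2) _ bs _ E]) auto
    ultimately show ?thesis using E_iff[of bs] E_iff[of cs] by simp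
  qed
  \<comment> \<open>Each new \<open>a\<close> satisfies \<open>Z\<close> and is
    \<open>R\<close>-related to all earlier second components; then \<open>b\<close> realizes the
    limit type over everything chosen so far, the current \<open>a\<close> included. The base is
    \<open>univ N\<close> because saturation is available there.\<close>
  define P where "P f n r \<longleftrightarrow> (case r of (a, b) \<Rightarrow> a \<in> univ C \<and> Z C [a] \<and>
      (\<forall>i<n. R C [a, snd (f i)]) \<and>
      realizes_limit V (univ N \<union> insert a ((\<lambda>i. fst (f i)) ` {..<n} \<union> (\<lambda>i. snd (f i)) ` {..<n})) b)"
    for f :: "nat \<Rightarrow> 'a \<times> 'a" and n r
  have MN: "univ M \<subseteq> univ N" using sat(3) by (simp add: elem_ext_def)
  have "\<exists>f. \<forall>n. P f n (f n)"
  proof (rule dependent_wf_choice[OF wf])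
    show "P f x r = P g x r" if "\<And>z. (z, x) \<in> {(m, n). m < n} \<Longrightarrow> f z = g z" for f g x r
    proof -
      have "(\<lambda>i. fst (f i)) ` {..<x} = (\<lambda>i. fst (g i)) ` {..<x}"
        "(\<lambda>i. snd (f i)) ` {..<x} = (\<lambda>i. snd (g i)) ` {..<x}"
        using that by (auto intro!: image_cong)
      then show ?thesis using that unfolding P_def by (simp split: prod.split)
    qed
    fix n f assume *: "\<And>y. (y, n) \<in> {(m, n). m < n} \<Longrightarrow> P f y (f y)"
    have prev: "fst (f i) \<in> univ C"
      "realizes_limit V (univ N \<union> (\<lambda>i. snd (f i)) ` {..<i}) (snd (f i))" if "i < n" for i
      using *[of i, unfolded P_def] that by (auto split: prod.splits elim: realizes_limit_mono)
    have "morley V (map (\<lambda>i. snd (f i)) (rev [0..<m]))" if "m \<le> n" for m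
      using that
    proof (induction m)
      case (Suc m)
      have "realizes_limit V (univ M \<union> (\<lambda>i. snd (f i)) ` {..<m}) (snd (f m))"
        by (rule realizes_limit_mono[OF prev(2)]) (use Suc.prems MN in auto)
      then show ?case using Suc by (simp add: atLeast0LessThan)
    qed simp
    from cons[OF this[OF order_refl]] obtain a where a: "a \<in> univ C" "Z C [a]"
      "\<And>i. i < n \<Longrightarrow> R C [a, snd (f i)]" by auto
    obtain b where "realizes_limit V
        (univ N \<union> insert a ((\<lambda>i. fst (f i)) ` {..<n} \<union> (\<lambda>i. snd (f i)) ` {..<n})) b"
      by (rule realizes_limit_exists[OF V sat(1,2),
            of "insert a ((\<lambda>i. fst (f i)) ` {..<n} \<union> (\<lambda>i. snd (f i)) ` {..<n})"])
        (use a(1) prev in \<open>auto simp: realizes_limit_def\<close>)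
    with a have "P f n (a, b)" unfolding P_def by auto
    then show "\<exists>r. P f n r" by blast
  qed
  then obtain f where f: "\<And>n. P f n (f n)" by blast
  define a b where "a n = fst (f n)" and "b n = snd (f n)" for n
  have a: "a n \<in> univ C" "Z C [a n]" "i < n \<Longrightarrow> R C [a n, b i]" for i n
    using f[of n] by (auto simp: P_def a_def b_def split: prod.splits)
  have b: "realizes_limit V (univ N \<union> a ` {..n}) (b n)" for n
  proof -
    have "realizes_limit V (univ N \<union> insert (a n) (a ` {..<n} \<union> b ` {..<n})) (b n)"
      using f[of n] by (auto simp: P_def a_def[abs_def] b_def[abs_def] split: prod.splits)
    then show ?thesis by (rule realizes_limit_mono) (auto simp: le_less)
  qed
  \<comment> \<open>\<open>b j\<close> is generic over \<open>a i\<close>, so \<open>R\<close> holds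
    only if it holds at the limit, which \<open>ZR\<close> forbids.\<close>
  have "\<not> R C [a i, b j]" if "i \<le> j" for i j
  proof -
    have "expressible L (univ N \<union> a ` {..j}) (Suc 1) R"
      by (rule expressible_mono[of L "univ M"]) (use R MN in \<open>auto simp: numeral_2_eq_2\<close>)
    then have "expressible L (univ N \<union> a ` {..j}) 1 (\<lambda>K as. R K (a i # as))"
      by (rule expressible_fix_fst) (use that in auto)
    then have "R C [a i, b j] \<longleftrightarrow> (\<forall>\<^sub>F c in V. R C [a i, c])"
      using b[of j] unfolding realizes_limit_def by blast
    then show ?thesis using ZR a(1,2) by blast
  qed
  then have order: "R C [a i, b j] \<longleftrightarrow> j < i" for i j using a(3)[of j i] by (meson not_less)
  have "orderless (univ C) (univ C) (\<lambda>a b. R C [a, b])"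
    by (rule stab) (use R univ_subset in \<open>auto intro: expressible_mono\<close>)
  then show False
    by (rule orderless_gtD[of _ _ "\<lambda>a b. R C [a, b]" a b, OF _ _ _ order]) (use a(1) b in \<open>auto simp: realizes_limit_def\<close>)
qed

text \<open>The limit type contains the given partial type and omits all dividing formulas. Hence
  the partial type together with the negations of the formulas in \<open>D\<close> is finitely
  satisfiable, and a realization escapes the disjunction.\<close>

lemma limit_not_forks:
  assumes sat: "saturated_above L C (univ N)" "elem_ext L N C" "elem_ext L M N"
    and q: "q \<in> types1 L N" and U: "ultra U" "\<forall>\<^sub>F m in U. m \<in> univ M"
    and \<Delta>: "\<Delta> \<subseteq> fms L (univ M) 2"
    and agree: "\<And>\<psi> b. \<lbrakk>\<psi> \<in> \<Delta>; b \<in> univ N\<rbrakk> \<Longrightarrow>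
       inst [1 \<mapsto> b] \<psi> \<in> q \<longleftrightarrow> (\<forall>\<^sub>F m in U. holds C \<psi> [m, b])"
  shows "\<not> forks L C (univ M) (restr_to N q \<Delta>)"
proof
  assume "forks L C (univ M) (restr_to N q \<Delta>)"
  then obtain D where D: "finite D" "\<forall>(\<phi>, b)\<in>D. divides L C (univ M) \<phi> b"
    "\<forall>a. realizes C a (restr_to N q \<Delta>) \<longrightarrow> (\<exists>(\<phi>, b)\<in>D. holds C \<phi> (a # b))"
    unfolding forks_def by blast
  have MN: "univ M \<subseteq> univ N" using sat(3) by (simp add: elem_ext_def)
  \<comment> \<open>Saturation speaks of formulas in one variable, so the tuple of each dividing
    formula is moved back into constants.\<close>
  have "\<forall>x\<in>D. \<exists>\<theta>. \<theta> \<in> fms L (set (snd x)) 1 \<and>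
      (\<forall>a\<in>univ C. holds C \<theta> [a] \<longleftrightarrow> \<not> holds C (fst x) (a # snd x))"
  proof
    fix x assume x: "x \<in> D"
    then have div: "divides L C (univ M) (fst x) (snd x)" using D(2) by (cases x) auto
    then have "fst x \<in> fms L (set (snd x)) (Suc (length (snd x)))"
      by (auto simp: divides_def intro: fms_mono)
    from expressible_fix_rest[OF expressible_not[OF expressible_holds[OF this]] order_refl]
    obtain \<theta> where \<theta>: "\<theta> \<in> fms L (set (snd x)) 1"
      "\<forall>K as. length as = 1 \<longrightarrow> set (snd x) \<union> set as \<subseteq> univ K \<longrightarrow>
        (holds K \<theta> as \<longleftrightarrow> \<not> holds K (fst x) (as ! 0 # snd x))"
      by (rule expressibleE)
    have "holds C \<theta> [a] \<longleftrightarrow> \<not> holds C (fst x) (a # snd x)" if "a \<in> univ C" for a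
      using \<theta>(2)[rule_format, of "[a]" C] that div by (simp add: divides_def)
    then show "\<exists>\<theta>. \<theta> \<in> fms L (set (snd x)) 1 \<and>
        (\<forall>a\<in>univ C. holds C \<theta> [a] \<longleftrightarrow> \<not> holds C (fst x) (a # snd x))"
      using \<theta>(1) by blast
  qed
  from bchoice[OF this] obtain \<nu> where \<nu>: "\<forall>x\<in>D. \<nu> x \<in> fms L (set (snd x)) 1 \<and>
      (\<forall>a\<in>univ C. holds C (\<nu> x) [a] \<longleftrightarrow> \<not> holds C (fst x) (a # snd x))" by blast
  define B where "B = (\<Union>x\<in>D. set (snd x))"
  define \<pi> where "\<pi> = restr_to N q \<Delta> \<union> \<nu> ` D"
  have "set (snd x) \<subseteq> univ C" if "x \<in> D" for x
    using D(2) that by (cases x) (auto simp: divides_def)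
  then have B: "finite B" "B \<subseteq> univ C"
    using D(1) by (auto simp: B_def)
  have "\<pi> \<subseteq> fms L (univ N \<union> B) 1"
  proof
    fix \<theta> assume "\<theta> \<in> \<pi>"
    then consider "\<theta> \<in> q" | x where "x \<in> D" "\<theta> = \<nu> x"
      by (auto simp: \<pi>_def restr_to_def)
    then show "\<theta> \<in> fms L (univ N \<union> B) 1"
    proof cases
      case 1
      then have "\<theta> \<in> fms L (univ N) 1" using q by (auto simp: types1_def)
      then show ?thesis by (rule fms_mono) auto
    next
      case 2
      then have "\<theta> \<in> fms L (set (snd x)) 1" using \<nu> by blast
      then show ?thesis by (rule fms_mono) (use 2 in \<open>auto simp: B_def\<close>)
    qed
  qed
  moreover have ev: "\<forall>\<^sub>F m in U. holds C \<theta> [m]" if "\<theta> \<in> \<pi>" for \<theta>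
    using that unfolding \<pi>_def
  proof
    assume \<theta>: "\<theta> \<in> restr_to N q \<Delta>"
    then obtain \<psi> b where \<psi>: "\<psi> \<in> \<Delta>" "b \<in> univ N"
      and "\<theta> = inst [1 \<mapsto> b] \<psi> \<or> \<theta> = Neg (inst [1 \<mapsto> b] \<psi>)"
      by (auto simp: restr_to_def)
    then consider "\<theta> = inst [1 \<mapsto> b] \<psi>" | "\<theta> = Neg (inst [1 \<mapsto> b] \<psi>)" by blast
    then show ?thesis
    proof cases
      case 1
      then have "inst [1 \<mapsto> b] \<psi> \<in> q" using \<theta> by (simp add: restr_to_def)
      then have "\<forall>\<^sub>F m in U. holds C \<psi> [m, b]" using agree[OF \<psi>] by simp
      then show ?thesis using holds_inst_1[of \<psi> L "univ M" C b] \<psi>(1) \<Delta> 1 by auto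
    next
      case 2
      have fms: "\<psi> \<in> fms L (univ M) 2" "inst [1 \<mapsto> b] \<psi> \<in> fms L (univ N) 1"
        using \<psi> \<Delta> MN fms_mono[of \<psi> L "univ M" 2 "univ N" 2] by (auto simp del: One_nat_def intro: inst_1_fms)
      then have "\<not> (\<forall>\<^sub>F m in U. holds C \<psi> [m, b])"
        using agree[OF \<psi>] types1_Neg[OF q fms(2)] \<theta> 2 by (auto simp: restr_to_def)
      then show ?thesis
        using holds_inst_1[OF fms(1), of C b] 2 by (simp add: ultra_not[OF U(1)] holds_def)
    qed
  next
    assume "\<theta> \<in> \<nu> ` D"
    then obtain x where x: "x \<in> D" "\<theta> = \<nu> x" by blast
    then have "\<forall>\<^sub>F m in U. \<not> holds C (fst x) (m # snd x)"
      using limit_not_divides[OF U, of "fst x" "snd x"] D(2)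
      by (cases x) (auto simp: ultra_not[OF U(1)])
    then have "\<forall>\<^sub>F m in U. m \<in> univ M \<and> \<not> holds C (fst x) (m # snd x)"
      using U(2) by (simp add: eventually_conj)
    then show ?thesis using \<nu> x univ_subset by (auto elim!: eventually_mono)
  qed
  have "fin_satisfiable C \<pi>"
    unfolding fin_satisfiable_def
  proof (intro allI impI)
    fix F assume F: "F \<subseteq> \<pi>" "finite F"
    have "\<forall>\<^sub>F m in U. m \<in> univ M \<and> (\<forall>\<theta>\<in>F. holds C \<theta> [m])"
      using U(2) F ev by (intro eventually_conj eventually_ball_finite) auto
    from ultra_ex[OF U(1) this] show "\<exists>a. realizes C a F"
      using univ_subset by (auto simp: realizes_def)
  qed
  ultimately obtain a where a: "realizes C a \<pi>"
    by (rule saturated_realize[OF sat(1,2) B])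
  then have "realizes C a (restr_to N q \<Delta>)" by (auto simp: realizes_def \<pi>_def)
  then obtain x where x: "x \<in> D" "holds C (fst x) (a # snd x)" using D(3) by fastforce
  have "a \<in> univ C" "holds C (\<nu> x) [a]" using a x(1) by (auto simp: realizes_def \<pi>_def)
  then show False using \<nu> x by blast
qed

text \<open>Every element is generic over \<open>univ N\<close> and its predecessors, so each finite
  set of indices, listed downwards, gives a Morley sequence over \<open>M\<close>.\<close>

lemma realizes_limit_sequence:
  assumes V: "ultra V" "\<forall>\<^sub>F m in V. m \<in> univ M"
    and sat: "saturated_above L C (univ N)" "elem_ext L N C" "elem_ext L M N"
  obtains s :: "nat \<Rightarrow> 'a" where "\<forall>i. realizes_limit V (univ M) (s i)"
    "\<forall>I. finite I \<longrightarrow> (\<exists>bs. morley V bs \<and> set bs = s ` I \<and> length bs = card I)"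
proof -
  have MN: "univ M \<subseteq> univ N" using sat(3) by (simp add: elem_ext_def)
  have "\<exists>s :: nat \<Rightarrow> 'a. \<forall>n. realizes_limit V (univ N \<union> s ` {..<n}) (s n)"
  proof (rule dependent_wf_choice[OF wf,
        where P = "\<lambda>s n b. realizes_limit V (univ N \<union> s ` {..<n}) b"])
    show "realizes_limit V (univ N \<union> f ` {..<n}) b = realizes_limit V (univ N \<union> g ` {..<n}) b"
      if "\<And>z. (z, n) \<in> {(m, n). m < n} \<Longrightarrow> f z = g z" for f g and n :: nat and b
    proof -
      have "f ` {..<n} = g ` {..<n}" using that by (intro image_cong) auto
      then show ?thesis by simp
    qed
    fix n :: nat and s assume *: "\<And>y. (y, n) \<in> {(m, n). m < n} \<Longrightarrow> realizes_limit V (univ N \<union> s ` {..<y}) (s y)"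
    have "s i \<in> univ C" if "i < n" for i
      using *[of i] that by (simp add: realizes_limit_def)
    then have "finite (s ` {..<n})" "s ` {..<n} \<subseteq> univ C" by auto
    from realizes_limit_exists[OF V sat(1,2) this]
    obtain b where "realizes_limit V (univ N \<union> s ` {..<n}) b"
      by blast
    then show "\<exists>b. realizes_limit V (univ N \<union> s ` {..<n}) b" ..
  qed
  then obtain s :: "nat \<Rightarrow> 'a" where s: "\<And>n. realizes_limit V (univ N \<union> s ` {..<n}) (s n)" by blast
  \<comment> \<open>The length counts indices and not values: \<open>s\<close> need not be
    injective, for instance when the limit type is realized in \<open>M\<close>.\<close>
  have "\<exists>bs. morley V bs \<and> set bs = s ` I \<and> length bs = card I" if "finite I" for I
    using that
  proof (induction rule: finite_linorder_max_induct)
    case empty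
    then show ?case by simp
  next
    case (insert i I)
    then obtain bs where bs: "morley V bs" "set bs = s ` I" "length bs = card I" by blast
    have "realizes_limit V (univ M \<union> set bs) (s i)"
      by (rule realizes_limit_mono[OF s]) (use bs(2) insert.hyps MN in auto)
    then show ?case
      using bs insert.hyps by (intro exI[of _ "s i # bs"]) auto
  qed
  moreover have "realizes_limit V (univ M) (s i)" for i
    by (rule realizes_limit_mono[OF s]) (use MN in auto)
  ultimately show thesis by (intro that[of s]) simp_all
qed

text \<open>A single dividing formula suffices, the conjunction of \<open>R\<close> and
  \<open>Z\<close>. Since \<open>R\<close> is any expressible relation, the lemma covers negated
  instances too.\<close>

lemma forks_if_not_limit:
  assumes sat: "saturated_above L C (univ N)" "elem_ext L N C" "elem_ext L M N"
    and U: "ultra U" "\<forall>\<^sub>F m in U. m \<in> univ M"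
    and R: "expressible L (univ M) 2 R" and b: "b \<in> univ C" "\<not> (\<forall>\<^sub>F m in U. R C [m, b])"
    and \<pi>: "\<And>a. realizes C a \<pi> \<Longrightarrow> R C [a, b]"
      "\<And>a c. \<lbrakk>realizes C a \<pi>; c \<in> univ M\<rbrakk> \<Longrightarrow> R C [a, c] \<longleftrightarrow> (\<forall>\<^sub>F m in U. R C [m, c])"
  shows "forks L C (univ M) \<pi>"
proof -
  obtain V where V: "ultra V" "\<forall>\<^sub>F m in V. m \<in> univ M"
    and tp: "\<forall>R. expressible L (univ M) 1 R \<longrightarrow> (R C [b] \<longleftrightarrow> (\<forall>\<^sub>F m in V. R C [m]))"
    by (rule realized_ultra[OF MC b(1)])
  \<comment> \<open>The variables are exchanged: \<open>S\<close> is to separate elements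
    \<open>a\<close> of \<open>C\<close> by their limits along \<open>V\<close>.\<close>
  have "orderless (univ M) (univ C) (\<lambda>c a. R C [a, c])"
    using orderless_MC[OF expressible_swap[OF R]] by simp
  then obtain S where S: "finite S" "S \<subseteq> univ M"
    "\<forall>a\<in>univ C. \<forall>a'\<in>univ C. (\<forall>\<^sub>F c in V. R C [a, c]) \<longrightarrow> \<not> (\<forall>\<^sub>F c in V. R C [a', c]) \<longrightarrow>
       (\<exists>s\<in>S. R C [a, s] \<and> \<not> R C [a', s])"
    by (rule ultra_finite_separation[OF _ V])
  obtain \<theta> where \<theta>: "\<theta> \<in> fms L (univ M) 1"
    "\<forall>b\<in>univ C. holds C \<theta> [b] \<longleftrightarrow> (\<forall>\<^sub>F m in U. R C [m, b])"
    by (rule limit_definable[OF U R])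
  \<comment> \<open>\<open>\<theta>\<close> is over \<open>M\<close>, so its failure at
    \<open>b\<close> is a failure at \<open>V\<close>-almost all \<open>c\<close>. Commuting the
    limits moves it to \<open>U\<close>-almost all \<open>m\<close>.\<close>
  have "\<not> (\<forall>\<^sub>F c in V. holds C \<theta> [c])"
    using tp[rule_format, OF expressible_holds[OF \<theta>(1)]] b \<theta>(2) by simp
  moreover have "(\<forall>\<^sub>F c in V. holds C \<theta> [c]) \<longleftrightarrow> (\<forall>\<^sub>F c in V. \<forall>\<^sub>F m in U. R C [m, c])"
    by (rule eventually_cong[OF V(2)]) (use \<theta>(2) univ_subset in blast)
  moreover have "orderless (univ M) (univ M) (\<lambda>a c. R C [a, c])"
    by (rule orderless_mono[OF orderless_MC[OF R]]) (use univ_subset in auto)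
  ultimately have UV: "\<forall>\<^sub>F m in U. \<not> (\<forall>\<^sub>F c in V. R C [m, c])"
    using ultra_commute[OF _ U V, of "\<lambda>a c. R C [a, c]"] by (simp add: ultra_not[OF U(1)])
  \<comment> \<open>\<open>Z\<close> prescribes for \<open>x\<close> the values at \<open>S\<close>
    given by the limit along \<open>U\<close>. These are truth values fixed once in
    \<open>C\<close>, so they enter the formula as constants.\<close>
  define Z where "Z K as \<longleftrightarrow> (\<forall>s\<in>S. R K [as ! 0, s] \<longleftrightarrow> (\<forall>\<^sub>F m in U. R C [m, s]))" for K as
  have const: "expressible L (univ M) n (\<lambda>_ _. P)" for P n
    using expressible_True[of L "univ M" n] expressible_not[OF expressible_True[of L "univ M" n]]
    by (cases P) simp_all
  have Z: "expressible L (univ M) n Z" if "n > 0" for n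
    unfolding Z_def[abs_def]
  proof (rule expressible_ball[OF S(1)], rule expressible_iff[OF _ const])
    fix s assume "s \<in> S"
    then have "expressible L (univ M) n (\<lambda>K as. R K (map (case_sum ((!) as) (\<lambda>a. a)) [Inl 0, Inr s]))"
      by (intro expressible_subst[OF R]) (use that S(2) in auto)
    then show "expressible L (univ M) n (\<lambda>K as. R K [as ! 0, s])" by simp
  qed
  \<comment> \<open>Almost every \<open>m\<close> has the values prescribed by \<open>Z\<close> and
    a false limit along \<open>V\<close>. An \<open>a\<close> with a true limit would be separated
    from \<open>m\<close> at a point of \<open>S\<close>, where the two agree.\<close>
  have ZR: "\<not> (\<forall>\<^sub>F c in V. R C [a, c])" if a: "a \<in> univ C" "Z C [a]" for a
  proof
    assume lim: "\<forall>\<^sub>F c in V. R C [a, c]"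
    have "\<forall>\<^sub>F m in U. R C [m, s] \<longleftrightarrow> (\<forall>\<^sub>F m in U. R C [m, s])" for s
    proof (cases "\<forall>\<^sub>F m in U. R C [m, s]")
      case False
      then have "\<forall>\<^sub>F m in U. \<not> R C [m, s]" by (simp add: ultra_not[OF U(1)])
      then show ?thesis using False by simp
    qed simp
    then have "\<forall>\<^sub>F m in U. m \<in> univ M \<and> \<not> (\<forall>\<^sub>F c in V. R C [m, c]) \<and>
        (\<forall>s\<in>S. R C [m, s] \<longleftrightarrow> (\<forall>\<^sub>F m in U. R C [m, s]))"
      by (intro eventually_conj U(2) UV eventually_ball_finite[OF S(1)]) blast
    from ultra_ex[OF U(1) this] obtain m where m: "m \<in> univ M" "\<not> (\<forall>\<^sub>F c in V. R C [m, c])"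
      "\<forall>s\<in>S. R C [m, s] \<longleftrightarrow> (\<forall>\<^sub>F m in U. R C [m, s])" by blast
    then obtain s where "s \<in> S" "R C [a, s]" "\<not> R C [m, s]"
      using S(3)[rule_format, OF a(1) _ lim, of m] univ_subset by blast
    then show False using m(3) a(2) by (simp add: Z_def)
  qed
  obtain n where n: "\<forall>bs. morley V bs \<and> length bs = n \<longrightarrow>
     \<not> (\<exists>a\<in>univ C. Z C [a] \<and> (\<forall>b\<in>set bs. R C [a, b]))"
    by (rule morley_inconsistent[OF V sat R Z ZR]) auto
  have "expressible L (univ M) 2 (\<lambda>K as. R K as \<and> Z K as)"
    by (rule expressible_and[OF R Z]) simp
  then obtain \<phi> where \<phi>: "\<phi> \<in> fms L (univ M) 2"
    "\<forall>K as. length as = 2 \<longrightarrow> univ M \<union> set as \<subseteq> univ K \<longrightarrow> (holds K \<phi> as \<longleftrightarrow> R K as \<and> Z K as)"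
    by (rule expressibleE)
  \<comment> \<open>The parameters \<open>ps\<close> join the tuple; lying in \<open>M\<close>, they
    do not disturb equality of types over \<open>M\<close>.\<close>
  obtain \<psi> ps where \<psi>: "set ps \<subseteq> univ M" "\<psi> \<in> fms L {} (2 + length ps)"
    "\<forall>K as. length as = 2 \<longrightarrow> (holds K \<psi> (as @ ps) \<longleftrightarrow> holds K \<phi> as)"
    by (rule params_abstract[OF \<phi>(1)])
  have \<psi>_iff: "holds C \<psi> (a # c # ps) \<longleftrightarrow> R C [a, c] \<and> Z C [a]" if "a \<in> univ C" "c \<in> univ C" for a c
    using \<psi>(3)[rule_format, of "[a, c]" C] \<phi>(2)[rule_format, of "[a, c]" C] that univ_subset by (simp add: Z_def)
  obtain s :: "nat \<Rightarrow> 'a" where s: "\<forall>i. realizes_limit V (univ M) (s i)"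
    "\<forall>I. finite I \<longrightarrow> (\<exists>bs. morley V bs \<and> set bs = s ` I \<and> length bs = card I)"
    by (rule realizes_limit_sequence[OF V sat])
  have sC: "s i \<in> univ C" for i using s(1) by (simp add: realizes_limit_def)
  have "divides L C (univ M) \<psi> (b # ps)"
    unfolding divides_def
  \<comment> \<open>\<open>n\<close> elements contradict \<open>R\<close> only together with
    \<open>Z\<close>. The extra element makes \<open>I\<close> nonempty even for
    \<open>n = 0\<close>, so that \<open>Z C [a]\<close> can be read off.\<close>
  proof (intro conjI exI[of _ "Suc n"] exI[of _ "\<lambda>i. s i # ps"] allI impI)
    show "\<psi> \<in> fms L {} (Suc (length (b # ps)))" using \<psi>(2) by simp
    show "set (b # ps) \<subseteq> univ C" "set (s i # ps) \<subseteq> univ C" for i using b \<psi>(1) univ_subset sC by auto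
    show "same_type L C (univ M) (b # ps) (s i # ps)" for i
      unfolding same_type_def
    proof (intro conjI ballI)
      fix \<theta> assume "\<theta> \<in> fms L (univ M) (length (b # ps))"
      then have "expressible L (univ M) 1 (\<lambda>K as. holds K \<theta> (as ! 0 # ps))"
        by (intro expressible_fix_rest[OF expressible_holds] \<psi>(1)) simp
      then have "holds C \<theta> ([b] ! 0 # ps) \<longleftrightarrow> holds C \<theta> ([s i] ! 0 # ps)"
        using tp s(1)[rule_format, of i] unfolding realizes_limit_def by blast
      then show "holds C \<theta> (b # ps) \<longleftrightarrow> holds C \<theta> (s i # ps)" by simp
    qed simp
    fix I :: "nat set" assume "finite I \<and> card I = Suc n"
    then obtain i J where J: "I = insert i J" "finite J" "card J = n"
      by (auto simp: card_Suc_eq)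
    then obtain bs where bs: "morley V bs" "set bs = s ` J" "length bs = n" using s(2) by blast
    show "\<not> (\<exists>a\<in>univ C. \<forall>i\<in>I. holds C \<psi> (a # s i # ps))"
    proof
      assume "\<exists>a\<in>univ C. \<forall>i\<in>I. holds C \<psi> (a # s i # ps)"
      then obtain a where "a \<in> univ C" "\<forall>i\<in>I. R C [a, s i] \<and> Z C [a]"
        using \<psi>_iff sC by blast
      then have "\<exists>a\<in>univ C. Z C [a] \<and> (\<forall>b\<in>set bs. R C [a, b])"
        using bs(2) J(1) by auto
      then show False using n bs(1,3) by blast
    qed
  qed
  moreover have "holds C \<psi> (a # b # ps)" if "realizes C a \<pi>" for a
    using that \<pi> S(2) b(1) by (subst \<psi>_iff) (auto simp: Z_def realizes_def)
  ultimately show ?thesis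
    unfolding forks_def by (intro exI[of _ "{(\<psi>, b # ps)}"]) auto
qed

end

text \<open>Over \<open>M\<close>, \<open>q\<close> and the limit agree by choice of
  \<open>U\<close>. If they differ at some \<open>b\<close>, then the instance or its negation lies
  in \<open>q\<close> outside the limit, and \<open>forks_if_not_limit\<close> applies.\<close>

lemma (in stable_extension) not_forks_iff_limit:
  assumes sat: "saturated_above L C (univ N)" "elem_ext L N C" "elem_ext L M N"
    and q: "q \<in> types1 L N" and U: "ultra U" "\<forall>\<^sub>F m in U. m \<in> univ M"
    and qU: "\<forall>\<theta>\<in>fms L (univ M) 1. \<theta> \<in> q \<longleftrightarrow> (\<forall>\<^sub>F m in U. holds C \<theta> [m])"
    and \<Delta>: "\<Delta> \<subseteq> fms L (univ M) 2"
  shows "\<not> forks L C (univ M) (restr_to N q \<Delta>) \<longleftrightarrow>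
    (\<forall>\<psi>\<in>\<Delta>. \<forall>b\<in>univ N. inst [1 \<mapsto> b] \<psi> \<in> q \<longleftrightarrow> (\<forall>\<^sub>F m in U. holds C \<psi> [m, b]))"
proof
  assume nf: "\<not> forks L C (univ M) (restr_to N q \<Delta>)"
  have MN: "univ M \<subseteq> univ N" and NC: "univ N \<subseteq> univ C"
    using sat(2,3) by (simp_all add: elem_ext_def)
  show "\<forall>\<psi>\<in>\<Delta>. \<forall>b\<in>univ N. inst [1 \<mapsto> b] \<psi> \<in> q \<longleftrightarrow> (\<forall>\<^sub>F m in U. holds C \<psi> [m, b])"
  proof (intro ballI)
    fix \<psi> b assume \<psi>: "\<psi> \<in> \<Delta>" and b: "b \<in> univ N"
    have fms: "\<psi> \<in> fms L (univ M) 2" using \<psi> \<Delta> by blast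
    \<comment> \<open>\<open>restr_to\<close> keeps negated instances as well, so a realization
      decides every instance over \<open>N\<close> exactly as \<open>q\<close> does.\<close>
    have real: "holds C \<psi> [a, c] \<longleftrightarrow> inst [1 \<mapsto> c] \<psi> \<in> q"
      if a: "realizes C a (restr_to N q \<Delta>)" and c: "c \<in> univ N" for a c
    proof (cases "inst [1 \<mapsto> c] \<psi> \<in> q")
      case True
      then have "inst [1 \<mapsto> c] \<psi> \<in> restr_to N q \<Delta>" using \<psi> c by (auto simp: restr_to_def)
      then show ?thesis
        using a True holds_inst_1[OF fms, of C c a] by (auto simp: realizes_def)
    next
      case False
      have "inst [1 \<mapsto> c] \<psi> \<in> fms L (univ N) 1"
        by (rule inst_1_fms[OF fms_mono[OF fms MN order_refl] c])
      then have "Neg (inst [1 \<mapsto> c] \<psi>) \<in> q" using types1_Neg[OF q] False by blast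
      then have "Neg (inst [1 \<mapsto> c] \<psi>) \<in> restr_to N q \<Delta>" using \<psi> c by (auto simp: restr_to_def)
      then have "holds C (Neg (inst [1 \<mapsto> c] \<psi>)) [a]" using a by (auto simp: realizes_def)
      then show ?thesis
        using False holds_inst_1[OF fms, of C c a] by (simp add: holds_def)
    qed
    have lim: "inst [1 \<mapsto> c] \<psi> \<in> q \<longleftrightarrow> (\<forall>\<^sub>F m in U. holds C \<psi> [m, c])" if "c \<in> univ M" for c
      using qU inst_1_fms[OF fms that] by (simp only: holds_inst_1[OF fms])
    show "inst [1 \<mapsto> b] \<psi> \<in> q \<longleftrightarrow> (\<forall>\<^sub>F m in U. holds C \<psi> [m, b])"
    proof (rule ccontr)
      assume ne: "\<not> ?thesis"
      have "forks L C (univ M) (restr_to N q \<Delta>)"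
      proof (cases "inst [1 \<mapsto> b] \<psi> \<in> q")
        case True
        show ?thesis
          by (rule forks_if_not_limit[OF sat U expressible_holds[OF fms], of b])
            (use True ne b NC MN real lim in auto)
      next
        case False
        then have "\<forall>\<^sub>F m in U. holds C \<psi> [m, b]" using ne by blast
        then have "\<not> (\<forall>\<^sub>F m in U. \<not> holds C \<psi> [m, b])" by (simp add: ultra_not[OF U(1)])
        then show ?thesis
          by (intro forks_if_not_limit[OF sat U expressible_not[OF expressible_holds[OF fms]], of b])
            (use False b NC MN real lim in \<open>auto simp: ultra_not[OF U(1)]\<close>)
      qed
      then show False using nf by blast
    qed
  qed
qed (use limit_not_forks[OF sat q U \<Delta>] in blast)

section \<open>Extension of definable sets and groups\<close>

text \<open>Equality of two definable sets transfers from \<open>M\<close> to \<open>N\<close>, so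
  the formula picked by \<open>SOME\<close> is harmless.\<close>

lemma sharp_defset:
  assumes MN: "elem_ext L M N" and \<alpha>: "\<alpha> \<in> fms L (univ M) 1"
  shows "sharp L M N (defset M \<alpha>) = defset N \<alpha>"
proof -
  have eq: "defset N \<phi> = defset N \<alpha>" if "\<phi> \<in> fms L (univ M) 1" "defset M \<phi> = defset M \<alpha>" for \<phi>
  proof -
    have "holds N \<phi> [a] \<longleftrightarrow> holds N \<alpha> [a]" if "a \<in> univ N" for a
    proof (rule elem_ext_transfer[OF MN, of 1 "\<lambda>K as. holds K \<phi> as \<longleftrightarrow> holds K \<alpha> as"])
      show "expressible L (univ M) 1 (\<lambda>K as. holds K \<phi> as \<longleftrightarrow> holds K \<alpha> as)"
        by (intro expressible_iff expressible_holds \<alpha> \<open>\<phi> \<in> fms L (univ M) 1\<close>)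
      show "holds M \<phi> as \<longleftrightarrow> holds M \<alpha> as" if "length as = 1" "set as \<subseteq> univ M" for as
        using that \<open>defset M \<phi> = defset M \<alpha>\<close> by (auto simp: defset_def set_eq_iff length_Suc_conv)
    qed (use that in auto)
    then show ?thesis by (auto simp: defset_def)
  qed
  have "(SOME \<phi>. \<phi> \<in> fms L (univ M) 1 \<and> defset M \<phi> = defset M \<alpha>) \<in> fms L (univ M) 1 \<and>
    defset M (SOME \<phi>. \<phi> \<in> fms L (univ M) 1 \<and> defset M \<phi> = defset M \<alpha>) = defset M \<alpha>"
    by (rule someI[of _ \<alpha>]) (use \<alpha> in simp)
  then show ?thesis unfolding sharp_def using eq by blast
qed

text \<open>Independence of the defining formula: otherwise \<open>\<phi>\<close> and
  \<open>Neg \<theta>\<close>, both in \<open>q\<close>, would have a common realization in spite of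
  defining complementary sets.\<close>

lemma set_in_type_defset:
  assumes q: "q \<in> types1 L N" and \<theta>: "\<theta> \<in> fms L (univ N) 1"
  shows "set_in_type N (defset N \<theta>) q \<longleftrightarrow> \<theta> \<in> q"
proof
  assume "set_in_type N (defset N \<theta>) q"
  then obtain \<phi> where \<phi>: "\<phi> \<in> q" "defset N \<phi> = defset N \<theta>" by (auto simp: set_in_type_def)
  show "\<theta> \<in> q"
  proof (rule ccontr)
    assume "\<theta> \<notin> q"
    then have "{\<phi>, Neg \<theta>} \<subseteq> q" using types1_Neg[OF q \<theta>] \<phi>(1) by simp
    then obtain a where "realizes N a {\<phi>, Neg \<theta>}"
      using q unfolding types1_def fin_satisfiable_def by blast
    then show False using \<phi>(2) by (auto simp: realizes_def holds_def defset_def)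
  qed
qed (auto simp: set_in_type_def)

lemma set_in_restr_type_defset:
  assumes MN: "elem_ext L M N" and q: "q \<in> types1 L N" and \<theta>: "\<theta> \<in> fms L (univ M) 1"
  shows "set_in_type M (defset M \<theta>) (restr_type L q M) \<longleftrightarrow> \<theta> \<in> q"
proof
  assume "set_in_type M (defset M \<theta>) (restr_type L q M)"
  then obtain \<phi> where \<phi>: "\<phi> \<in> q" "\<phi> \<in> fms L (univ M) 1" "defset M \<phi> = defset M \<theta>"
    by (auto simp: set_in_type_def restr_type_def)
  then have "defset N \<phi> = defset N \<theta>"
    using sharp_defset[OF MN \<phi>(2)] sharp_defset[OF MN \<theta>] by simp
  then have "set_in_type N (defset N \<theta>) q" using \<phi>(1) by (auto simp: set_in_type_def)
  moreover have "\<theta> \<in> fms L (univ N) 1"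
    by (rule fms_mono[OF \<theta>]) (use MN in \<open>auto simp: elem_ext_def\<close>)
  ultimately show "\<theta> \<in> q" using set_in_type_defset[OF q] by blast
qed (use \<theta> in \<open>auto simp: set_in_type_def restr_type_def\<close>)

text \<open>\<open>group_of\<close> is built with \<open>THE\<close>, which does not transfer.
  Recording the graph and a named neutral element \<open>e\<close> gives statements that do, with
  the same \<open>e\<close> in \<open>M\<close> and \<open>N\<close>.\<close>

definition group_graph :: "('f, 'r, 'a) str \<Rightarrow> ('f, 'r, 'a) fm \<Rightarrow> 'a \<Rightarrow> bool" where
  "group_graph K \<mu> e \<longleftrightarrow> group (group_of K \<mu>) \<and> e = \<one>\<^bsub>group_of K \<mu>\<^esub> \<and>
     (\<forall>x\<in>univ K. \<forall>y\<in>univ K. \<forall>z\<in>univ K. holds K \<mu> [x, y, z] \<longleftrightarrow> z = x \<otimes>\<^bsub>group_of K \<mu>\<^esub> y)"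

lemma carrier_group_of [simp]: "carrier (group_of K \<mu>) = univ K"
  by (simp add: group_of_def Let_def)

lemma mult_group_of:
  "x \<otimes>\<^bsub>group_of K \<mu>\<^esub> y = (THE z. z \<in> univ K \<and> holds K \<mu> [x, y, z])"
  by (simp add: group_of_def Let_def)

lemma one_group_of:
  "\<one>\<^bsub>group_of K \<mu>\<^esub> = (THE e. e \<in> univ K \<and>
     (\<forall>x\<in>univ K. e \<otimes>\<^bsub>group_of K \<mu>\<^esub> x = x \<and> x \<otimes>\<^bsub>group_of K \<mu>\<^esub> e = x))"
  by (simp add: group_of_def Let_def)

lemma mult_group_of_iff:
  assumes "\<exists>!z. z \<in> univ K \<and> holds K \<mu> [x, y, z]"
  shows "x \<otimes>\<^bsub>group_of K \<mu>\<^esub> y \<in> univ K"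
    and "z \<in> univ K \<Longrightarrow> holds K \<mu> [x, y, z] \<longleftrightarrow> z = x \<otimes>\<^bsub>group_of K \<mu>\<^esub> y"
  using theI'[OF assms] assms unfolding mult_group_of by (blast, metis)

lemma defines_group_graph:
  "defines_group L M \<mu> \<Longrightarrow> group_graph M \<mu> \<one>\<^bsub>group_of M \<mu>\<^esub>"
  unfolding defines_group_def group_graph_def by (simp add: mult_group_of_iff(2))

text \<open>The group axioms in relational form, each directly expressible by a formula.
  Associativity names the intermediate products, which exist by \<open>total\<close>.\<close>

lemma group_graphI:
  assumes e: "e \<in> univ K"
    and total: "\<And>x y. \<lbrakk>x \<in> univ K; y \<in> univ K\<rbrakk> \<Longrightarrow> \<exists>z\<in>univ K. holds K \<mu> [x, y, z]"
    and unique: "\<And>x y z z'. \<lbrakk>x \<in> univ K; y \<in> univ K; z \<in> univ K; z' \<in> univ K;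
       holds K \<mu> [x, y, z]; holds K \<mu> [x, y, z']\<rbrakk> \<Longrightarrow> z = z'"
    and neutral: "\<And>x. x \<in> univ K \<Longrightarrow> holds K \<mu> [e, x, x]" "\<And>x. x \<in> univ K \<Longrightarrow> holds K \<mu> [x, e, x]"
    and inverse: "\<And>x. x \<in> univ K \<Longrightarrow> \<exists>y\<in>univ K. holds K \<mu> [y, x, e]"
    and assoc: "\<And>x y z u v w. \<lbrakk>x \<in> univ K; y \<in> univ K; z \<in> univ K; u \<in> univ K; v \<in> univ K; w \<in> univ K;
       holds K \<mu> [x, y, u]; holds K \<mu> [y, z, v]; holds K \<mu> [u, z, w]\<rbrakk> \<Longrightarrow> holds K \<mu> [x, v, w]"
  shows "group_graph K \<mu> e"
proof -
  let ?G = "group_of K \<mu>"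
  have ex1: "\<exists>!z. z \<in> univ K \<and> holds K \<mu> [x, y, z]" if "x \<in> univ K" "y \<in> univ K" for x y
    using total[OF that] unique[OF that] by blast
  have closed: "x \<otimes>\<^bsub>?G\<^esub> y \<in> univ K" if "x \<in> univ K" "y \<in> univ K" for x y
    by (rule mult_group_of_iff(1)[OF ex1[OF that]])
  have graph: "holds K \<mu> [x, y, z] \<longleftrightarrow> z = x \<otimes>\<^bsub>?G\<^esub> y"
    if "x \<in> univ K" "y \<in> univ K" "z \<in> univ K" for x y z
    by (rule mult_group_of_iff(2)[OF ex1[OF that(1,2)] that(3)])
  have neut: "e \<otimes>\<^bsub>?G\<^esub> x = x" "x \<otimes>\<^bsub>?G\<^esub> e = x" if "x \<in> univ K" for x
    using graph[of e x x] graph[of x e x] neutral[OF that] e that by simp_all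
  have one: "\<one>\<^bsub>?G\<^esub> = e"
    unfolding one_group_of
  proof (rule the_equality)
    fix e' assume "e' \<in> univ K \<and> (\<forall>x\<in>univ K. e' \<otimes>\<^bsub>?G\<^esub> x = x \<and> x \<otimes>\<^bsub>?G\<^esub> e' = x)"
    then show "e' = e" using neut(2)[of e'] e by metis
  qed (use e neut in auto)
  have "group ?G"
  proof (rule groupI)
    fix x y z assume "x \<in> carrier ?G" "y \<in> carrier ?G" "z \<in> carrier ?G"
    then show "x \<otimes>\<^bsub>?G\<^esub> y \<otimes>\<^bsub>?G\<^esub> z = x \<otimes>\<^bsub>?G\<^esub> (y \<otimes>\<^bsub>?G\<^esub> z)"
      using assoc[of x y z "x \<otimes>\<^bsub>?G\<^esub> y" "y \<otimes>\<^bsub>?G\<^esub> z" "x \<otimes>\<^bsub>?G\<^esub> y \<otimes>\<^bsub>?G\<^esub> z"]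
      by (simp add: graph closed)
  next
    fix x assume x: "x \<in> carrier ?G"
    then obtain y where "y \<in> univ K" "holds K \<mu> [y, x, e]" using inverse by auto
    then show "\<exists>y\<in>carrier ?G. y \<otimes>\<^bsub>?G\<^esub> x = \<one>\<^bsub>?G\<^esub>"
      using x e by (intro bexI[of _ y]) (auto simp: graph one)
  qed (use closed e neut one in auto)
  then show ?thesis using graph one unfolding group_graph_def by simp
qed

lemma group_graph_elem_ext:
  assumes MN: "elem_ext L M N" and \<mu>: "\<mu> \<in> fms L (univ M) 3" and G: "group_graph M \<mu> e"
  shows "group_graph N \<mu> e"
proof -
  let ?G = "group_of M \<mu>"
  interpret G: group ?G using G by (simp add: group_graph_def)
  have e: "e = \<one>\<^bsub>?G\<^esub>" "e \<in> univ M" using G G.one_closed by (auto simp: group_graph_def)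
  have closed: "x \<otimes>\<^bsub>?G\<^esub> y \<in> univ M" if "x \<in> univ M" "y \<in> univ M" for x y
    using G.m_closed that by simp
  have graph: "holds M \<mu> [x, y, z] \<longleftrightarrow> z = x \<otimes>\<^bsub>?G\<^esub> y"
    if "x \<in> univ M" "y \<in> univ M" "z \<in> univ M" for x y z
    using G that by (simp add: group_graph_def)
  have expr: "expressible L (univ M) n (\<lambda>K as. holds K \<mu> (map (case_sum ((!) as) (\<lambda>a. a)) [i, j, k]))"
    if "\<forall>l. Inl l \<in> {i, j, k} \<longrightarrow> l < n" "\<forall>a. Inr a \<in> {i, j, k} \<longrightarrow> a \<in> univ M" for n i j k
    by (rule expressible_subst[OF expressible_holds[OF \<mu>]]) (use that in auto)
  have var: "expressible L (univ M) n (\<lambda>K as. holds K \<mu> [as ! i, as ! j, as ! k])"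
    if "i < n" "j < n" "k < n" for n i j k
    using expr[of "Inl i" "Inl j" "Inl k" n] that by simp
  show ?thesis
  proof (rule group_graphI)
    show "e \<in> univ N" using e(2) MN by (auto simp: elem_ext_def)
  next
    fix x y assume xy: "x \<in> univ N" "y \<in> univ N"
    let ?R = "\<lambda>K as. \<exists>z\<in>univ K. holds K \<mu> [(as @ [z]) ! 0, (as @ [z]) ! 1, (as @ [z]) ! 2]"
    have "expressible L (univ M) 2 ?R"
      by (rule expressible_ex) (rule var; simp)
    then have "?R N [x, y]"
    proof (rule elem_ext_transfer[OF MN])
      fix as assume "length as = 2" "set as \<subseteq> univ M"
      then have "as ! 0 \<in> univ M" "as ! 1 \<in> univ M" by (auto dest!: nth_mem subsetD)
      then show "?R M as"
        using \<open>length as = 2\<close> closed by (intro bexI[of _ "as ! 0 \<otimes>\<^bsub>?G\<^esub> as ! 1"]) (auto simp: nth_append graph)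
    qed (use xy in auto)
    then show "\<exists>z\<in>univ N. holds N \<mu> [x, y, z]" by (simp add: numeral_2_eq_2)
  next
    fix x y z z' assume *: "x \<in> univ N" "y \<in> univ N" "z \<in> univ N" "z' \<in> univ N"
      "holds N \<mu> [x, y, z]" "holds N \<mu> [x, y, z']"
    let ?R = "\<lambda>K as. holds K \<mu> [as ! 0, as ! 1, as ! 2] \<and> holds K \<mu> [as ! 0, as ! 1, as ! 3] \<longrightarrow>
      as ! 2 = as ! 3"
    have "expressible L (univ M) 4 ?R"
      by (intro expressible_imp expressible_and var expressible_eq) simp_all
    then have "?R N [x, y, z, z']"
    proof (rule elem_ext_transfer[OF MN])
      fix as assume as: "length as = 4" "set as \<subseteq> univ M"
      then have "i < 4 \<Longrightarrow> as ! i \<in> univ M" for i by (auto dest!: nth_mem subsetD)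
      then show "?R M as" by (simp add: graph)
    qed (use * in auto)
    then show "z = z'" using * by (simp add: numeral_2_eq_2 numeral_3_eq_3)
  next
    fix x assume x: "x \<in> univ N"
    let ?R = "\<lambda>K as. holds K \<mu> [e, as ! 0, as ! 0] \<and> holds K \<mu> [as ! 0, e, as ! 0]"
    have "expressible L (univ M) 1 ?R"
      using expr[of "Inr e" "Inl 0" "Inl 0" 1] expr[of "Inl 0" "Inr e" "Inl 0" 1] e(2)
      by (intro expressible_and) simp_all
    then have "?R N [x]"
    proof (rule elem_ext_transfer[OF MN])
      fix as assume "length as = 1" "set as \<subseteq> univ M"
      then have "as ! 0 \<in> univ M" by (auto dest!: nth_mem subsetD)
      then show "?R M as" using e G.l_one G.r_one by (simp add: graph)
    qed (use x in auto)
    then show "holds N \<mu> [e, x, x]" "holds N \<mu> [x, e, x]" by simp_all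
  next
    fix x assume x: "x \<in> univ N"
    let ?R = "\<lambda>K as. \<exists>y\<in>univ K. holds K \<mu> [(as @ [y]) ! 1, (as @ [y]) ! 0, e]"
    have "expressible L (univ M) 1 ?R"
      using expr[of "Inl 1" "Inl 0" "Inr e" 2] e(2) by (intro expressible_ex) (simp add: numeral_2_eq_2)
    then have "?R N [x]"
    proof (rule elem_ext_transfer[OF MN])
      fix as assume as: "length as = 1" "set as \<subseteq> univ M"
      then have "as ! 0 \<in> univ M" by (auto dest!: nth_mem subsetD)
      then show "?R M as"
        using as(1) e G.inv_closed G.l_inv
        by (intro bexI[of _ "inv\<^bsub>?G\<^esub> (as ! 0)"]) (auto simp: nth_append graph)
    qed (use x in auto)
    then show "\<exists>y\<in>univ N. holds N \<mu> [y, x, e]" by simp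
  next
    fix x y z u v w
    assume *: "x \<in> univ N" "y \<in> univ N" "z \<in> univ N" "u \<in> univ N" "v \<in> univ N" "w \<in> univ N"
      "holds N \<mu> [x, y, u]" "holds N \<mu> [y, z, v]" "holds N \<mu> [u, z, w]"
    let ?R = "\<lambda>K as. holds K \<mu> [as ! 0, as ! 1, as ! 3] \<and> holds K \<mu> [as ! 1, as ! 2, as ! 4] \<and>
      holds K \<mu> [as ! 3, as ! 2, as ! 5] \<longrightarrow> holds K \<mu> [as ! 0, as ! 4, as ! 5]"
    have "expressible L (univ M) 6 ?R"
      by (intro expressible_imp expressible_and var) simp_all
    then have "?R N [x, y, z, u, v, w]"
    proof (rule elem_ext_transfer[OF MN])
      fix as assume as: "length as = 6" "set as \<subseteq> univ M"
      then have "i < 6 \<Longrightarrow> as ! i \<in> univ M" for i by (auto dest!: nth_mem subsetD)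
      then show "?R M as" using G.m_assoc by (simp add: graph closed)
    qed (use * in auto)
    then show "holds N \<mu> [x, v, w]" using * by (simp add: eval_nat_numeral)
  qed
qed

section \<open>Translates of definable sets\<close>

lemma group_graph_coset:
  assumes G: "group_graph K \<mu> e" and x: "x \<in> univ K" and y: "y \<in> univ K"
  shows "x \<in> y <#\<^bsub>group_of K \<mu>\<^esub> defset K \<alpha> \<longleftrightarrow> (\<exists>a\<in>univ K. holds K \<alpha> [a] \<and> holds K \<mu> [y, a, x])"
    and "x \<in> defset K \<alpha> #>\<^bsub>group_of K \<mu>\<^esub> y \<longleftrightarrow> (\<exists>a\<in>univ K. holds K \<alpha> [a] \<and> holds K \<mu> [a, y, x])"
  using assms by (auto simp: group_graph_def l_coset_def r_coset_def defset_def)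

text \<open>Coset membership is an existential statement about \<open>\<alpha>\<close> and the graph
  \<open>\<mu>\<close>, so its equivalence with \<open>\<phi>\<close> passes from \<open>M\<close>
  to \<open>N\<close>.\<close>

lemma expresses_elem_ext:
  assumes MN: "elem_ext L M N" and \<mu>: "\<mu> \<in> fms L (univ M) 3"
    and GM: "group_graph M \<mu> e" and GN: "group_graph N \<mu> e" and \<alpha>: "\<alpha> \<in> fms L (univ M) 1"
    and x: "x \<in> univ N" and y: "y \<in> univ N"
  shows "expresses_left L M \<mu> (defset M \<alpha>) \<phi> \<Longrightarrow>
      holds N \<phi> [x, y] \<longleftrightarrow> x \<in> y <#\<^bsub>group_of N \<mu>\<^esub> defset N \<alpha>"
    and "expresses_right L M \<mu> (defset M \<alpha>) \<phi> \<Longrightarrow>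
      holds N \<phi> [x, y] \<longleftrightarrow> x \<in> defset N \<alpha> #>\<^bsub>group_of N \<mu>\<^esub> y"
proof -
  \<comment> \<open>Positions refer to the list \<open>[x, y, a]\<close>: \<open>i = 1\<close>,
    \<open>j = 2\<close> expresses \<open>x = y a\<close>, and \<open>i = 2\<close>,
    \<open>j = 1\<close> expresses \<open>x = a y\<close>.\<close>
  have main: "holds N \<phi> [x, y] \<longleftrightarrow> (\<exists>a\<in>univ N. holds N \<alpha> [a] \<and>
       holds N \<mu> [([x, y] @ [a]) ! i, ([x, y] @ [a]) ! j, ([x, y] @ [a]) ! 0])"
    if \<phi>: "\<phi> \<in> fms L (univ M) 2" and ij: "i < 3" "j < 3"
      and iff: "\<And>x y. \<lbrakk>x \<in> univ M; y \<in> univ M\<rbrakk> \<Longrightarrow> holds M \<phi> [x, y] \<longleftrightarrow> (\<exists>a\<in>univ M. holds M \<alpha> [a] \<and>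
       holds M \<mu> [([x, y] @ [a]) ! i, ([x, y] @ [a]) ! j, ([x, y] @ [a]) ! 0])" for i j
  proof -
    let ?S = "\<lambda>K as. holds K \<alpha> [as ! 2] \<and> holds K \<mu> [as ! i, as ! j, as ! 0]"
    let ?R = "\<lambda>K as. holds K \<phi> as \<longleftrightarrow> (\<exists>a\<in>univ K. ?S K (as @ [a]))"
    have "expressible L (univ M) 3 (\<lambda>K as. holds K \<alpha> (map (case_sum ((!) as) (\<lambda>a. a)) [Inl 2]))"
      by (rule expressible_subst[OF expressible_holds[OF \<alpha>]]) auto
    moreover have "expressible L (univ M) 3
        (\<lambda>K as. holds K \<mu> (map (case_sum ((!) as) (\<lambda>a. a)) [Inl i, Inl j, Inl 0]))"
      by (rule expressible_subst[OF expressible_holds[OF \<mu>]]) (use ij in auto)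
    ultimately have "expressible L (univ M) (Suc 2) ?S"
      using expressible_and by fastforce
    from expressible_iff[OF expressible_holds[OF \<phi>] expressible_ex[OF this]]
    have "?R N [x, y]"
    proof (rule elem_ext_transfer[OF MN])
      fix as assume "length as = 2" "set as \<subseteq> univ M"
      then obtain c d where "as = [c, d]" "c \<in> univ M" "d \<in> univ M"
        by (auto simp: length_Suc_conv numeral_2_eq_2)
      then show "?R M as" using iff[of c d] by simp
    qed (use x y in auto)
    then show ?thesis by simp
  qed
  show "expresses_left L M \<mu> (defset M \<alpha>) \<phi> \<Longrightarrow>
      holds N \<phi> [x, y] \<longleftrightarrow> x \<in> y <#\<^bsub>group_of N \<mu>\<^esub> defset N \<alpha>"
    using main[of 1 2] unfolding group_graph_coset(1)[OF GN x y] expresses_left_def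
    by (simp add: group_graph_coset(1)[OF GM])
  show "expresses_right L M \<mu> (defset M \<alpha>) \<phi> \<Longrightarrow>
      holds N \<phi> [x, y] \<longleftrightarrow> x \<in> defset N \<alpha> #>\<^bsub>group_of N \<mu>\<^esub> y"
    using main[of 2 1] unfolding group_graph_coset(2)[OF GN x y] expresses_right_def
    by (simp add: group_graph_coset(2)[OF GM])
qed

text \<open>The translate of \<open>A^#\<close> by \<open>h^-1\<close> is the instance of
  \<open>\<phi>\<close> at \<open>y = h^-1\<close>; this is how the left formulas enter.\<close>

lemma dset_eq_expresses_left:
  assumes MN: "elem_ext L M N" and \<mu>: "\<mu> \<in> fms L (univ M) 3"
    and GM: "group_graph M \<mu> e" and GN: "group_graph N \<mu> e" and \<alpha>: "\<alpha> \<in> fms L (univ M) 1"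
    and \<phi>: "expresses_left L M \<mu> (defset M \<alpha>) \<phi>"
  shows "dset N \<mu> q (defset N \<alpha>) =
    {h \<in> univ N. set_in_type N (defset N (inst [1 \<mapsto> inv\<^bsub>group_of N \<mu>\<^esub> h] \<phi>)) q}"
proof -
  let ?G = "group_of N \<mu>"
  interpret group ?G using GN by (simp add: group_graph_def)
  have fms: "\<phi> \<in> fms L (univ M) 2" using \<phi> by (simp add: expresses_left_def)
  have "inv\<^bsub>?G\<^esub> h <#\<^bsub>?G\<^esub> defset N \<alpha> = defset N (inst [1 \<mapsto> inv\<^bsub>?G\<^esub> h] \<phi>)" if h: "h \<in> univ N" for h
  proof -
    have h': "inv\<^bsub>?G\<^esub> h \<in> univ N" using h inv_closed by simp
    have "defset N \<alpha> \<subseteq> carrier ?G" by (auto simp: defset_def)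
    then have "inv\<^bsub>?G\<^esub> h <#\<^bsub>?G\<^esub> defset N \<alpha> \<subseteq> univ N"
      using l_coset_subset_G[of "defset N \<alpha>" "inv\<^bsub>?G\<^esub> h"] h' by simp
    then show ?thesis
      using expresses_elem_ext(1)[OF MN \<mu> GM GN \<alpha> _ h' \<phi>]
      by (auto simp: defset_def holds_inst_1[OF fms] simp del: One_nat_def)
  qed
  then show ?thesis unfolding dset_def by auto
qed

section \<open>Weak heirs and weak coheirs as agreement with the limit type\<close>

context stable_extension
begin

text \<open>If \<open>\<theta>\<close> defines the limit of \<open>\<phi>\<close>, then
  \<open>d_p(A)\<close> is defined by \<open>\<theta>(h^-1)\<close>. In \<open>N\<close> the same
  formula collects the \<open>h\<close> at whose inverse the limit is true, while
  \<open>d_q(A^#)\<close> collects those at whose inverse \<open>q\<close> contains the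
  instance.\<close>

lemma weak_heir_iff_limit:
  assumes MN: "elem_ext L M N" and NC: "elem_ext L N C"
    and \<mu>: "\<mu> \<in> fms L (univ M) 3" and GM: "group_graph M \<mu> e" and GN: "group_graph N \<mu> e"
    and q: "q \<in> types1 L N" and U: "ultra U" "\<forall>\<^sub>F m in U. m \<in> univ M"
    and qU: "\<forall>\<theta>\<in>fms L (univ M) 1. \<theta> \<in> q \<longleftrightarrow> (\<forall>\<^sub>F m in U. holds C \<theta> [m])"
    and A: "A \<in> Def L M" and \<phi>: "expresses_left L M \<mu> A \<phi>"
  shows "dset N \<mu> q (sharp L M N A) = sharp L M N (dset M \<mu> (restr_type L q M) A) \<longleftrightarrow>
    (\<forall>b\<in>univ N. inst [1 \<mapsto> b] \<phi> \<in> q \<longleftrightarrow> (\<forall>\<^sub>F m in U. holds C \<phi> [m, b]))"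
proof -
  let ?GM = "group_of M \<mu>" and ?GN = "group_of N \<mu>"
  interpret GM: group ?GM using GM by (simp add: group_graph_def)
  interpret GN: group ?GN using GN by (simp add: group_graph_def)
  have MNs: "univ M \<subseteq> univ N" and NCs: "univ N \<subseteq> univ C" and M: "elem_ext L M M"
    using MN NC by (auto simp: elem_ext_def)
  obtain \<alpha> where \<alpha>: "\<alpha> \<in> fms L (univ M) 1" "A = defset M \<alpha>" using A by (auto simp: Def_def)
  have fms: "\<phi> \<in> fms L (univ M) 2" using \<phi> by (simp add: expresses_left_def)
  note \<phi>' = \<phi>[unfolded \<alpha>(2)]
  have dN: "dset N \<mu> q (sharp L M N A) = {h \<in> univ N. inst [1 \<mapsto> inv\<^bsub>?GN\<^esub> h] \<phi> \<in> q}"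
  proof -
    have "inst [1 \<mapsto> inv\<^bsub>?GN\<^esub> h] \<phi> \<in> fms L (univ N) 1" if "h \<in> univ N" for h
      by (rule inst_1_fms[OF fms_mono[OF fms MNs order_refl]]) (use that GN.inv_closed in simp)
    then show ?thesis
      unfolding \<alpha>(2) sharp_defset[OF MN \<alpha>(1)] dset_eq_expresses_left[OF MN \<mu> GM GN \<alpha>(1) \<phi>']
      using set_in_type_defset[OF q] by auto
  qed
  have dM: "dset M \<mu> (restr_type L q M) A = {h \<in> univ M. inst [1 \<mapsto> inv\<^bsub>?GM\<^esub> h] \<phi> \<in> q}"
  proof -
    have "inst [1 \<mapsto> inv\<^bsub>?GM\<^esub> h] \<phi> \<in> fms L (univ M) 1" if "h \<in> univ M" for h
      by (rule inst_1_fms[OF fms]) (use that GM.inv_closed in simp)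
    then show ?thesis
      unfolding \<alpha>(2) dset_eq_expresses_left[OF M \<mu> GM GM \<alpha>(1) \<phi>']
      using set_in_restr_type_defset[OF MN q] by auto
  qed
  obtain \<theta> where \<theta>: "\<theta> \<in> fms L (univ M) 1"
    "\<forall>b\<in>univ C. holds C \<theta> [b] \<longleftrightarrow> (\<forall>\<^sub>F m in U. holds C \<phi> [m, b])"
    by (rule limit_definable[OF U expressible_holds[OF fms]])
  have e: "e \<in> univ M" using GM GM.one_closed by (simp add: group_graph_def)
  \<comment> \<open>Inversion is eliminated: the formula asserts \<open>\<theta>\<close> of some
    \<open>y\<close> whose product with \<open>h\<close> is the parameter \<open>e\<close>.\<close>
  have "expressible L (univ M) 2 (\<lambda>K as. holds K \<theta> (map (case_sum ((!) as) (\<lambda>a. a)) [Inl 1]) \<and>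
      holds K \<mu> (map (case_sum ((!) as) (\<lambda>a. a)) [Inl 0, Inl 1, Inr e]))"
    by (intro expressible_and expressible_subst[OF expressible_holds[OF \<theta>(1)]]
        expressible_subst[OF expressible_holds[OF \<mu>]]) (use e in auto)
  then have "expressible L (univ M) (Suc 1) (\<lambda>K as. holds K \<theta> [as ! 1] \<and> holds K \<mu> [as ! 0, as ! 1, e])"
    by (simp add: numeral_2_eq_2)
  from expressible_ex[OF this] obtain \<gamma> where \<gamma>: "\<gamma> \<in> fms L (univ M) 1"
    "\<forall>K as. length as = 1 \<longrightarrow> univ M \<union> set as \<subseteq> univ K \<longrightarrow> (holds K \<gamma> as \<longleftrightarrow>
      (\<exists>y\<in>univ K. holds K \<theta> [(as @ [y]) ! 1] \<and> holds K \<mu> [(as @ [y]) ! 0, (as @ [y]) ! 1, e]))"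
    by (rule expressibleE)
  have \<gamma>_iff: "holds K \<gamma> [h] \<longleftrightarrow> holds K \<theta> [inv\<^bsub>group_of K \<mu>\<^esub> h]"
    if "group_graph K \<mu> e" "univ M \<subseteq> univ K" "h \<in> univ K" for K h
  proof -
    interpret group "group_of K \<mu>" using that by (simp add: group_graph_def)
    have "holds K \<mu> [h, y, e] \<longleftrightarrow> y = inv\<^bsub>group_of K \<mu>\<^esub> h" if y: "y \<in> univ K" for y
    proof -
      have "holds K \<mu> [h, y, e] \<longleftrightarrow> \<one>\<^bsub>group_of K \<mu>\<^esub> = h \<otimes>\<^bsub>group_of K \<mu>\<^esub> y"
        using \<open>group_graph K \<mu> e\<close> \<open>h \<in> univ K\<close> y one_closed by (simp add: group_graph_def)
      also have "\<dots> \<longleftrightarrow> y = inv\<^bsub>group_of K \<mu>\<^esub> h"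
        using inv_equality[OF inv_comm, of h y] r_inv[of h] \<open>h \<in> univ K\<close> y by auto
      finally show ?thesis .
    qed
    then show ?thesis
      using \<gamma>(2)[rule_format, of "[h]" K] that inv_closed[of h] by auto
  qed
  have "inst [1 \<mapsto> inv\<^bsub>?GM\<^esub> h] \<phi> \<in> q \<longleftrightarrow> holds M \<gamma> [h]" if h: "h \<in> univ M" for h
  proof -
    have h': "inv\<^bsub>?GM\<^esub> h \<in> univ M" using h GM.inv_closed by simp
    have "inst [1 \<mapsto> inv\<^bsub>?GM\<^esub> h] \<phi> \<in> q \<longleftrightarrow> (\<forall>\<^sub>F m in U. holds C \<phi> [m, inv\<^bsub>?GM\<^esub> h])"
      using qU inst_1_fms[OF fms h'] by (simp only: holds_inst_1[OF fms])
    also have "\<dots> \<longleftrightarrow> holds C \<theta> [inv\<^bsub>?GM\<^esub> h]" using \<theta>(2) h' univ_subset by blast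
    also have "\<dots> \<longleftrightarrow> holds M \<theta> [inv\<^bsub>?GM\<^esub> h]" using elem_ext_holds[OF MC \<theta>(1)] h' by simp
    finally show ?thesis using \<gamma>_iff[OF GM order_refl h] by simp
  qed
  then have "dset M \<mu> (restr_type L q M) A = defset M \<gamma>" unfolding dM defset_def by blast
  then have "sharp L M N (dset M \<mu> (restr_type L q M) A) = defset N \<gamma>"
    using sharp_defset[OF MN \<gamma>(1)] by simp
  also have "\<dots> = {h \<in> univ N. \<forall>\<^sub>F m in U. holds C \<phi> [m, inv\<^bsub>?GN\<^esub> h]}"
  proof -
    have "holds N \<gamma> [h] \<longleftrightarrow> (\<forall>\<^sub>F m in U. holds C \<phi> [m, inv\<^bsub>?GN\<^esub> h])" if h: "h \<in> univ N" for h
    proof -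
      have h': "inv\<^bsub>?GN\<^esub> h \<in> univ N" using h GN.inv_closed by simp
      have "holds N \<theta> [inv\<^bsub>?GN\<^esub> h] \<longleftrightarrow> holds C \<theta> [inv\<^bsub>?GN\<^esub> h]"
        by (rule elem_ext_holds[OF NC fms_mono[OF \<theta>(1) MNs order_refl]]) (use h' in auto)
      then show ?thesis using \<gamma>_iff[OF GN MNs h] \<theta>(2) h' NCs by auto
    qed
    then show ?thesis unfolding defset_def by blast
  qed
  finally have "dset N \<mu> q (sharp L M N A) = sharp L M N (dset M \<mu> (restr_type L q M) A) \<longleftrightarrow>
    (\<forall>h\<in>univ N. inst [1 \<mapsto> inv\<^bsub>?GN\<^esub> h] \<phi> \<in> q \<longleftrightarrow> (\<forall>\<^sub>F m in U. holds C \<phi> [m, inv\<^bsub>?GN\<^esub> h]))"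
    unfolding dN by blast
  \<comment> \<open>Every \<open>b\<close> is the inverse of its inverse.\<close>
  also have "\<dots> \<longleftrightarrow> (\<forall>b\<in>univ N. inst [1 \<mapsto> b] \<phi> \<in> q \<longleftrightarrow> (\<forall>\<^sub>F m in U. holds C \<phi> [m, b]))"
    using GN.inv_closed GN.inv_inv by (metis carrier_group_of)
  finally show ?thesis .
qed

text \<open>For a type \<open>s\<close> realized by \<open>c\<close>, \<open>d_s(A^#)\<close> is the
  right translate \<open>A^# c^-1\<close>; by finite separation, for any \<open>s\<close> it is a
  Boolean combination of such translates. The coheir condition for all \<open>s\<close> thus reduces
  to the instances of \<open>\<psi>\<close>.\<close>

lemma weak_coheir_iff_limit:
  assumes MN: "elem_ext L M N" and NC: "elem_ext L N C"
    and stabN: "\<And>R. expressible L (univ N) 2 R \<Longrightarrow> orderless (univ N) (univ N) (\<lambda>a b. R N [a, b])"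
    and \<mu>: "\<mu> \<in> fms L (univ M) 3" and GM: "group_graph M \<mu> e" and GN: "group_graph N \<mu> e"
    and q: "q \<in> types1 L N" and U: "ultra U" "\<forall>\<^sub>F m in U. m \<in> univ M"
    and qU: "\<forall>\<theta>\<in>fms L (univ M) 1. \<theta> \<in> q \<longleftrightarrow> (\<forall>\<^sub>F m in U. holds C \<theta> [m])"
    and A: "A \<in> Def L M" and \<phi>: "expresses_left L M \<mu> A \<phi>" and \<psi>: "expresses_right L M \<mu> A \<psi>"
  shows "(\<forall>s\<in>types1 L N. set_in_type N (dset N \<mu> s (sharp L M N A)) q \<longleftrightarrow>
       set_in_type M (dset N \<mu> s (sharp L M N A) \<inter> univ M) (restr_type L q M)) \<longleftrightarrow>
    (\<forall>b\<in>univ N. inst [1 \<mapsto> b] \<psi> \<in> q \<longleftrightarrow> (\<forall>\<^sub>F m in U. holds C \<psi> [m, b]))"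
proof -
  let ?G = "group_of N \<mu>"
  interpret G: group ?G using GN by (simp add: group_graph_def)
  have inv: "inv\<^bsub>?G\<^esub> h \<in> univ N" if "h \<in> univ N" for h using that G.inv_closed by simp
  have MNs: "univ M \<subseteq> univ N" and NCs: "univ N \<subseteq> univ C" and N: "elem_ext L N N"
    using MN NC by (auto simp: elem_ext_def)
  obtain \<alpha> where \<alpha>: "\<alpha> \<in> fms L (univ M) 1" "A = defset M \<alpha>" using A by (auto simp: Def_def)
  have fms: "\<phi> \<in> fms L (univ M) 2" "\<psi> \<in> fms L (univ M) 2"
    using \<phi> \<psi> by (simp_all add: expresses_left_def expresses_right_def)
  have fmsN: "\<phi> \<in> fms L (univ N) 2" "\<psi> \<in> fms L (univ N) 2"
    using fms MNs by (auto intro: fms_mono)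
  note \<phi>' = \<phi>[unfolded \<alpha>(2)] and \<psi>' = \<psi>[unfolded \<alpha>(2)]
  have dN: "dset N \<mu> s (sharp L M N A) = {h \<in> univ N. inst [1 \<mapsto> inv\<^bsub>?G\<^esub> h] \<phi> \<in> s}"
    if s: "s \<in> types1 L N" for s
  proof -
    have "inst [1 \<mapsto> inv\<^bsub>?G\<^esub> h] \<phi> \<in> fms L (univ N) 1" if "h \<in> univ N" for h
      by (rule inst_1_fms[OF fmsN(1) inv[OF that]])
    then show ?thesis
      unfolding \<alpha>(2) sharp_defset[OF MN \<alpha>(1)] dset_eq_expresses_left[OF MN \<mu> GM GN \<alpha>(1) \<phi>']
      using set_in_type_defset[OF s] by auto
  qed
  \<comment> \<open>\<open>c \<in> h^-1 A\<close> iff \<open>h c \<in> A\<close> iff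
    \<open>h \<in> A c^-1\<close>: the left cosets of \<open>dset\<close> become the right cosets of
    \<open>\<psi>\<close>.\<close>
  have swap: "holds N \<phi> [c, inv\<^bsub>?G\<^esub> h] \<longleftrightarrow> holds N \<psi> [h, inv\<^bsub>?G\<^esub> c]"
    if h: "h \<in> univ N" and c: "c \<in> univ N" for h c
  proof -
    have "holds N \<phi> [c, inv\<^bsub>?G\<^esub> h] \<longleftrightarrow> (\<exists>a\<in>defset N \<alpha>. c = inv\<^bsub>?G\<^esub> h \<otimes>\<^bsub>?G\<^esub> a)"
      unfolding expresses_elem_ext(1)[OF MN \<mu> GM GN \<alpha>(1) c inv[OF h] \<phi>'] by (auto simp: l_coset_def)
    also have "\<dots> \<longleftrightarrow> (\<exists>a\<in>defset N \<alpha>. a = h \<otimes>\<^bsub>?G\<^esub> c)"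
      by (rule bex_cong) (use h c in \<open>auto simp: defset_def G.inv_solve_left\<close>)
    also have "\<dots> \<longleftrightarrow> (\<exists>a\<in>defset N \<alpha>. h = a \<otimes>\<^bsub>?G\<^esub> inv\<^bsub>?G\<^esub> c)"
      by (rule bex_cong) (use h c in \<open>auto simp: defset_def G.inv_solve_right\<close>)
    also have "\<dots> \<longleftrightarrow> holds N \<psi> [h, inv\<^bsub>?G\<^esub> c]"
      unfolding expresses_elem_ext(2)[OF MN \<mu> GM GN \<alpha>(1) h inv[OF c] \<psi>'] by (auto simp: r_coset_def)
    finally show ?thesis .
  qed
  have NC_holds: "holds N \<psi> [a, b] \<longleftrightarrow> holds C \<psi> [a, b]" if "a \<in> univ N" "b \<in> univ N" for a b
    by (rule elem_ext_holds[OF NC fmsN(2)]) (use that in auto)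
  have in_p: "set_in_type M X (restr_type L q M) \<longleftrightarrow> (\<forall>\<^sub>F m in U. m \<in> X)"
    if "\<theta> \<in> fms L (univ M) 1" "X \<subseteq> univ M" "\<forall>m\<in>univ M. holds C \<theta> [m] \<longleftrightarrow> m \<in> X" for X \<theta>
  proof -
    have "X = defset M \<theta>"
      using that(2,3) elem_ext_holds[OF MC that(1)] by (auto simp: defset_def)
    then have "set_in_type M X (restr_type L q M) \<longleftrightarrow> \<theta> \<in> q"
      using set_in_restr_type_defset[OF MN q that(1)] by simp
    also have "\<dots> \<longleftrightarrow> (\<forall>\<^sub>F m in U. holds C \<theta> [m])" using qU that(1) by blast
    also have "\<dots> \<longleftrightarrow> (\<forall>\<^sub>F m in U. m \<in> X)"
      by (rule eventually_cong[OF U(2)]) (use that(3) in blast)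
    finally show ?thesis .
  qed
  show ?thesis
  proof
    assume wc: "\<forall>s\<in>types1 L N. set_in_type N (dset N \<mu> s (sharp L M N A)) q \<longleftrightarrow>
       set_in_type M (dset N \<mu> s (sharp L M N A) \<inter> univ M) (restr_type L q M)"
    show "\<forall>b\<in>univ N. inst [1 \<mapsto> b] \<psi> \<in> q \<longleftrightarrow> (\<forall>\<^sub>F m in U. holds C \<psi> [m, b])"
    proof
      fix b assume b: "b \<in> univ N"
      \<comment> \<open>Realized types suffice here: for \<open>s\<close> realized by
        \<open>b^-1\<close>, \<open>d_s(A^#)\<close> is \<open>A^# b\<close>, the set of the
        instance at \<open>b\<close>.\<close>
      define s where "s = {\<theta> \<in> fms L (univ N) 1. holds N \<theta> [inv\<^bsub>?G\<^esub> b]}"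
      have s: "s \<in> types1 L N" unfolding s_def by (rule realized_type[OF inv[OF b]])
      have "inst [1 \<mapsto> inv\<^bsub>?G\<^esub> h] \<phi> \<in> s \<longleftrightarrow> holds N \<psi> [h, b]" if h: "h \<in> univ N" for h
        using inst_1_fms[OF fmsN(1) inv[OF h]] swap[OF h inv[OF b]] b
        by (simp add: s_def holds_inst_1[OF fms(1), simplified] G.inv_inv)
      then have B: "dset N \<mu> s (sharp L M N A) = {h \<in> univ N. holds N \<psi> [h, b]}"
        unfolding dN[OF s] by blast
      also have "\<dots> = defset N (inst [1 \<mapsto> b] \<psi>)"
        unfolding defset_def holds_inst_1[OF fms(2)] ..
      finally have in_q: "set_in_type N (dset N \<mu> s (sharp L M N A)) q \<longleftrightarrow> inst [1 \<mapsto> b] \<psi> \<in> q"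
        using set_in_type_defset[OF q inst_1_fms[OF fmsN(2) b]] by simp
      obtain \<theta> where \<theta>: "\<theta> \<in> fms L (univ M) 1" "\<forall>m\<in>univ M. holds C \<theta> [m] \<longleftrightarrow> holds C \<psi> [m, b]"
        by (rule externally_definable[OF expressible_holds[OF fms(2)]]) (use b NCs in auto)
      have "set_in_type M (dset N \<mu> s (sharp L M N A) \<inter> univ M) (restr_type L q M) \<longleftrightarrow>
          (\<forall>\<^sub>F m in U. m \<in> dset N \<mu> s (sharp L M N A) \<inter> univ M)"
        by (rule in_p[OF \<theta>(1)]) (use \<theta>(2) MNs b NC_holds in \<open>auto simp: B\<close>)
      also have "\<dots> \<longleftrightarrow> (\<forall>\<^sub>F m in U. holds C \<psi> [m, b])"
        by (rule eventually_cong[OF U(2)]) (use MNs b NC_holds in \<open>auto simp: B\<close>)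
      finally show "inst [1 \<mapsto> b] \<psi> \<in> q \<longleftrightarrow> (\<forall>\<^sub>F m in U. holds C \<psi> [m, b])"
        using wc s in_q by blast
    qed
  next
    assume agree: "\<forall>b\<in>univ N. inst [1 \<mapsto> b] \<psi> \<in> q \<longleftrightarrow> (\<forall>\<^sub>F m in U. holds C \<psi> [m, b])"
    show "\<forall>s\<in>types1 L N. set_in_type N (dset N \<mu> s (sharp L M N A)) q \<longleftrightarrow>
       set_in_type M (dset N \<mu> s (sharp L M N A) \<inter> univ M) (restr_type L q M)"
    proof
      fix s assume s: "s \<in> types1 L N"
      define B where "B = dset N \<mu> s (sharp L M N A)"
      \<comment> \<open>\<open>s\<close> may be unrealized, so it becomes an ultrafilter on
        \<open>univ N\<close>, and \<open>B\<close> a limit of \<open>\<phi>\<close> along it.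
        Finite separation in \<open>N\<close> then ties \<open>B\<close> to the translates by
        finitely many \<open>c\<close>.\<close>
      obtain W where W: "ultra W" "\<forall>\<^sub>F c in W. c \<in> univ N"
        "\<forall>\<theta>\<in>fms L (univ N) 1. \<theta> \<in> s \<longleftrightarrow> (\<forall>\<^sub>F c in W. holds N \<theta> [c])"
        by (rule type_ultra[OF N N s])
      have B: "h \<in> B \<longleftrightarrow> (\<forall>\<^sub>F c in W. holds N \<phi> [c, inv\<^bsub>?G\<^esub> h])" if h: "h \<in> univ N" for h
        using W(3)[rule_format, OF inst_1_fms[OF fmsN(1) inv[OF h]]] h
        unfolding B_def dN[OF s] holds_inst_1[OF fms(1)] by blast
      have "orderless (univ N) (univ N) (\<lambda>c h. holds N \<phi> [c, h])"
        by (rule stabN[OF expressible_holds[OF fmsN(1)]])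
      then obtain S where S: "finite S" "S \<subseteq> univ N"
        "\<forall>b\<in>univ N. \<forall>b'\<in>univ N. (\<forall>\<^sub>F c in W. holds N \<phi> [c, b]) \<longrightarrow> \<not> (\<forall>\<^sub>F c in W. holds N \<phi> [c, b']) \<longrightarrow>
           (\<exists>s\<in>S. holds N \<phi> [s, b] \<and> \<not> holds N \<phi> [s, b'])"
        by (rule ultra_finite_separation[OF _ W(1,2)])
      have atoms: "y \<in> B" if xy: "x \<in> univ N" "y \<in> univ N" "x \<in> B"
        "\<And>c. c \<in> S \<Longrightarrow> holds N \<psi> [x, inv\<^bsub>?G\<^esub> c] \<longleftrightarrow> holds N \<psi> [y, inv\<^bsub>?G\<^esub> c]" for x y
      proof (rule ccontr)
        assume "y \<notin> B"
        then obtain c where "c \<in> S" "holds N \<phi> [c, inv\<^bsub>?G\<^esub> x]" "\<not> holds N \<phi> [c, inv\<^bsub>?G\<^esub> y]"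
          using S(3)[rule_format, OF inv[OF xy(1)] inv[OF xy(2)]] B xy(1-3) by blast
        then show False using swap xy S(2) by blast
      qed
      have instN: "inst [1 \<mapsto> inv\<^bsub>?G\<^esub> c] \<psi> \<in> fms L (univ N) 1" if "c \<in> S" for c
        by (rule inst_1_fms[OF fmsN(2) inv]) (use that S(2) in blast)
      obtain \<beta> where \<beta>: "\<beta> \<in> fms L (univ N) 1" "\<forall>x\<in>univ N. holds N \<beta> [x] \<longleftrightarrow> x \<in> B"
      proof (rule expressible_atoms[of S L "univ N" "\<lambda>c K as. holds K (inst [1 \<mapsto> inv\<^bsub>?G\<^esub> c] \<psi>) as" N "\<lambda>x. x \<in> B"])
        show "expressible L (univ N) 1 (\<lambda>K as. holds K (inst [1 \<mapsto> inv\<^bsub>?G\<^esub> c] \<psi>) as)" if "c \<in> S" for c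
          by (rule expressible_holds[OF instN[OF that]])
        show "y \<in> B" if "x \<in> univ N" "y \<in> univ N" "x \<in> B"
          "\<And>c. c \<in> S \<Longrightarrow> holds N (inst [1 \<mapsto> inv\<^bsub>?G\<^esub> c] \<psi>) [x] \<longleftrightarrow> holds N (inst [1 \<mapsto> inv\<^bsub>?G\<^esub> c] \<psi>) [y]" for x y
          using atoms[OF that(1-3)] that(4) unfolding holds_inst_1[OF fms(2)] by blast
      qed (use S(1) in auto)
      have "B \<subseteq> univ N" by (auto simp: B_def dset_def)
      then have "B = defset N \<beta>" using \<beta>(2) by (auto simp: defset_def)
      then have Bq: "set_in_type N B q \<longleftrightarrow> \<beta> \<in> q" using set_in_type_defset[OF q \<beta>(1)] by simp
      \<comment> \<open>The translates have parameters in \<open>N\<close>, but their traces on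
        \<open>M\<close> are definable over \<open>M\<close>; hence so is the trace of
        \<open>B\<close>.\<close>
      have "\<forall>c\<in>S. \<exists>\<theta>. \<theta> \<in> fms L (univ M) 1 \<and> (\<forall>m\<in>univ M. holds C \<theta> [m] \<longleftrightarrow> holds C \<psi> [m, inv\<^bsub>?G\<^esub> c])"
      proof
        fix c assume "c \<in> S"
        then have "inv\<^bsub>?G\<^esub> c \<in> univ C" using inv S(2) NCs by blast
        then show "\<exists>\<theta>. \<theta> \<in> fms L (univ M) 1 \<and> (\<forall>m\<in>univ M. holds C \<theta> [m] \<longleftrightarrow> holds C \<psi> [m, inv\<^bsub>?G\<^esub> c])"
          by (rule externally_definable[OF expressible_holds[OF fms(2)]]) blast
      qed
      from bchoice[OF this] obtain \<theta> where \<theta>: "\<forall>c\<in>S. \<theta> c \<in> fms L (univ M) 1 \<and>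
          (\<forall>m\<in>univ M. holds C (\<theta> c) [m] \<longleftrightarrow> holds C \<psi> [m, inv\<^bsub>?G\<^esub> c])" by blast
      have \<theta>M: "holds M (\<theta> c) [m] \<longleftrightarrow> holds N \<psi> [m, inv\<^bsub>?G\<^esub> c]" if "c \<in> S" "m \<in> univ M" for c m
      proof -
        have "holds M (\<theta> c) [m] \<longleftrightarrow> holds C (\<theta> c) [m]"
          by (rule elem_ext_holds[OF MC]) (use \<theta> that in auto)
        also have "\<dots> \<longleftrightarrow> holds C \<psi> [m, inv\<^bsub>?G\<^esub> c]" using \<theta> that by blast
        also have "\<dots> \<longleftrightarrow> holds N \<psi> [m, inv\<^bsub>?G\<^esub> c]"
          using NC_holds[of m "inv\<^bsub>?G\<^esub> c"] that MNs S(2) inv by blast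
        finally show ?thesis .
      qed
      obtain \<delta> where \<delta>: "\<delta> \<in> fms L (univ M) 1" "\<forall>x\<in>univ M. holds M \<delta> [x] \<longleftrightarrow> x \<in> B"
      proof (rule expressible_atoms[of S L "univ M" "\<lambda>c K as. holds K (\<theta> c) as" M "\<lambda>x. x \<in> B"])
        show "expressible L (univ M) 1 (\<lambda>K as. holds K (\<theta> c) as)" if "c \<in> S" for c
          by (rule expressible_holds) (use \<theta> that in blast)
        show "y \<in> B" if "x \<in> univ M" "y \<in> univ M" "x \<in> B"
          "\<And>c. c \<in> S \<Longrightarrow> holds M (\<theta> c) [x] \<longleftrightarrow> holds M (\<theta> c) [y]" for x y
          by (rule atoms[of x y]) (use that MNs \<theta>M in auto)
      qed (use S(1) in auto)
      have "set_in_type M (B \<inter> univ M) (restr_type L q M) \<longleftrightarrow> (\<forall>\<^sub>F m in U. m \<in> B \<inter> univ M)"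
        by (rule in_p[OF \<delta>(1)]) (use \<delta> elem_ext_holds[OF MC \<delta>(1)] in auto)
      also have "\<dots> \<longleftrightarrow> (\<forall>\<^sub>F m in U. m \<in> B)"
        by (rule eventually_cong[OF U(2)]) simp
      also have "\<dots> \<longleftrightarrow> \<beta> \<in> q"
      proof -
        \<comment> \<open>\<open>\<chi>\<close> selects the formula or its negation, whichever is in
          \<open>q\<close>. Finite satisfiability yields one \<open>h\<close> in \<open>N\<close>
          deciding \<open>\<beta>\<close> and all the translates as \<open>q\<close> does.\<close>
        define \<chi> where "\<chi> \<theta> = (if \<theta> \<in> q then \<theta> else Neg \<theta>)" for \<theta>
        have "\<chi> \<theta> \<in> q" if "\<theta> \<in> fms L (univ N) 1" for \<theta>
          using types1_Neg[OF q that] by (simp add: \<chi>_def)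
        then have "insert (\<chi> \<beta>) ((\<lambda>c. \<chi> (inst [1 \<mapsto> inv\<^bsub>?G\<^esub> c] \<psi>)) ` S) \<subseteq> q"
          using instN \<beta>(1) by blast
        moreover have "finite (insert (\<chi> \<beta>) ((\<lambda>c. \<chi> (inst [1 \<mapsto> inv\<^bsub>?G\<^esub> c] \<psi>)) ` S))"
          using S(1) by simp
        ultimately obtain h where
          "realizes N h (insert (\<chi> \<beta>) ((\<lambda>c. \<chi> (inst [1 \<mapsto> inv\<^bsub>?G\<^esub> c] \<psi>)) ` S))"
          using q unfolding types1_def fin_satisfiable_def by blast
        moreover have "holds N (\<chi> \<theta>) [h] \<Longrightarrow> holds N \<theta> [h] \<longleftrightarrow> \<theta> \<in> q" for \<theta>
          by (auto simp: \<chi>_def holds_def split: if_splits)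
        ultimately have h: "h \<in> univ N" "h \<in> B \<longleftrightarrow> \<beta> \<in> q"
          "\<forall>c\<in>S. holds N (inst [1 \<mapsto> inv\<^bsub>?G\<^esub> c] \<psi>) [h] \<longleftrightarrow> inst [1 \<mapsto> inv\<^bsub>?G\<^esub> c] \<psi> \<in> q"
          using \<beta>(2) by (auto simp: realizes_def)
        have "\<forall>\<^sub>F m in U. \<forall>c\<in>S. holds C \<psi> [m, inv\<^bsub>?G\<^esub> c] \<longleftrightarrow> inst [1 \<mapsto> inv\<^bsub>?G\<^esub> c] \<psi> \<in> q"
        proof (rule eventually_ball_finite[OF S(1)], rule ballI)
          fix c assume "c \<in> S"
          then have "inst [1 \<mapsto> inv\<^bsub>?G\<^esub> c] \<psi> \<in> q \<longleftrightarrow> (\<forall>\<^sub>F m in U. holds C \<psi> [m, inv\<^bsub>?G\<^esub> c])"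
            using agree inv S(2) by blast
          then show "\<forall>\<^sub>F m in U. holds C \<psi> [m, inv\<^bsub>?G\<^esub> c] \<longleftrightarrow> inst [1 \<mapsto> inv\<^bsub>?G\<^esub> c] \<psi> \<in> q"
            by (cases "inst [1 \<mapsto> inv\<^bsub>?G\<^esub> c] \<psi> \<in> q") (simp_all add: ultra_not[OF U(1)])
        qed
        \<comment> \<open>By \<open>agree\<close>, almost every \<open>m\<close> lies in the same
          translates as \<open>h\<close>, and \<open>B\<close> respects these.\<close>
        with U(2) have "\<forall>\<^sub>F m in U. m \<in> B \<longleftrightarrow> h \<in> B"
        proof (rule eventually_elim2)
          fix m assume m: "m \<in> univ M"
            "\<forall>c\<in>S. holds C \<psi> [m, inv\<^bsub>?G\<^esub> c] \<longleftrightarrow> inst [1 \<mapsto> inv\<^bsub>?G\<^esub> c] \<psi> \<in> q"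
          then have mN: "m \<in> univ N" using MNs by blast
          have "holds N \<psi> [m, inv\<^bsub>?G\<^esub> c] \<longleftrightarrow> holds N \<psi> [h, inv\<^bsub>?G\<^esub> c]" if "c \<in> S" for c
          proof -
            have "inv\<^bsub>?G\<^esub> c \<in> univ N" using inv S(2) that by blast
            then show ?thesis
              using NC_holds[OF mN] m(2) h(3) that unfolding holds_inst_1[OF fms(2)] by blast
          qed
          then show "m \<in> B \<longleftrightarrow> h \<in> B" using atoms[OF mN h(1)] atoms[OF h(1) mN] by blast
        qed
        then have "(\<forall>\<^sub>F m in U. m \<in> B) \<longleftrightarrow> (\<forall>\<^sub>F m in U. h \<in> B)"
          using eventually_subst by fastforce
        also have "\<dots> \<longleftrightarrow> h \<in> B"
          using U(1) by (simp add: ultra_def eventually_const_iff)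
        finally show ?thesis using h(2) by simp
      qed
      finally show "set_in_type N (dset N \<mu> s (sharp L M N A)) q \<longleftrightarrow>
          set_in_type M (dset N \<mu> s (sharp L M N A) \<inter> univ M) (restr_type L q M)"
        using Bq by (simp add: B_def)
    qed
  qed
qed

end

theorem theorem4p3:
  fixes L :: "('f, 'r) lang"
    and T :: "('f, 'r, 'a) fm set"
    and M N C :: "('f, 'r, 'a) str"
    and \<mu> :: "('f, 'r, 'a) fm"
    and \<Phi> \<Psi> :: "'a set \<Rightarrow> ('f, 'r, 'a) fm"
    and q :: "('f, 'r, 'a) fm set"
  assumes "is_theory L T" and "stable L T"
    and "models L M T"
    and "defines_group L M \<mu>"
    and "elem_ext L M N"
    and "elem_ext L N C" and "saturated_above L C (univ N)"
    and "\<And>A. A \<in> Def L M \<Longrightarrow> expresses_left L M \<mu> A (\<Phi> A)"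
    and "\<And>A. A \<in> Def L M \<Longrightarrow> expresses_right L M \<mu> A (\<Psi> A)"
    and "q \<in> types1 L N"
  shows "(weak_heir L M N \<mu> q \<longleftrightarrow> \<not> forks L C (univ M) (restr_to N q (\<Phi> ` Def L M))) \<and>
         (weak_coheir L M N \<mu> q \<longleftrightarrow> \<not> forks L C (univ M) (restr_to N q (\<Psi> ` Def L M)))"
proof -
  note MN = assms(5) and NC = assms(6) and sat = assms(7) and q = assms(10)
  have MC: "elem_ext L M C" by (rule elem_ext_trans[OF MN NC])
  interpret stable_extension L M C
  proof
    show "orderless (univ C) (univ C) (\<lambda>a b. R C [a, b])" if "expressible L (univ C) 2 R" for R
      by (rule stable_orderless[OF assms(2) models_elem_ext[OF assms(1,3) MC] that])
  qed (rule MC)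
  \<comment> \<open>The coheir part takes limits inside \<open>N\<close> along arbitrary types
    \<open>s\<close>, so orders must be excluded there as well.\<close>
  have stabN: "orderless (univ N) (univ N) (\<lambda>a b. R N [a, b])" if "expressible L (univ N) 2 R" for R
    by (rule stable_orderless[OF assms(2) models_elem_ext[OF assms(1,3) MN] that])
  have \<mu>: "\<mu> \<in> fms L (univ M) 3" using assms(4) by (simp add: defines_group_def)
  define e where "e = \<one>\<^bsub>group_of M \<mu>\<^esub>"
  have GM: "group_graph M \<mu> e" unfolding e_def by (rule defines_group_graph[OF assms(4)])
  have GN: "group_graph N \<mu> e" by (rule group_graph_elem_ext[OF MN \<mu> GM])
  \<comment> \<open>One ultrafilter inducing \<open>p\<close> serves both parts.\<close>
  obtain U where U: "ultra U" "\<forall>\<^sub>F m in U. m \<in> univ M"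
    "\<forall>\<theta>\<in>fms L (univ M) 1. \<theta> \<in> q \<longleftrightarrow> (\<forall>\<^sub>F m in U. holds C \<theta> [m])"
    by (rule type_ultra[OF MN MC q])
  have "\<Phi> ` Def L M \<subseteq> fms L (univ M) 2" "\<Psi> ` Def L M \<subseteq> fms L (univ M) 2"
    using assms(8,9) by (auto simp: expresses_left_def expresses_right_def)
  note nf = this[THEN not_forks_iff_limit[OF sat NC MN q U]]
  have "weak_heir L M N \<mu> q \<longleftrightarrow> \<not> forks L C (univ M) (restr_to N q (\<Phi> ` Def L M))"
    unfolding weak_heir_def nf
    by (simp only: ball_simps) (intro ball_cong refl weak_heir_iff_limit[OF MN NC \<mu> GM GN q U] assms(8))
  moreover have coheir: "(\<forall>s\<in>types1 L N. set_in_type N (dset N \<mu> s (sharp L M N A)) q \<longleftrightarrow>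
       set_in_type M (dset N \<mu> s (sharp L M N A) \<inter> univ M) (restr_type L q M)) \<longleftrightarrow>
    (\<forall>b\<in>univ N. inst [1 \<mapsto> b] (\<Psi> A) \<in> q \<longleftrightarrow> (\<forall>\<^sub>F m in U. holds C (\<Psi> A) [m, b]))"
    if "A \<in> Def L M" for A
    by (rule weak_coheir_iff_limit[OF MN NC _ \<mu> GM GN q U that assms(8)[OF that] assms(9)[OF that]])
      (rule stabN)
  have "weak_coheir L M N \<mu> q \<longleftrightarrow> \<not> forks L C (univ M) (restr_to N q (\<Psi> ` Def L M))"
    unfolding weak_coheir_def nf
    by (simp only: ball_simps) (intro ball_cong refl coheir)
  ultimately show ?thesis ..
qed

end
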